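(* Every nice graph is algebraic $(1,5)$-choosable.
   Context: All graphs are finite and simple, with vertex set $V=\{1,\dots,n\}$; an edge is a $2$-element subset $\{i,j\}$ of $V$. For $i\in V$, $E(i)$ is the set of edges incident to $i$. An edge $\{i,j\}$ is isolated if both $i$ and $j$ have degree $1$; a graph is nice if it has no isolated edges. For a graph $G=(V,E)$ define the polynomial in variables $x_e$ ($e\in E$) $$P_G=\prod_{\{i,j\}\in E,\ i<j}\Big(\sum_{e\in E(i)}x_e-\sum_{e\in E(j)}x_e\Big)$$ (the empty product is $1$). For $K:E\to\mathbb{N}$ write $x^K=\prod_{e\in E}x_e^{K(e)}$, and let $\mathrm{mon}(P)$ be the set of monomials $x^K$ with nonzero coefficient in $P$. For a positive integer $b$, $G$ is algebraic $(1,b)$-choosable if there is $K:E\to\mathbb{N}$ with $\sum_{e\in E}K(e)=|E|$ and $K(e)\le b-1$ for all $e\in E$ such that $x^K\in\mathrm{mon}(P_G)$. (By the Combinatorial Nullstellensatz this implies total weight $(1,b)$-choosability.) *)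

theory Defs
  imports Main "HOL-Library.Poly_Mapping"
begin

definition simple_graph :: "nat \<Rightarrow> nat set set \<Rightarrow> bool" where
  "simple_graph n E \<longleftrightarrow> (\<forall>e\<in>E. e \<subseteq> {1..n} \<and> card e = 2)"

definition inc_edges :: "nat set set \<Rightarrow> nat \<Rightarrow> nat set set" where
  "inc_edges E i = {e\<in>E. i \<in> e}"

definition deg :: "nat set set \<Rightarrow> nat \<Rightarrow> nat" where
  "deg E i = card (inc_edges E i)"

definition isolated_edge :: "nat set set \<Rightarrow> nat set \<Rightarrow> bool" where
  "isolated_edge E e \<longleftrightarrow> e \<in> E \<and> (\<forall>v\<in>e. deg E v = 1)"

definition nice :: "nat set set \<Rightarrow> bool" where
  "nice E \<longleftrightarrow> \<not> (\<exists>e\<in>E. isolated_edge E e)"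

text \<open>Multivariate integer polynomials in variables indexed by edges:
  monomials are finitely supported exponent maps (edge to nat),
  polynomials are finitely supported coefficient maps on monomials.\<close>
type_synonym epoly = "(nat set \<Rightarrow>\<^sub>0 nat) \<Rightarrow>\<^sub>0 int"

definition var :: "nat set \<Rightarrow> epoly" where
  "var e = Poly_Mapping.single (Poly_Mapping.single e 1) 1"

definition P_G :: "nat set set \<Rightarrow> epoly" where
  "P_G E = (\<Prod>e\<in>E. (\<Sum>f\<in>inc_edges E (Min e). var f) - (\<Sum>f\<in>inc_edges E (Max e). var f))"

definition alg_choosable :: "nat set set \<Rightarrow> nat \<Rightarrow> bool" where
  "alg_choosable E b \<longleftrightarrow> (\<exists>K :: nat set \<Rightarrow>\<^sub>0 nat.
     Poly_Mapping.keys K \<subseteq> E \<and> (\<Sum>e\<in>E. Poly_Mapping.lookup K e) = card E \<and> (\<forall>e\<in>E. Poly_Mapping.lookup K e \<le> b - 1)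
     \<and> Poly_Mapping.lookup (P_G E) K \<noteq> 0)"

end

theory Submission
  imports Defs "HOL-Combinatorics.Permutations"
begin

text \<open>
  The coefficient of \<open>x\<^sup>K\<close> in \<open>P_G\<close> is, up to a positive factor, the permanent of the matrix whose rows are
  the linear factors and whose columns are edges, each edge \<open>e\<close> taken \<open>K e\<close> times.  By multilinearity it
  suffices to find columns that are integer combinations of edges, with each edge occurring in at most
  four columns, such that the permanent does not vanish.  An edge acts as the indicator of its two
  ends, and a column acts as a function on the vertices.

  Let \<open>X\<close> be a maximum independent set.  The columns of edges outside \<open>X\<close> are chosen triangular with
  respect to an ordering of the vertices, each rooted at a cut edge \<open>{\<gamma> u, u}\<close>.  The columns of cut
  edges are turned into functions \<open>1\<^sub>a \<plusminus> 1\<^sub>b\<close> supported on \<open>X\<close>, in pairs that agree up to sign, by routing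
  them along a minimum set \<open>J\<close> of edges with prescribed degree parities; their permanent is a sum of
  squares.  Minimality of \<open>J\<close> rules out trails on which \<open>1\<^sub>a - 1\<^sub>b\<close> would vanish and, with maximality
  of \<open>X\<close> and the marriage theorem, leaves enough room on the cut edges \<open>{\<gamma> u, u}\<close>.  If \<open>X\<close> is a single
  vertex, the graph is complete and explicit columns work.
\<close>

section \<open>Permanents\<close>

text \<open>The bound four is a budget. A stub that is not cancelled puts its cut edge into two
  columns, its own and its partner's. An edge used for routing lies in at most two columns, those of
  the two stubs at the ends of one trail. A cut edge that is also routed along is therefore full,
  while the triangular columns need room on the edges \<open>{\<gamma> u, u}\<close> and the
  unpaired column may need one more unit. Room is gained in three ways:
  \<open>{\<gamma> u, u}\<close> is not in \<open>J\<close>, or its stub is moved into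
  \<open>X\<close> and cancels, or \<open>u\<close> comes so early in the ordering that no
  triangular column is rooted there.

  The parities prescribed for \<open>J\<close> are those of the numbers of stubs, since a
  decomposition into trails has its ends exactly at the nodes of odd degree. Pairs agreeing up to
  sign turn the permanent into a squared norm. It is positive because taking the larger label in
  each pair is the only choice that attains the largest sum of labels. A column 1_a - 1_a is then
  the one remaining danger.\<close>

definition permanent :: "'a set \<Rightarrow> ('a \<Rightarrow> 'a \<Rightarrow> int) \<Rightarrow> int" where
  "permanent R A = (\<Sum>\<sigma> | \<sigma> permutes R. \<Prod>r\<in>R. A r (\<sigma> r))"

lemma permanent_transpose:
  assumes "finite R"
  shows "permanent R A = (\<Sum>\<sigma> | \<sigma> permutes R. \<Prod>s\<in>R. A (\<sigma> s) s)"
proof -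
  have "permanent R A = (\<Sum>\<sigma> | \<sigma> permutes R. \<Prod>r\<in>R. A r (inv \<sigma> r))"
    unfolding permanent_def by (rule sum_permutations_inverse)
  also have "\<dots> = (\<Sum>\<sigma> | \<sigma> permutes R. \<Prod>s\<in>R. A (\<sigma> s) s)"
  proof (rule sum.cong[OF refl])
    fix \<sigma> assume "\<sigma> \<in> {\<sigma>. \<sigma> permutes R}"
    then have p: "\<sigma> permutes R" by simp
    show "(\<Prod>r\<in>R. A r (inv \<sigma> r)) = (\<Prod>s\<in>R. A (\<sigma> s) s)"
      by (subst prod.permute[OF p]) (simp add: o_def permutes_inverses[OF p])
  qed
  finally show ?thesis .
qed

lemma permanent_row_factor:
  assumes "\<And>r s. r \<in> R \<Longrightarrow> s \<in> R \<Longrightarrow> A r s = c r * B r s"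
  shows "permanent R A = (\<Prod>r\<in>R. c r) * permanent R B"
proof -
  have "(\<Prod>r\<in>R. A r (\<sigma> r)) = (\<Prod>r\<in>R. c r) * (\<Prod>r\<in>R. B r (\<sigma> r))" if "\<sigma> permutes R" for \<sigma>
    unfolding prod.distrib[symmetric]
    using that assms by (intro prod.cong) (auto simp: permutes_in_image)
  then show ?thesis
    unfolding permanent_def sum_distrib_left by (intro sum.cong) auto
qed

lemma permanent_cong:
  assumes "\<And>r s. r \<in> R \<Longrightarrow> s \<in> R \<Longrightarrow> A r s = B r s"
  shows "permanent R A = permanent R B"
  using permanent_row_factor[of R A "\<lambda>_. 1" B] assms by simp

text \<open>A permutation with nonzero product maps \<open>Q\<close> into \<open>Q\<close>, hence by
  finiteness onto \<open>Q\<close>, and so \<open>R\<close> onto \<open>R\<close>; it splits into a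
  permutation of each block.\<close>

lemma permanent_block_triangular:
  assumes fin: "finite R" "finite Q" and disj: "R \<inter> Q = {}"
    and zero: "\<And>r s. r \<in> Q \<Longrightarrow> s \<in> R \<Longrightarrow> A r s = 0"
  shows "permanent (R \<union> Q) A = permanent R A * permanent Q A"
proof -
  let ?f = "\<lambda>\<sigma>. \<Prod>r\<in>R \<union> Q. A r (\<sigma> r)"
  let ?P = "{\<sigma>. \<sigma> permutes R} \<times> {\<sigma>. \<sigma> permutes Q}"
  let ?S = "{\<sigma>. \<sigma> permutes (R \<union> Q) \<and> \<sigma> ` Q \<subseteq> Q}"
  have "permanent (R \<union> Q) A = sum ?f ?S"
    unfolding permanent_def
  proof (rule sum.mono_neutral_right)
    show "finite {\<sigma>. \<sigma> permutes R \<union> Q}"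
      using fin by (simp add: finite_permutations)
    show "\<forall>\<sigma>\<in>{\<sigma>. \<sigma> permutes R \<union> Q} - ?S. ?f \<sigma> = 0"
    proof
      fix \<sigma> assume "\<sigma> \<in> {\<sigma>. \<sigma> permutes R \<union> Q} - ?S"
      then obtain r where "\<sigma> permutes R \<union> Q" "r \<in> Q" "\<sigma> r \<notin> Q" by auto
      then have "\<sigma> r \<in> R" by (metis Un_iff permutes_in_image)
      then have "A r (\<sigma> r) = 0" using zero \<open>r \<in> Q\<close> by auto
      then show "?f \<sigma> = 0" using fin \<open>r \<in> Q\<close> by (intro prod_zero) auto
    qed
  qed auto
  also have "\<dots> = (\<Sum>(\<alpha>, \<beta>)\<in>?P. (\<Prod>r\<in>R. A r (\<alpha> r)) * (\<Prod>r\<in>Q. A r (\<beta> r)))"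
  proof (rule sum.reindex_bij_witness[where
        i = "\<lambda>(\<alpha>, \<beta>). \<alpha> \<circ> \<beta>" and
        j = "\<lambda>\<sigma>. (\<lambda>x. if x \<in> R then \<sigma> x else x, \<lambda>x. if x \<in> Q then \<sigma> x else x)"])
    fix \<sigma> assume \<sigma>: "\<sigma> \<in> ?S"
    then have p: "\<sigma> permutes R \<union> Q" by simp
    have Q: "\<sigma> ` Q = Q"
      using \<sigma> fin(2) by (metis (mono_tags, lifting) endo_inj_surj mem_Collect_eq permutes_inj_on)
    have R: "\<sigma> ` R = R"
    proof -
      have "\<sigma> ` R = \<sigma> ` ((R \<union> Q) - Q)" using disj by (metis Diff_cancel Diff_triv Un_Diff Un_empty_right)
      also have "\<dots> = (R \<union> Q) - Q"
        by (simp add: image_set_diff[OF permutes_inj[OF p]] permutes_image[OF p] Q)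
      finally show ?thesis using disj by auto
    qed
    have inj: "inj \<sigma>" using p by (rule permutes_inj)
    have pr: "(\<lambda>x. if x \<in> T then \<sigma> x else x) permutes T" if "\<sigma> ` T = T" for T
      using that inj by (intro bij_imp_permutes) (auto simp: bij_betw_def inj_on_def)
    show "(\<lambda>\<sigma>. (\<lambda>x. if x \<in> R then \<sigma> x else x, \<lambda>x. if x \<in> Q then \<sigma> x else x)) \<sigma> \<in> ?P"
      using pr[OF R] pr[OF Q] by simp
    show "(\<lambda>(\<alpha>, \<beta>). \<alpha> \<circ> \<beta>) ((\<lambda>\<sigma>. (\<lambda>x. if x \<in> R then \<sigma> x else x, \<lambda>x. if x \<in> Q then \<sigma> x else x)) \<sigma>) = \<sigma>"
    proof
      fix x
      have "x \<notin> R \<Longrightarrow> x \<notin> Q \<Longrightarrow> \<sigma> x = x" using p by (simp add: permutes_not_in)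
      moreover have "x \<in> Q \<Longrightarrow> \<sigma> x \<notin> R" using Q disj by auto
      ultimately show "(\<lambda>(\<alpha>, \<beta>). \<alpha> \<circ> \<beta>) ((\<lambda>\<sigma>. (\<lambda>x. if x \<in> R then \<sigma> x else x, \<lambda>x. if x \<in> Q then \<sigma> x else x)) \<sigma>) x = \<sigma> x"
        using disj by auto
    qed
    show "(case (\<lambda>\<sigma>. (\<lambda>x. if x \<in> R then \<sigma> x else x, \<lambda>x. if x \<in> Q then \<sigma> x else x)) \<sigma> of
        (\<alpha>, \<beta>) \<Rightarrow> (\<Prod>r\<in>R. A r (\<alpha> r)) * (\<Prod>r\<in>Q. A r (\<beta> r))) = ?f \<sigma>"
      using fin disj by (simp add: prod.union_disjoint)
  next
    fix ab assume "ab \<in> ?P"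
    then obtain \<alpha> \<beta> where ab: "ab = (\<alpha>, \<beta>)" "\<alpha> permutes R" "\<beta> permutes Q" by auto
    have bQ: "\<beta> x \<in> Q \<longleftrightarrow> x \<in> Q" for x using ab by (simp add: permutes_in_image)
    have aQ: "\<alpha> x = x" if "x \<notin> R" for x using ab that by (simp add: permutes_not_in)
    have bR: "\<beta> x = x" if "x \<notin> Q" for x using ab that by (simp add: permutes_not_in)
    have "(\<alpha> \<circ> \<beta>) permutes R \<union> Q"
      by (meson ab permutes_compose permutes_subset sup_ge1 sup_ge2)
    moreover have "(\<alpha> \<circ> \<beta>) ` Q \<subseteq> Q"
    proof safe
      fix x assume "x \<in> Q"
      then have "\<beta> x \<in> Q" "\<beta> x \<notin> R" using bQ[of x] disj by blast+
      then show "(\<alpha> \<circ> \<beta>) x \<in> Q" using aQ[of "\<beta> x"] by simp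
    qed
    ultimately show "(\<lambda>(\<alpha>, \<beta>). \<alpha> \<circ> \<beta>) ab \<in> ?S" using ab(1) by simp
    show "(\<lambda>\<sigma>. (\<lambda>x. if x \<in> R then \<sigma> x else x, \<lambda>x. if x \<in> Q then \<sigma> x else x)) ((\<lambda>(\<alpha>, \<beta>). \<alpha> \<circ> \<beta>) ab) = ab"
    proof -
      have "(if x \<in> R then \<alpha> (\<beta> x) else x) = \<alpha> x" for x
        using bR[of x] aQ[of x] disj by (metis disjoint_iff)
      moreover have "(if x \<in> Q then \<alpha> (\<beta> x) else x) = \<beta> x" for x
        using bR[of x] bQ[of x] aQ[of "\<beta> x"] disj by (metis disjoint_iff)
      ultimately show ?thesis unfolding ab(1) prod.case comp_def by (simp add: fun_eq_iff)
    qed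
  qed
  also have "\<dots> = permanent R A * permanent Q A"
    unfolding permanent_def by (simp add: sum_product sum.cartesian_product)
  finally show ?thesis .
qed

text \<open>In a nonzero term the rank never drops from \<open>r\<close> to
  \<open>\<sigma> r\<close>. The total rank is preserved, so no rank changes at all. Every surviving
  term then equals the product of the \<open>c r\<close>, and no cancellation is possible whatever
  their signs.\<close>

lemma permanent_ranked:
  fixes rk :: "'a \<Rightarrow> nat"
  assumes fin: "finite R"
    and low: "\<And>r s. r \<in> R \<Longrightarrow> s \<in> R \<Longrightarrow> A r s \<noteq> 0 \<Longrightarrow> rk r \<le> rk s"
    and eq: "\<And>r s. r \<in> R \<Longrightarrow> s \<in> R \<Longrightarrow> rk r = rk s \<Longrightarrow> A r s = c r"
    and nz: "\<And>r. r \<in> R \<Longrightarrow> c r \<noteq> 0"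
  shows "permanent R A \<noteq> 0"
proof -
  let ?S = "{\<sigma>. \<sigma> permutes R \<and> (\<forall>r\<in>R. rk (\<sigma> r) = rk r)}"
  have finS: "finite ?S" using fin by (auto intro: finite_subset[OF _ finite_permutations])
  have "permanent R A = (\<Sum>\<sigma>\<in>?S. \<Prod>r\<in>R. A r (\<sigma> r))"
    unfolding permanent_def
  proof (rule sum.mono_neutral_right)
    show "finite {\<sigma>. \<sigma> permutes R}" using fin by (simp add: finite_permutations)
    show "\<forall>\<sigma>\<in>{\<sigma>. \<sigma> permutes R} - ?S. (\<Prod>r\<in>R. A r (\<sigma> r)) = 0"
    proof
      fix \<sigma> assume \<sigma>: "\<sigma> \<in> {\<sigma>. \<sigma> permutes R} - ?S"
      then have p: "\<sigma> permutes R" by simp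
      have "\<exists>r\<in>R. A r (\<sigma> r) = 0"
      proof (rule ccontr)
        assume "\<not> ?thesis"
        then have le: "rk r \<le> rk (\<sigma> r)" if "r \<in> R" for r
          using that p low by (metis permutes_in_image)
        obtain r0 where "r0 \<in> R" "rk (\<sigma> r0) \<noteq> rk r0" using \<sigma> by auto
        then have "(\<Sum>r\<in>R. rk r) < (\<Sum>r\<in>R. rk (\<sigma> r))"
          using le[of r0] by (intro sum_strict_mono_ex1[OF fin] ballI le bexI[of _ r0]) simp_all
        also have "\<dots> = (\<Sum>r\<in>R. rk r)" using sum.permute[OF p, of rk] by (simp add: o_def)
        finally show False by simp
      qed
      then show "(\<Prod>r\<in>R. A r (\<sigma> r)) = 0" using fin by (auto intro: prod_zero)
    qed
  qed auto
  also have "\<dots> = (\<Sum>\<sigma>\<in>?S. \<Prod>r\<in>R. c r)"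
  proof (intro sum.cong prod.cong refl)
    fix \<sigma> r assume "\<sigma> \<in> ?S" "r \<in> R"
    then show "A r (\<sigma> r) = c r" using eq[of r "\<sigma> r"] permutes_in_image[of \<sigma> R r] by simp
  qed
  also have "\<dots> = of_nat (card ?S) * (\<Prod>r\<in>R. c r)" by simp
  also have "\<dots> \<noteq> 0"
  proof -
    have "id \<in> ?S" by simp
    then have "?S \<noteq> {}" by blast
    then have "int (card ?S) \<noteq> 0" using finS by simp
    moreover have "(\<Prod>r\<in>R. c r) \<noteq> 0" using nz prod_zero_iff[OF fin, of c] by blast
    ultimately show ?thesis by (simp only: mult_eq_0_iff) simp
  qed
  finally show ?thesis .
qed

text \<open>The permutations with a given composite \<open>f \<circ> \<sigma>\<close> form a coset
  of the stabiliser of \<open>f\<close>, so each rearrangement is hit equally often,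
  \<open>N\<close> times, where \<open>N\<close> is the order of the stabiliser.\<close>

lemma sum_permutes_rearrangement:
  fixes f :: "'a \<Rightarrow> 'b"
  assumes fin: "finite R"
  shows "\<exists>N::nat. N > 0 \<and> (\<forall>F :: ('a \<Rightarrow> 'b) \<Rightarrow> int. (\<Sum>\<sigma> | \<sigma> permutes R. F (restrict (f \<circ> \<sigma>) R)) =
       int N * (\<Sum>h | h \<in> extensional R \<and> image_mset h (mset_set R) = image_mset f (mset_set R). F h))"
proof -
  let ?H = "{h. h \<in> extensional R \<and> image_mset h (mset_set R) = image_mset f (mset_set R)}"
  let ?P = "{\<sigma>. \<sigma> permutes R}"
  let ?g = "\<lambda>\<sigma>. restrict (f \<circ> \<sigma>) R"
  define N where "N = card {\<sigma> \<in> ?P. ?g \<sigma> = ?g id}"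
  have finP: "finite ?P" using fin by (simp add: finite_permutations)
  have "N > 0"
  proof -
    have "id \<in> {\<sigma> \<in> ?P. ?g \<sigma> = ?g id}" by simp
    moreover have "finite {\<sigma> \<in> ?P. ?g \<sigma> = ?g id}" using finP by simp
    ultimately show ?thesis unfolding N_def card_gt_0_iff by blast
  qed
  have HH: "?H = ?g ` ?P"
  proof (intro equalityI subsetI)
    fix h assume h: "h \<in> ?H"
    then have "image_mset h (mset_set R) = image_mset f (mset_set R)" by simp
    then obtain p where p: "p permutes R" "\<forall>x\<in>R. h x = f (p x)"
      by (rule image_mset_eq_implies_permutes[OF fin])
    have "h = ?g p" using p(2) h by (auto simp: fun_eq_iff extensional_def)
    then show "h \<in> ?g ` ?P" using p(1) by auto
  next
    fix h assume "h \<in> ?g ` ?P"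
    then obtain p where p: "p permutes R" "h = ?g p" by auto
    have "image_mset h (mset_set R) = image_mset (f \<circ> p) (mset_set R)"
      using fin unfolding p(2) by (intro image_mset_cong) auto
    also have "\<dots> = image_mset f (mset_set R)"
      by (simp add: multiset.map_comp[symmetric] permutes_image_mset[OF p(1)])
    finally show "h \<in> ?H" using p(2) by auto
  qed
  have cardN: "card {\<sigma> \<in> ?P. ?g \<sigma> = ?g \<tau>} = N" if \<tau>: "\<tau> permutes R" for \<tau>
    unfolding N_def
  proof (rule bij_betw_same_card[of "\<lambda>\<sigma>. \<sigma> \<circ> inv \<tau>"], rule bij_betwI[where g = "\<lambda>\<sigma>. \<sigma> \<circ> \<tau>"])
    have i: "inv \<tau> permutes R" using \<tau> by (rule permutes_inv)
    show "(\<lambda>\<sigma>. \<sigma> \<circ> inv \<tau>) \<in> {\<sigma> \<in> ?P. ?g \<sigma> = ?g \<tau>} \<rightarrow> {\<sigma> \<in> ?P. ?g \<sigma> = ?g id}"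
    proof (rule funcsetI, unfold mem_Collect_eq, elim conjE, intro conjI)
      fix \<sigma> assume s: "\<sigma> permutes R" "?g \<sigma> = ?g \<tau>"
      show "(\<sigma> \<circ> inv \<tau>) permutes R" using i s(1) by (rule permutes_compose)
      have *: "f (\<sigma> x) = f (\<tau> x)" if "x \<in> R" for x
        using fun_cong[OF s(2), of x] that by simp
      have "f (\<sigma> (inv \<tau> x)) = f x" if "x \<in> R" for x
        using *[of "inv \<tau> x"] that permutes_in_image[OF i, of x] by (simp add: permutes_inverses[OF \<tau>])
      then show "?g (\<sigma> \<circ> inv \<tau>) = ?g id" by (simp add: restrict_def fun_eq_iff)
    qed
    show "(\<lambda>\<sigma>. \<sigma> \<circ> \<tau>) \<in> {\<sigma> \<in> ?P. ?g \<sigma> = ?g id} \<rightarrow> {\<sigma> \<in> ?P. ?g \<sigma> = ?g \<tau>}"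
    proof (rule funcsetI, unfold mem_Collect_eq, elim conjE, intro conjI)
      fix \<sigma> assume s: "\<sigma> permutes R" "?g \<sigma> = ?g id"
      show "(\<sigma> \<circ> \<tau>) permutes R" using \<tau> s(1) by (rule permutes_compose)
      have "f (\<sigma> x) = f x" if "x \<in> R" for x
        using fun_cong[OF s(2), of x] that by simp
      then show "?g (\<sigma> \<circ> \<tau>) = ?g \<tau>" using permutes_in_image[OF \<tau>] by (simp add: restrict_def fun_eq_iff)
    qed
    show "\<And>\<sigma>. \<sigma> \<circ> inv \<tau> \<circ> \<tau> = \<sigma>" "\<And>\<sigma>. \<sigma> \<circ> \<tau> \<circ> inv \<tau> = \<sigma>"
      using \<tau> by (simp_all add: comp_assoc permutes_inv_o)
  qed
  have "(\<Sum>\<sigma>\<in>?P. F (?g \<sigma>)) = int N * (\<Sum>h\<in>?H. F h)" for F :: "('a \<Rightarrow> 'b) \<Rightarrow> int"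
  proof -
    have "(\<Sum>\<sigma>\<in>?P. F (?g \<sigma>)) = (\<Sum>h\<in>?g ` ?P. \<Sum>\<sigma>\<in>{\<sigma> \<in> ?P. ?g \<sigma> = h}. F (?g \<sigma>))"
      by (rule sum.image_gen[OF finP])
    also have "\<dots> = (\<Sum>h\<in>?g ` ?P. int N * F h)"
    proof (rule sum.cong[OF refl])
      fix h assume "h \<in> ?g ` ?P"
      then obtain \<tau> where \<tau>: "\<tau> permutes R" "h = ?g \<tau>" by auto
      have "(\<Sum>\<sigma>\<in>{\<sigma> \<in> ?P. ?g \<sigma> = h}. F (?g \<sigma>)) = (\<Sum>\<sigma>\<in>{\<sigma> \<in> ?P. ?g \<sigma> = h}. F h)"
        by (intro sum.cong) auto
      also have "\<dots> = int N * F h" using cardN[OF \<tau>(1)] \<tau>(2) by simp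
      finally show "(\<Sum>\<sigma>\<in>{\<sigma> \<in> ?P. ?g \<sigma> = h}. F (?g \<sigma>)) = int N * F h" .
    qed
    finally show ?thesis by (simp add: HH sum_distrib_left)
  qed
  then show ?thesis using \<open>N > 0\<close> by (intro exI[of _ N] conjI allI)
qed

section \<open>From certificates to coefficients\<close>

text \<open>The coefficient of the variable of \<open>g\<close> in the linear factor of the edge
  \<open>r\<close>.\<close>

definition end_diff :: "nat set \<Rightarrow> nat set \<Rightarrow> int" where
  "end_diff r g = of_bool (Min r \<in> g) - of_bool (Max r \<in> g)"

definition form :: "nat set set \<Rightarrow> (nat set \<Rightarrow> int) \<Rightarrow> nat \<Rightarrow> int" where
  "form E c v = (\<Sum>g\<in>E. c g * of_bool (v \<in> g))"

definition load :: "nat set set \<Rightarrow> (nat set \<Rightarrow> nat set \<Rightarrow> int) \<Rightarrow> nat set \<Rightarrow> nat" where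
  "load R c g = card {s \<in> R. c s g \<noteq> 0}"

text \<open>Load at most four is the exponent bound \<open>b - 1\<close> for \<open>b = 5\<close>.
  Rows and columns are both indexed by \<open>E\<close> because the degree of the monomial equals
  the number of factors.\<close>

definition certified :: "nat set set \<Rightarrow> bool" where
  "certified E \<longleftrightarrow> (\<exists>c. (\<forall>g\<in>E. load E c g \<le> 4) \<and>
     permanent E (\<lambda>r s. form E (c s) (Min r) - form E (c s) (Max r)) \<noteq> 0)"

definition edge_monomial :: "nat set set \<Rightarrow> (nat set \<Rightarrow> nat set) \<Rightarrow> (nat set \<Rightarrow>\<^sub>0 nat)" where
  "edge_monomial E h = (\<Sum>r\<in>E. Poly_Mapping.single (h r) 1)"

lemma lookup_edge_monomial:
  "finite E \<Longrightarrow> Poly_Mapping.lookup (edge_monomial E h) g = card {r\<in>E. h r = g}"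
  by (simp add: edge_monomial_def lookup_sum lookup_single when_def sum.If_cases Int_def)

lemma prod_single:
  "finite E \<Longrightarrow> (\<Prod>r\<in>E. Poly_Mapping.single (m r) (a r)) =
    Poly_Mapping.single (\<Sum>r\<in>E. m r) (\<Prod>r\<in>E. a r :: int)"
  by (induction E rule: finite_induct) (simp_all add: mult_single)

text \<open>Expanding the product picks one edge \<open>h r\<close> from the factor of every edge
  \<open>r\<close>.\<close>

lemma lookup_P_G:
  assumes fin: "finite E"
  shows "Poly_Mapping.lookup (P_G E) K =
    (\<Sum>h | h \<in> E \<rightarrow>\<^sub>E E \<and> edge_monomial E h = K. \<Prod>r\<in>E. end_diff r (h r))"
proof -
  have lin: "(\<Sum>f\<in>inc_edges E i. var f) - (\<Sum>f\<in>inc_edges E j. var f) =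
      (\<Sum>f\<in>E. Poly_Mapping.single (Poly_Mapping.single f 1) (of_bool (i \<in> f) - of_bool (j \<in> f)))" for i j
  proof -
    have "(\<Sum>f\<in>inc_edges E i. var f) =
        (\<Sum>f\<in>E. Poly_Mapping.single (Poly_Mapping.single f 1) (of_bool (i \<in> f)))" for i
      unfolding inc_edges_def var_def using fin
      by (intro sum.mono_neutral_cong_left) auto
    then show ?thesis
      by (simp add: sum_subtractf[symmetric] single_diff[symmetric])
  qed
  have "P_G E = (\<Prod>r\<in>E. \<Sum>f\<in>E. Poly_Mapping.single (Poly_Mapping.single f 1) (end_diff r f))"
    unfolding P_G_def lin end_diff_def ..
  also have "\<dots> = (\<Sum>h\<in>E \<rightarrow>\<^sub>E E. \<Prod>r\<in>E. Poly_Mapping.single (Poly_Mapping.single (h r) 1) (end_diff r (h r)))"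
    using fin by (intro prod_sum_PiE) auto
  also have "\<dots> = (\<Sum>h\<in>E \<rightarrow>\<^sub>E E. Poly_Mapping.single (edge_monomial E h) (\<Prod>r\<in>E. end_diff r (h r)))"
    using fin by (simp add: prod_single edge_monomial_def)
  finally have "Poly_Mapping.lookup (P_G E) K =
      (\<Sum>h\<in>E \<rightarrow>\<^sub>E E. if edge_monomial E h = K then \<Prod>r\<in>E. end_diff r (h r) else 0)"
    by (simp add: lookup_sum lookup_single when_def)
  then show ?thesis
    using fin by (simp add: sum.If_cases finite_PiE Int_def)
qed

lemma edge_monomial_eq_iff:
  assumes "finite E"
  shows "edge_monomial E h = edge_monomial E g \<longleftrightarrow> image_mset h (mset_set E) = image_mset g (mset_set E)"
proof -
  have "count (image_mset h (mset_set E)) x = Poly_Mapping.lookup (edge_monomial E h) x" for h x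
    using assms by (induction E rule: finite_induct)
      (simp_all add: edge_monomial_def lookup_add lookup_single when_def)
  then show ?thesis
    by (metis multiset_eqI poly_mapping_eqI)
qed

text \<open>Expanding all columns by multilinearity gives a combination of permanents whose column
  \<open>s\<close> is a single edge \<open>g s\<close>. Some term is nonzero; its coefficient
  requires \<open>c s (g s) \<noteq> 0\<close> for all \<open>s\<close>, so an edge is chosen at
  most as often as its load. By counting rearrangements, the permanent of that term is a positive
  multiple of the coefficient of \<open>edge_monomial E g\<close>.\<close>

lemma certified_imp_alg_choosable:
  assumes fin: "finite E" and cert: "certified E"
  shows "alg_choosable E 5"
proof -
  obtain c where load: "\<forall>g\<in>E. load E c g \<le> 4"
    and nz: "permanent E (\<lambda>r s. form E (c s) (Min r) - form E (c s) (Max r)) \<noteq> 0"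
    using cert unfolding certified_def by blast
  have "permanent E (\<lambda>r s. form E (c s) (Min r) - form E (c s) (Max r)) =
      (\<Sum>\<sigma> | \<sigma> permutes E. \<Prod>s\<in>E. \<Sum>g\<in>E. c s g * end_diff (\<sigma> s) g)"
    unfolding permanent_transpose[OF fin] form_def end_diff_def
    by (simp add: sum_subtractf[symmetric] right_diff_distrib)
  also have "\<dots> = (\<Sum>\<sigma> | \<sigma> permutes E. \<Sum>g\<in>E \<rightarrow>\<^sub>E E. \<Prod>s\<in>E. c s (g s) * end_diff (\<sigma> s) (g s))"
    using fin by (intro sum.cong refl prod_sum_PiE) auto
  also have "\<dots> = (\<Sum>g\<in>E \<rightarrow>\<^sub>E E. (\<Prod>s\<in>E. c s (g s)) * permanent E (\<lambda>r s. end_diff r (g s)))"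
    unfolding permanent_transpose[OF fin] by (subst sum.swap) (simp add: prod.distrib sum_distrib_left)
  finally have "(\<Sum>g\<in>E \<rightarrow>\<^sub>E E. (\<Prod>s\<in>E. c s (g s)) * permanent E (\<lambda>r s. end_diff r (g s))) \<noteq> 0"
    using nz by simp
  then obtain g where g: "g \<in> E \<rightarrow>\<^sub>E E" "(\<Prod>s\<in>E. c s (g s)) \<noteq> 0" "permanent E (\<lambda>r s. end_diff r (g s)) \<noteq> 0"
    by (metis (no_types, lifting) mult_eq_0_iff sum.neutral)
  obtain N :: nat where N: "N > 0"
    "\<forall>F :: (nat set \<Rightarrow> nat set) \<Rightarrow> int. (\<Sum>\<sigma> | \<sigma> permutes E. F (restrict (g \<circ> \<sigma>) E)) =
       int N * (\<Sum>h | h \<in> extensional E \<and> image_mset h (mset_set E) = image_mset g (mset_set E). F h)"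
    using sum_permutes_rearrangement[OF fin, of g] by (elim exE conjE)
  let ?K = "edge_monomial E g"
  have "permanent E (\<lambda>r s. end_diff r (g s)) =
      (\<Sum>\<sigma> | \<sigma> permutes E. \<Prod>r\<in>E. end_diff r (restrict (g \<circ> \<sigma>) E r))"
    unfolding permanent_def by simp
  also have "\<dots> = int N * (\<Sum>h | h \<in> extensional E \<and> image_mset h (mset_set E) = image_mset g (mset_set E).
      \<Prod>r\<in>E. end_diff r (h r))"
    by (rule N(2)[rule_format])
  also have "{h. h \<in> extensional E \<and> image_mset h (mset_set E) = image_mset g (mset_set E)} =
      {h. h \<in> E \<rightarrow>\<^sub>E E \<and> edge_monomial E h = ?K}"
  proof -
    have "h ` E \<subseteq> E" if "image_mset h (mset_set E) = image_mset g (mset_set E)" for h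
    proof -
      have "h ` E = g ` E" using arg_cong[OF that, of set_mset] fin by simp
      then show ?thesis using g(1) by auto
    qed
    then show ?thesis by (auto simp: edge_monomial_eq_iff[OF fin] PiE_def)
  qed
  finally have "Poly_Mapping.lookup (P_G E) ?K \<noteq> 0"
    using g(3) by (auto simp: lookup_P_G[OF fin])
  moreover have "Poly_Mapping.lookup ?K e \<le> 5 - 1" if "e \<in> E" for e
  proof -
    have "Poly_Mapping.lookup ?K e \<le> load E c e"
      unfolding lookup_edge_monomial[OF fin] load_def
      using fin g(2) by (intro card_mono) auto
    then show ?thesis using load that by fastforce
  qed
  moreover have "Poly_Mapping.keys ?K \<subseteq> E"
  proof
    fix x assume "x \<in> Poly_Mapping.keys ?K"
    then have "card {r\<in>E. g r = x} \<noteq> 0" by (simp add: in_keys_iff lookup_edge_monomial[OF fin])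
    then show "x \<in> E" using g(1) by (metis (mono_tags, lifting) PiE_mem card.empty empty_Collect_eq)
  qed
  moreover have "(\<Sum>e\<in>E. Poly_Mapping.lookup ?K e) = card E"
  proof -
    have "card E = (\<Sum>e\<in>E. card {r\<in>E. g r = e})"
      using g(1) fin by (subst card_eq_sum, subst sum.group[symmetric, of _ E g]) auto
    then show ?thesis by (simp add: lookup_edge_monomial[OF fin])
  qed
  ultimately show ?thesis unfolding alg_choosable_def by blast
qed

section \<open>Positivity of the block of a signed pairing\<close>

lemma involution_transversal:
  assumes "finite S" "\<And>s. s \<in> S \<Longrightarrow> \<iota> s \<in> S \<and> \<iota> (\<iota> s) = s \<and> \<iota> s \<noteq> s"
  shows "\<exists>P\<subseteq>S. P \<inter> \<iota> ` P = {} \<and> P \<union> \<iota> ` P = S"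
  using assms
proof (induction "card S" arbitrary: S rule: less_induct)
  case less
  show ?case
  proof (cases "S = {}")
    case False
    then obtain s where s: "s \<in> S" by auto
    let ?S = "S - {s, \<iota> s}"
    have i: "\<iota> s \<in> S" "\<iota> (\<iota> s) = s" "\<iota> s \<noteq> s" using less.prems s by auto
    have "card ?S < card S" using s less.prems(1) by (intro psubset_card_mono) auto
    moreover have "\<iota> t \<in> ?S \<and> \<iota> (\<iota> t) = t \<and> \<iota> t \<noteq> t" if "t \<in> ?S" for t
      using that less.prems(2)[of t] i by (auto; metis)
    ultimately obtain P where P: "P \<subseteq> ?S" "P \<inter> \<iota> ` P = {}" "P \<union> \<iota> ` P = ?S"
      using less.hyps[of ?S] less.prems(1) by (metis finite_Diff)
    show ?thesis
    proof (intro exI[of _ "insert s P"] conjI)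
      have "s \<notin> \<iota> ` P" "\<iota> s \<notin> P" using P(1,3) by auto
      then show "insert s P \<inter> \<iota> ` insert s P = {}" using P(2) i(3) by auto
      show "insert s P \<union> \<iota> ` insert s P = S" using P(3) s i(1) by blast
      show "insert s P \<subseteq> S" using P(1) s by auto
    qed
  qed auto
qed

text \<open>An entry depends on its row only through the label \<open>lb r\<close>, so a permutation
  matters only through the labels that it hands to the columns.\<close>

lemma permanent_rearrangements:
  fixes K :: "'b \<Rightarrow> nat \<Rightarrow> int"
  assumes "finite T"
  shows "\<exists>N::nat. N > 0 \<and> permanent T (\<lambda>r s. K s (lb r)) =
    int N * (\<Sum>m | m \<in> extensional T \<and> image_mset m (mset_set T) = image_mset lb (mset_set T). \<Prod>s\<in>T. K s (m s))"
proof -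
  obtain N :: nat where N: "N > 0"
    "\<forall>F :: ('b \<Rightarrow> nat) \<Rightarrow> int. (\<Sum>\<sigma> | \<sigma> permutes T. F (restrict (lb \<circ> \<sigma>) T)) =
       int N * (\<Sum>h | h \<in> extensional T \<and> image_mset h (mset_set T) = image_mset lb (mset_set T). F h)"
    using sum_permutes_rearrangement[OF assms, of lb] by (elim exE conjE)
  have "permanent T (\<lambda>r s. K s (lb r)) = (\<Sum>\<sigma> | \<sigma> permutes T. \<Prod>s\<in>T. K s (restrict (lb \<circ> \<sigma>) T s))"
    unfolding permanent_transpose[OF assms] by simp
  also have "\<dots> = int N * (\<Sum>m | m \<in> extensional T \<and> image_mset m (mset_set T) = image_mset lb (mset_set T). \<Prod>s\<in>T. K s (m s))"
    by (rule N(2)[rule_format])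
  finally show ?thesis using N(1) by blast
qed

text \<open>The row of \<open>r\<close> evaluates a column at \<open>lab r\<close>, so rows and
  columns carry the same multiset of labels; this symmetry is what produces squares.
  \<open>P\<close> contains one member of each pair, and \<open>nondeg\<close> excludes the zero
  column 1_a - 1_a.\<close>

locale signed_pairing =
  fixes S :: "'a set" and \<iota> :: "'a \<Rightarrow> 'a" and \<eta> :: "'a \<Rightarrow> int"
    and lab :: "'a \<Rightarrow> nat" and L :: "'a \<Rightarrow> nat \<Rightarrow> int" and P :: "'a set"
  assumes fin: "finite S"
    and inv: "s \<in> S \<Longrightarrow> \<iota> (\<iota> s) = s"
    and P: "P \<subseteq> S" "P \<inter> \<iota> ` P = {}" "P \<union> \<iota> ` P = S"
    and sign: "s \<in> S \<Longrightarrow> \<eta> s = 1 \<or> \<eta> s = -1" "s \<in> S \<Longrightarrow> \<eta> (\<iota> s) = \<eta> s"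
    and L: "s \<in> S \<Longrightarrow> L s x = of_bool (x = lab s) - \<eta> s * of_bool (x = lab (\<iota> s))"
    and nondeg: "s \<in> S \<Longrightarrow> lab s \<noteq> lab (\<iota> s) \<or> \<eta> s = -1"
begin

definition Q where "Q = (\<Pi>\<^sub>E p\<in>P. {lab p, lab (\<iota> p)})"
definition F where "F m = (\<Prod>p\<in>P. L p (m p))"
definition M where "M m = image_mset m (mset_set P)"
text \<open>The coefficient of the monomial \<gamma> in the product of the monomial \<open>k\<close>
  and the linear forms \<open>L p\<close> for \<open>p\<close> in \<open>P\<close>, the labels being
  the variables.\<close>

definition u where "u k \<gamma> = (\<Sum>m | m \<in> Q \<and> k + M m = \<gamma>. F m)"
definition flip where "flip s x = (if x = lab s then lab (\<iota> s) else lab s)"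
definition peak where "peak = (\<lambda>p\<in>P. max (lab p) (lab (\<iota> p)))"

lemma finP: "finite P" using fin P(1) by (rule finite_subset[rotated])

lemma finQ: "finite Q" unfolding Q_def using finP by (intro finite_PiE) auto

lemma inS: "s \<in> S \<Longrightarrow> \<iota> s \<in> S"
proof -
  assume s: "s \<in> S"
  show "\<iota> s \<in> S"
  proof (cases "s \<in> P")
    case False
    then obtain p where "p \<in> P" "s = \<iota> p" using s P(3) by auto
    then show ?thesis using inv[of p] P(1) by auto
  qed (use P(3) in auto)
qed

lemma inP: "s \<in> S \<Longrightarrow> s \<notin> P \<Longrightarrow> \<iota> s \<in> P"
proof -
  assume "s \<in> S" "s \<notin> P"
  then obtain p where "p \<in> P" "s = \<iota> p" using P(3) by auto
  then show "\<iota> s \<in> P" using inv[of p] P(1) by auto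
qed

lemma inP': "p \<in> P \<Longrightarrow> \<iota> p \<notin> P"
  using P by blast

lemma mset_S: "image_mset h (mset_set S) = M h + image_mset (h \<circ> \<iota>) (mset_set P)"
proof -
  have inj: "inj_on \<iota> P" using inv P(1) by (metis inj_on_inverseI subsetD)
  have "mset_set S = mset_set P + image_mset \<iota> (mset_set P)"
    unfolding image_mset_mset_set[OF inj] using P finP
    by (metis finite_imageI mset_set_Union)
  then show ?thesis by (simp add: M_def multiset.map_comp)
qed

lemma flip_mset: "s \<in> S \<Longrightarrow> x \<in> {lab s, lab (\<iota> s)} \<Longrightarrow> {#x#} + {#flip s x#} = {#lab s, lab (\<iota> s)#}"
  by (auto simp: flip_def)

text \<open>Up to the exchange of the two labels, partners have the same column: the values 1 and
  \<open>- \<eta> s\<close> trade places, without an extra sign.\<close>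

lemma flip_L: "s \<in> S \<Longrightarrow> x \<in> {lab s, lab (\<iota> s)} \<Longrightarrow> L (\<iota> s) x = L s (flip s x)"
  using sign(1)[of s] by (auto simp: L inS sign(2) inv flip_def)

lemma flip_range: "flip s x \<in> {lab s, lab (\<iota> s)}"
  by (auto simp: flip_def)

lemma flip_flip: "x \<in> {lab s, lab (\<iota> s)} \<Longrightarrow> flip s (flip s x) = x"
  by (auto simp: flip_def)

lemma M_flip:
  assumes "\<And>p. p \<in> P \<Longrightarrow> h p \<in> {lab p, lab (\<iota> p)}"
  shows "M h + M (\<lambda>p. flip p (h p)) = image_mset lab (mset_set S)"
proof -
  have "M h + M (\<lambda>p. flip p (h p)) = (\<Sum>p\<in>P. {#h p#} + {#flip p (h p)#})"
    unfolding M_def sum.distrib by (simp add: sum_unfold_sum_mset)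
  also have "\<dots> = (\<Sum>p\<in>P. {#lab p#} + {#lab (\<iota> p)#})"
    using assms P(1) flip_mset by (intro sum.cong) auto
  also have "\<dots> = image_mset lab (mset_set S)"
    unfolding mset_S M_def sum.distrib by (simp add: sum_unfold_sum_mset comp_def)
  finally show ?thesis .
qed

text \<open>A rearrangement \<open>m\<close> is cut into its restriction to \<open>P\<close> and the
  flipped labels of the partners. A label and its flip together exhaust the labels of the pair, so
  the condition on multisets becomes \<open>k + M m = l + M m'\<close>; by \<open>flip_L\<close> the
  product becomes \<open>F m * F m'\<close>.\<close>

lemma sum_rearrangements:
  "(\<Sum>m | m \<in> extensional S \<and> k + image_mset m (mset_set S) = l + image_mset lab (mset_set S). \<Prod>s\<in>S. L s (m s))
   = (\<Sum>(m, m')\<in>{(m, m'). m \<in> Q \<and> m' \<in> Q \<and> k + M m = l + M m'}. F m * F m')"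
  (is "sum ?f ?H = sum ?g ?K")
proof -
  let ?R = "\<lambda>s. {lab s, lab (\<iota> s)}"
  let ?H' = "{m. m \<in> Pi\<^sub>E S ?R \<and> k + image_mset m (mset_set S) = l + image_mset lab (mset_set S)}"
  have fH': "finite ?H'" using fin by (auto intro: finite_subset[OF _ finite_PiE[of S ?R]])
  have L0: "x \<in> ?R s" if "s \<in> S" "L s x \<noteq> 0" for s x
    using that by (auto simp: L split: if_splits)
  have nonzero: "m \<in> ?H'" if "m \<in> ?H" "?f m \<noteq> 0" for m
  proof -
    have "L s (m s) \<noteq> 0" if "s \<in> S" for s
      using \<open>?f m \<noteq> 0\<close> that fin by (metis prod_zero_iff)
    then show ?thesis using \<open>m \<in> ?H\<close> L0 unfolding PiE_def Pi_def by blast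
  qed
  have finH: "finite ?H"
  proof -
    let ?U = "set_mset (l + image_mset lab (mset_set S))"
    have "?H \<subseteq> S \<rightarrow>\<^sub>E ?U"
    proof
      fix m assume m: "m \<in> ?H"
      have "m x \<in> ?U" if "x \<in> S" for x
      proof -
        have "m x \<in># k + image_mset m (mset_set S)" using that fin by simp
        then show ?thesis using m by (metis (mono_tags, lifting) mem_Collect_eq)
      qed
      then show "m \<in> S \<rightarrow>\<^sub>E ?U" using m by (auto simp: PiE_def)
    qed
    then show ?thesis using fin by (auto intro: finite_subset[OF _ finite_PiE])
  qed
  have "sum ?f ?H = sum ?f ?H'"
    using nonzero by (intro sum.mono_neutral_right[OF finH]) (auto simp: PiE_def)
  also have "\<dots> = sum ?g ?K"
  proof (rule sum.reindex_bij_witness[where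
        j = "\<lambda>m. (restrict m P, \<lambda>p\<in>P. flip p (m (\<iota> p)))" and
        i = "\<lambda>(m, m'). \<lambda>s\<in>S. if s \<in> P then m s else flip (\<iota> s) (m' (\<iota> s))"])
    fix m assume m: "m \<in> ?H'"
    have mR: "m s \<in> ?R s" if "s \<in> S" for s using m that by (auto simp: PiE_def Pi_def)
    have mi: "m (\<iota> p) \<in> ?R p" if "p \<in> P" for p
      using mR[of "\<iota> p"] that inS P(1) inv by auto
    have ext: "m \<in> extensional S" using m by (simp add: PiE_def)
    show "(\<lambda>(m, m'). \<lambda>s\<in>S. if s \<in> P then m s else flip (\<iota> s) (m' (\<iota> s)))
        ((\<lambda>m. (restrict m P, \<lambda>p\<in>P. flip p (m (\<iota> p)))) m) = m"
    proof
      fix s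
      show "(\<lambda>(m, m'). \<lambda>s\<in>S. if s \<in> P then m s else flip (\<iota> s) (m' (\<iota> s)))
        ((\<lambda>m. (restrict m P, \<lambda>p\<in>P. flip p (m (\<iota> p)))) m) s = m s"
      proof (cases "s \<in> S")
        case False
        then show ?thesis using ext by (simp add: extensional_def)
      next
        case True
        show ?thesis
        proof (cases "s \<in> P")
          case False
          then have "\<iota> s \<in> P" "\<iota> (\<iota> s) = s" using True inP inv by auto
          then show ?thesis using True False flip_flip[OF mi[of "\<iota> s"]] by simp
        qed (use True in simp)
      qed
    qed
    have M1: "M (restrict m P) = M m"
      unfolding M_def using finP by (intro image_mset_cong) auto
    have M2: "M (\<lambda>p\<in>P. flip p (m (\<iota> p))) = M (\<lambda>p. flip p (m (\<iota> p)))"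
      unfolding M_def using finP by (intro image_mset_cong) auto
    have M3: "image_mset (m \<circ> \<iota>) (mset_set P) + M (\<lambda>p. flip p (m (\<iota> p))) = image_mset lab (mset_set S)"
      using M_flip[of "m \<circ> \<iota>"] mi by (simp add: M_def)
    have "k + (M m + image_mset (m \<circ> \<iota>) (mset_set P)) = l + image_mset lab (mset_set S)"
      using m by (simp add: mset_S[of m])
    then have "k + M m = l + M (\<lambda>p. flip p (m (\<iota> p)))"
      unfolding M3[symmetric] by (simp add: add.assoc[symmetric] add.commute[of _ "image_mset (m \<circ> \<iota>) (mset_set P)"])
    moreover have "restrict m P \<in> Q" using mR P(1) unfolding Q_def by auto
    moreover have "(\<lambda>p\<in>P. flip p (m (\<iota> p))) \<in> Q" using flip_range unfolding Q_def by auto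
    ultimately show "(\<lambda>m. (restrict m P, \<lambda>p\<in>P. flip p (m (\<iota> p)))) m \<in> ?K"
      using M1 M2 by simp
    have "F (\<lambda>p\<in>P. flip p (m (\<iota> p))) = (\<Prod>p\<in>P. L (\<iota> p) (m (\<iota> p)))"
      unfolding F_def using P(1) mi by (intro prod.cong) (auto simp: flip_L)
    also have "\<dots> = (\<Prod>s\<in>\<iota> ` P. L s (m s))"
      using inv P(1) by (subst prod.reindex) (auto intro: inj_on_inverseI[of _ \<iota>])
    finally have "F (restrict m P) * F (\<lambda>p\<in>P. flip p (m (\<iota> p))) = (\<Prod>s\<in>P. L s (m s)) * (\<Prod>s\<in>\<iota> ` P. L s (m s))"
      by (simp add: F_def)
    also have "\<dots> = ?f m"
      using P finP by (metis finite_imageI prod.union_disjoint)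
    finally show "?g ((\<lambda>m. (restrict m P, \<lambda>p\<in>P. flip p (m (\<iota> p)))) m) = ?f m"
      by simp
  next
    fix mm assume "mm \<in> ?K"
    then obtain m m' where mm: "mm = (m, m')" "m \<in> Q" "m' \<in> Q" "k + M m = l + M m'" by auto
    let ?h = "\<lambda>s\<in>S. if s \<in> P then m s else flip (\<iota> s) (m' (\<iota> s))"
    have mR: "m p \<in> ?R p" "m' p \<in> ?R p" if "p \<in> P" for p
      using mm that by (auto simp: Q_def)
    have ext: "m \<in> extensional P" "m' \<in> extensional P" using mm by (auto simp: Q_def PiE_def)
    have hi: "?h (\<iota> p) = flip p (m' p)" if "p \<in> P" for p
      using that inP'[of p] P(1) inS inv by auto
    have "restrict ?h P = m" using ext P(1) by (auto simp: fun_eq_iff extensional_def)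
    moreover have "(\<lambda>p\<in>P. flip p (?h (\<iota> p))) = m'"
    proof
      fix p show "(\<lambda>p\<in>P. flip p (?h (\<iota> p))) p = m' p"
        using ext(2) hi[of p] flip_flip[OF mR(2)[of p]] by (cases "p \<in> P") (auto simp: extensional_def)
    qed
    ultimately show "(\<lambda>m. (restrict m P, \<lambda>p\<in>P. flip p (m (\<iota> p))))
        ((\<lambda>(m, m'). \<lambda>s\<in>S. if s \<in> P then m s else flip (\<iota> s) (m' (\<iota> s))) mm) = mm"
      unfolding mm(1) by simp
    have Mh: "M ?h = M m" unfolding M_def using finP P(1) by (intro image_mset_cong) auto
    have "image_mset (?h \<circ> \<iota>) (mset_set P) = M (\<lambda>p. flip p (m' p))"
      unfolding M_def using finP hi by (intro image_mset_cong) auto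
    then have "k + image_mset ?h (mset_set S) = k + M m + M (\<lambda>p. flip p (m' p))"
      by (simp add: mset_S[of ?h] Mh)
    also have "\<dots> = l + image_mset lab (mset_set S)"
      unfolding mm(4) using M_flip[OF mR(2)] by (simp add: add.assoc)
    finally have "k + image_mset ?h (mset_set S) = l + image_mset lab (mset_set S)" .
    moreover have "?h \<in> Pi\<^sub>E S ?R"
    proof (rule PiE_I)
      fix s assume s: "s \<in> S"
      show "?h s \<in> ?R s"
      proof (cases "s \<in> P")
        case False
        then show ?thesis using flip_range[of "\<iota> s"] inv[OF s] s by auto
      qed (use s mR in auto)
    qed auto
    ultimately show "(\<lambda>(m, m'). \<lambda>s\<in>S. if s \<in> P then m s else flip (\<iota> s) (m' (\<iota> s))) mm \<in> ?H'"
      unfolding mm(1) by simp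
  qed
  finally show ?thesis .
qed

text \<open>Grouping pairs \<open>(m, m')\<close> by the common multiset turns each sum over rearrangements into
  an inner product of the vectors \<open>u k\<close>, so that the permanent becomes a sum of squares.\<close>

lemma sum_rearrangements_inner:
  assumes "finite \<Gamma>" "(\<lambda>m. l + M m) ` Q \<subseteq> \<Gamma>"
  shows "(\<Sum>m | m \<in> extensional S \<and> k + image_mset m (mset_set S) = l + image_mset lab (mset_set S). \<Prod>s\<in>S. L s (m s))
   = (\<Sum>\<gamma>\<in>\<Gamma>. u k \<gamma> * u l \<gamma>)"
proof -
  have "(\<Sum>\<gamma>\<in>\<Gamma>. u k \<gamma> * u l \<gamma>)
      = (\<Sum>\<gamma>\<in>\<Gamma>. \<Sum>m\<in>Q. \<Sum>m'\<in>Q. of_bool (k + M m = \<gamma>) * of_bool (l + M m' = \<gamma>) * (F m * F m'))"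
  proof -
    have "u k \<gamma> = (\<Sum>m\<in>Q. of_bool (k + M m = \<gamma>) * F m)" for k \<gamma>
      unfolding u_def using finQ by (intro sum.mono_neutral_cong_left) auto
    then show ?thesis by (simp add: sum_product ac_simps)
  qed
  also have "\<dots> = (\<Sum>m\<in>Q. \<Sum>m'\<in>Q. \<Sum>\<gamma>\<in>\<Gamma>. of_bool (k + M m = \<gamma>) * of_bool (l + M m' = \<gamma>) * (F m * F m'))"
    by (subst sum.swap, intro sum.cong refl, subst sum.swap, rule refl)
  also have "\<dots> = (\<Sum>m\<in>Q. \<Sum>m'\<in>Q. of_bool (k + M m = l + M m') * (F m * F m'))"
  proof (intro sum.cong refl)
    fix m m' assume "m' \<in> Q"
    then have mem: "l + M m' \<in> \<Gamma>" using assms(2) by blast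
    have "(\<Sum>\<gamma>\<in>\<Gamma>. of_bool (k + M m = \<gamma>) * of_bool (l + M m' = \<gamma>) * (F m * F m'))
        = (\<Sum>\<gamma>\<in>{l + M m'}. of_bool (k + M m = \<gamma>) * of_bool (l + M m' = \<gamma>) * (F m * F m'))"
      using assms(1) mem by (intro sum.mono_neutral_right) auto
    then show "(\<Sum>\<gamma>\<in>\<Gamma>. of_bool (k + M m = \<gamma>) * of_bool (l + M m' = \<gamma>) * (F m * F m'))
        = of_bool (k + M m = l + M m') * (F m * F m')" by simp
  qed
  also have "\<dots> = (\<Sum>(m, m')\<in>Q \<times> Q. of_bool (k + M m = l + M m') * (F m * F m'))"
    by (simp add: sum.cartesian_product)
  also have "\<dots> = (\<Sum>(m, m')\<in>{(m, m'). m \<in> Q \<and> m' \<in> Q \<and> k + M m = l + M m'}. F m * F m')"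
    using finQ by (intro sum.mono_neutral_cong_right) auto
  finally show ?thesis unfolding sum_rearrangements by simp
qed

lemma peak_in_Q: "peak \<in> Q"
  unfolding Q_def peak_def by (auto simp: max_def)

lemma F_peak: "F peak \<noteq> 0"
proof -
  have "L p (peak p) \<noteq> 0" if "p \<in> P" for p
  proof -
    have "p \<in> S" using that P(1) by auto
    then show ?thesis using that sign(1)[of p] nondeg[of p] by (auto simp: peak_def L max_def)
  qed
  then show ?thesis using finP by (simp add: F_def)
qed

lemma sum_mset_M: "sum_mset (M m) = (\<Sum>p\<in>P. m p)"
  by (simp add: M_def sum_unfold_sum_mset)

text \<open>Labels are numbers, so the sum of a multiset serves as its weight. Only
  \<open>peak\<close> has the largest weight, hence no other term can cancel its
  contribution.\<close>

lemma sum_mset_le_peak: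
  assumes "m \<in> Q"
  shows "sum_mset (M m) \<le> sum_mset (M peak)" "sum_mset (M m) = sum_mset (M peak) \<Longrightarrow> m = peak"
proof -
  have le: "m p \<le> peak p" if "p \<in> P" for p
    using assms that by (auto simp: Q_def peak_def PiE_def Pi_def)
  then show "sum_mset (M m) \<le> sum_mset (M peak)"
    unfolding sum_mset_M by (rule sum_mono)
  assume eq: "sum_mset (M m) = sum_mset (M peak)"
  have "m p = peak p" if "p \<in> P" for p
  proof (rule ccontr)
    assume "m p \<noteq> peak p"
    then have "m p < peak p" using le[OF that] by simp
    then have "(\<Sum>p\<in>P. m p) < (\<Sum>p\<in>P. peak p)"
      using le that by (intro sum_strict_mono_ex1 finP) auto
    then show False using eq by (simp add: sum_mset_M)
  qed
  moreover have "m \<in> extensional P" using assms by (simp add: Q_def PiE_def)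
  ultimately show "m = peak" by (auto simp: peak_def extensional_def fun_eq_iff)
qed

lemma u_peak: "u k (k + M peak) = F peak"
proof -
  have "{m. m \<in> Q \<and> k + M m = k + M peak} = {peak}"
    using peak_in_Q sum_mset_le_peak(2) by auto
  then show ?thesis by (simp add: u_def)
qed

text \<open>For \<open>k = l = {#}\<close> the inner product is the squared norm of
  \<open>u {#}\<close>, whose entry at \<open>M peak\<close> is nonzero.\<close>

lemma permanent_even: "permanent S (\<lambda>r s. L s (lab r)) \<noteq> 0"
proof -
  let ?\<Gamma> = "M ` Q"
  obtain N :: nat where N: "N > 0" "permanent S (\<lambda>r s. L s (lab r)) =
      int N * (\<Sum>m | m \<in> extensional S \<and> image_mset m (mset_set S) = image_mset lab (mset_set S). \<Prod>s\<in>S. L s (m s))"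
    using permanent_rearrangements[OF fin] by blast
  have "(\<Sum>m | m \<in> extensional S \<and> image_mset m (mset_set S) = image_mset lab (mset_set S). \<Prod>s\<in>S. L s (m s))
      = (\<Sum>\<gamma>\<in>?\<Gamma>. u {#} \<gamma> * u {#} \<gamma>)"
    using sum_rearrangements_inner[of ?\<Gamma> "{#}" "{#}"] finQ by simp
  also have "\<dots> > 0"
  proof (rule sum_pos2)
    show "finite ?\<Gamma>" "M peak \<in> ?\<Gamma>" using finQ peak_in_Q by auto
    show "0 < u {#} (M peak) * u {#} (M peak)" using u_peak[of "{#}"] F_peak
      by (simp add: zero_less_mult_iff not_less) (meson linorder_neqE)
  qed simp
  finally show ?thesis using N by simp
qed

text \<open>The unpaired column splits the sum into the squared norm of \<open>u {#lab t#}\<close>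
  minus its inner product with \<open>u {#a#}\<close>. The two vectors have equal norms, so twice
  this difference is the squared norm of their difference.\<close>

lemma permanent_odd:
  assumes t: "t \<notin> S" and a: "a \<noteq> lab t" and Lt: "\<And>x. L t x = of_bool (x = lab t) - of_bool (x = a)"
  shows "permanent (insert t S) (\<lambda>r s. L s (lab r)) \<noteq> 0"
proof -
  let ?\<Gamma> = "(\<lambda>m. {#lab t#} + M m) ` Q \<union> (\<lambda>m. {#a#} + M m) ` Q"
  let ?T = "insert t S"
  let ?f = "\<lambda>m. \<Prod>s\<in>S. L s (m s)"
  let ?V = "\<lambda>k l. \<Sum>m | m \<in> extensional S \<and> k + image_mset m (mset_set S) = l + image_mset lab (mset_set S). ?f m"
  let ?H = "{m. m \<in> extensional ?T \<and> image_mset m (mset_set ?T) = image_mset lab (mset_set ?T)}"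
  let ?H' = "\<lambda>x. {m. m \<in> extensional S \<and> {#x#} + image_mset m (mset_set S) = {#lab t#} + image_mset lab (mset_set S)}"
  obtain N :: nat where N: "N > 0" "permanent ?T (\<lambda>r s. L s (lab r)) =
      int N * (\<Sum>m\<in>?H. \<Prod>s\<in>?T. L s (m s))"
    using permanent_rearrangements[of ?T] fin by blast
  have fin\<Gamma>: "finite ?\<Gamma>" using finQ by simp
  have finH: "finite ?H"
  proof -
    have "?H \<subseteq> ?T \<rightarrow>\<^sub>E lab ` ?T"
    proof
      fix m assume m: "m \<in> ?H"
      then have "m ` ?T = lab ` ?T" using fin
        by (metis (mono_tags, lifting) finite.insertI finite_set_mset_mset_set mem_Collect_eq set_image_mset)
      then show "m \<in> ?T \<rightarrow>\<^sub>E lab ` ?T" using m by (auto simp: PiE_def)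
    qed
    then show ?thesis using fin by (auto intro: finite_subset[OF _ finite_PiE])
  qed
  have part: "(\<Sum>m\<in>{m\<in>?H. m t = x}. \<Prod>s\<in>S. L s (m s)) = ?V {#x#} {#lab t#}" for x
  proof (rule sum.reindex_bij_witness[where j = "\<lambda>m. restrict m S" and i = "\<lambda>m. m(t := x)"])
    fix m assume m: "m \<in> {m\<in>?H. m t = x}"
    then show "(restrict m S)(t := x) = m" using t by (auto simp: fun_eq_iff extensional_def)
    have "image_mset (restrict m S) (mset_set S) = image_mset m (mset_set S)"
      using fin by (intro image_mset_cong) auto
    then show "restrict m S \<in> ?H' x"
      using m t fin by auto
    show "?f (restrict m S) = (\<Prod>s\<in>S. L s (m s))" by simp
  next
    fix m assume m: "m \<in> ?H' x"
    then show "restrict (m(t := x)) S = m" using t by (auto simp: fun_eq_iff extensional_def)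
    have "image_mset (m(t := x)) (mset_set S) = image_mset m (mset_set S)"
      using fin t by (intro image_mset_cong) auto
    then show "m(t := x) \<in> {m\<in>?H. m t = x}"
      using m t fin by (auto simp: extensional_def)
  qed
  have part': "(\<Sum>m\<in>?H. of_bool (m t = x) * ?f m) = ?V {#x#} {#lab t#}" for x
    unfolding part[symmetric] using finH by (intro sum.mono_neutral_cong_right) auto
  have "(\<Sum>m\<in>?H. \<Prod>s\<in>?T. L s (m s)) = (\<Sum>m\<in>?H. L t (m t) * ?f m)"
    using t fin by simp
  also have "\<dots> = (\<Sum>m\<in>?H. of_bool (m t = lab t) * ?f m) - (\<Sum>m\<in>?H. of_bool (m t = a) * ?f m)"
    by (simp add: Lt left_diff_distrib sum_subtractf)
  finally have V: "(\<Sum>m\<in>?H. \<Prod>s\<in>?T. L s (m s)) = ?V {#lab t#} {#lab t#} - ?V {#a#} {#lab t#}"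
    unfolding part' .
  have V1: "?V {#lab t#} {#lab t#} = (\<Sum>\<gamma>\<in>?\<Gamma>. u {#lab t#} \<gamma> * u {#lab t#} \<gamma>)"
    by (rule sum_rearrangements_inner[OF fin\<Gamma>]) auto
  have V2: "?V {#a#} {#a#} = (\<Sum>\<gamma>\<in>?\<Gamma>. u {#a#} \<gamma> * u {#a#} \<gamma>)"
    by (rule sum_rearrangements_inner[OF fin\<Gamma>]) auto
  have V3: "?V {#a#} {#lab t#} = (\<Sum>\<gamma>\<in>?\<Gamma>. u {#a#} \<gamma> * u {#lab t#} \<gamma>)"
    by (rule sum_rearrangements_inner[OF fin\<Gamma>]) auto
  have V4: "?V {#lab t#} {#lab t#} = ?V {#a#} {#a#}" by simp
  have "2 * (\<Sum>m\<in>?H. \<Prod>s\<in>?T. L s (m s)) = (\<Sum>\<gamma>\<in>?\<Gamma>. (u {#lab t#} \<gamma> - u {#a#} \<gamma>)\<^sup>2)"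
  proof -
    have "(\<Sum>\<gamma>\<in>?\<Gamma>. (u {#lab t#} \<gamma> - u {#a#} \<gamma>)\<^sup>2) = (\<Sum>\<gamma>\<in>?\<Gamma>. u {#lab t#} \<gamma> * u {#lab t#} \<gamma>
        + u {#a#} \<gamma> * u {#a#} \<gamma> - 2 * (u {#a#} \<gamma> * u {#lab t#} \<gamma>))"
      by (intro sum.cong refl) (simp add: power2_eq_square algebra_simps)
    also have "\<dots> = ?V {#lab t#} {#lab t#} + ?V {#a#} {#a#} - 2 * ?V {#a#} {#lab t#}"
      unfolding V1 V2 V3 by (simp only: sum_subtractf sum.distrib sum_distrib_left)
    finally show ?thesis using V V4 by linarith
  qed
  also have "\<dots> > 0"
  proof -
    \<comment> \<open>Adding the smaller label \<open>l\<close> cannot reach the weight of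
      \<open>peak\<close> with the larger label \<open>k\<close>. So at that entry only one of the
      two vectors is nonzero and they differ.\<close>
    have big: "u {#l#} ({#k#} + M peak) = 0" if "l < k" for k l
    proof -
      have "\<not> {#l#} + M m = {#k#} + M peak" if "m \<in> Q" for m
      proof
        assume eq: "{#l#} + M m = {#k#} + M peak"
        have "l + sum_mset (M m) = k + sum_mset (M peak)" using arg_cong[OF eq, of sum_mset] by simp
        then show False using sum_mset_le_peak(1)[OF that] \<open>l < k\<close> by linarith
      qed
      then show ?thesis by (simp add: u_def cong: conj_cong)
    qed
    have "\<exists>\<gamma>\<in>?\<Gamma>. u {#lab t#} \<gamma> - u {#a#} \<gamma> \<noteq> 0"
    proof (cases "a < lab t")
      case True
      then show ?thesis using big[OF True] u_peak[of "{#lab t#}"] F_peak peak_in_Q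
        by (intro bexI[of _ "{#lab t#} + M peak"]) auto
    next
      case False
      then have "lab t < a" using a by simp
      then show ?thesis using big[of "lab t" a] u_peak[of "{#a#}"] F_peak peak_in_Q
        by (intro bexI[of _ "{#a#} + M peak"]) auto
    qed
    then obtain \<gamma> where "\<gamma> \<in> ?\<Gamma>" "u {#lab t#} \<gamma> - u {#a#} \<gamma> \<noteq> 0" by blast
    then show ?thesis by (intro sum_pos2[OF fin\<Gamma>]) auto
  qed
  finally show ?thesis using N by simp
qed

end

section \<open>Marriage, trails and stubs\<close>

text \<open>Induction on \<open>card Z\<close>. A proper tight subset is matched on its own and its
  neighbours are removed for the rest; without one, an arbitrary choice for a single element costs
  every other set at most one neighbour, which it can spare.\<close>

lemma hall_marriage:
  fixes N :: "'a \<Rightarrow> 'b set"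
  assumes "finite Z" "\<And>u. u \<in> Z \<Longrightarrow> finite (N u)"
    and "\<And>S. S \<subseteq> Z \<Longrightarrow> card S \<le> card (\<Union>(N ` S))"
  shows "\<exists>\<phi>. inj_on \<phi> Z \<and> (\<forall>u\<in>Z. \<phi> u \<in> N u)"
  using assms
proof (induction "card Z" arbitrary: Z N rule: less_induct)
  case less
  note fin = less.prems(1) and finN = less.prems(2) and hall = less.prems(3)
  have finU: "finite (\<Union>(N ` S))" if "S \<subseteq> Z" for S
    using that fin finN by (metis finite_UN finite_subset subsetD)
  show ?case
  proof (cases "Z = {}")
    case False
    then obtain z where z: "z \<in> Z" by auto
    show ?thesis
    proof (cases "\<exists>S. S \<subset> Z \<and> S \<noteq> {} \<and> card (\<Union>(N ` S)) \<le> card S")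
      case True
      then obtain S where S: "S \<subset> Z" "S \<noteq> {}" "card (\<Union>(N ` S)) \<le> card S" by auto
      let ?M = "\<Union>(N ` S)"
      have finS: "finite S" using S(1) fin by (auto intro: finite_subset)
      have "card S < card Z" using S(1) fin by (rule psubset_card_mono[rotated])
      then obtain \<phi> where \<phi>: "inj_on \<phi> S" "\<forall>u\<in>S. \<phi> u \<in> N u"
        using less.hyps[of S N] finS S(1) finN hall by (metis psubsetE subset_eq subset_trans)
      have "card (Z - S) < card Z"
        using S fin by (intro psubset_card_mono) auto
      moreover have "card T \<le> card (\<Union>((\<lambda>u. N u - ?M) ` T))" if T: "T \<subseteq> Z - S" for T
      proof -
        have "card T + card S = card (T \<union> S)"
          using T finS fin by (subst card_Un_disjoint) (auto intro: finite_subset)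
        also have "\<dots> \<le> card (\<Union>(N ` (T \<union> S)))" using T S(1) by (intro hall) auto
        also have "\<Union>(N ` (T \<union> S)) = \<Union>((\<lambda>u. N u - ?M) ` T) \<union> ?M" by auto
        also have "card \<dots> \<le> card (\<Union>((\<lambda>u. N u - ?M) ` T)) + card ?M" by (rule card_Un_le)
        finally show ?thesis using S(3) by linarith
      qed
      ultimately obtain \<psi> where \<psi>: "inj_on \<psi> (Z - S)" "\<forall>u\<in>Z - S. \<psi> u \<in> N u - ?M"
        using less.hyps[of "Z - S" "\<lambda>u. N u - ?M"] fin finN by (metis (no_types, lifting) DiffD1 finite_Diff)
      let ?\<chi> = "\<lambda>u. if u \<in> S then \<phi> u else \<psi> u"
      have "inj_on ?\<chi> Z"
      proof (rule inj_onI)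
        fix x y assume xy: "x \<in> Z" "y \<in> Z" "?\<chi> x = ?\<chi> y"
        have "?\<chi> w \<in> ?M \<longleftrightarrow> w \<in> S" if "w \<in> Z" for w
          using that \<phi>(2) \<psi>(2) by auto
        then have "x \<in> S \<longleftrightarrow> y \<in> S" using xy by metis
        then show "x = y" using xy \<phi>(1) \<psi>(1) by (auto dest: inj_onD split: if_splits)
      qed
      moreover have "\<forall>u\<in>Z. ?\<chi> u \<in> N u" using \<phi>(2) \<psi>(2) by auto
      ultimately show ?thesis by blast
    next
      case False
      have "card {z} \<le> card (\<Union>(N ` {z}))" using z by (intro hall) auto
      then obtain x where x: "x \<in> N z" by fastforce
      have "card (Z - {z}) < card Z" using z fin by (intro psubset_card_mono) auto
      moreover have "card T \<le> card (\<Union>((\<lambda>u. N u - {x}) ` T))" if T: "T \<subseteq> Z - {z}" for T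
      proof (cases "T = {}")
        case nonempty: False
        have "T \<subset> Z" using T z by auto
        then have "card T < card (\<Union>(N ` T))" using False nonempty not_le by blast
        also have "\<Union>(N ` T) \<subseteq> insert x (\<Union>((\<lambda>u. N u - {x}) ` T))" by auto
        then have "card (\<Union>(N ` T)) \<le> card (insert x (\<Union>((\<lambda>u. N u - {x}) ` T)))"
          using finU[of T] \<open>T \<subset> Z\<close> by (intro card_mono) (auto intro: finite_subset)
        also have "\<dots> \<le> Suc (card (\<Union>((\<lambda>u. N u - {x}) ` T)))" by (rule card_insert_le_m1) auto
        finally show ?thesis by simp
      qed simp
      ultimately obtain \<psi> where \<psi>: "inj_on \<psi> (Z - {z})" "\<forall>u\<in>Z - {z}. \<psi> u \<in> N u - {x}"
        using less.hyps[of "Z - {z}" "\<lambda>u. N u - {x}"] fin finN by (metis (no_types, lifting) DiffD1 finite_Diff)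
      have "inj_on (\<psi>(z := x)) Z"
      proof (rule inj_onI)
        fix v w assume "v \<in> Z" "w \<in> Z" "(\<psi>(z := x)) v = (\<psi>(z := x)) w"
        then show "v = w" using \<psi> by (auto dest: inj_onD split: if_splits)
      qed
      moreover have "\<forall>u\<in>Z. (\<psi>(z := x)) u \<in> N u" using \<psi>(2) x by auto
      ultimately show ?thesis by blast
    qed
  qed auto
qed

section \<open>Trails for an abstract incidence relation between edges and nodes\<close>

definition ideg :: "('e \<Rightarrow> 'n \<Rightarrow> bool) \<Rightarrow> 'e set \<Rightarrow> 'n \<Rightarrow> nat" where
  "ideg I J x = card {e \<in> J. I e x}"

lemma ideg_insert:
  assumes "finite J" "e \<notin> J"
  shows "ideg I (insert e J) x = ideg I J x + of_bool (I e x)"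
proof -
  have "{f \<in> insert e J. I f x} = (if I e x then insert e {f \<in> J. I f x} else {f \<in> J. I f x})" by auto
  then show ?thesis using assms by (simp add: ideg_def)
qed

text \<open>\<open>P t\<close> plays the role of the edge set of a trail from \<open>t\<close> to
  \<open>\<iota> t\<close>, and \<open>d t\<close> that of alternating signs along it, so that the
  weighted edges telescope to the two ends; the sign at the far end is governed by the parity of the
  length. Edges of \<open>J\<close> on no trail are allowed.\<close>

definition trail_system ::
    "('e \<Rightarrow> 'n \<Rightarrow> bool) \<Rightarrow> 'e set \<Rightarrow> ('n \<Rightarrow> 'n) \<Rightarrow> ('n \<Rightarrow> 'e set) \<Rightarrow> ('n \<Rightarrow> 'e \<Rightarrow> int) \<Rightarrow> bool" where
  "trail_system I J \<iota> P d \<longleftrightarrow>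
    (\<forall>t. odd (ideg I J t) \<longrightarrow>
      odd (ideg I J (\<iota> t)) \<and> \<iota> (\<iota> t) = t \<and> \<iota> t \<noteq> t \<and> P t \<subseteq> J \<and> P (\<iota> t) = P t \<and>
      (\<forall>e. e \<notin> P t \<longrightarrow> d t e = 0) \<and>
      (\<forall>x. (\<Sum>e\<in>J. d t e * of_bool (I e x)) = of_bool (x = t) - (-1) ^ card (P t) * of_bool (x = \<iota> t)) \<and>
      (\<forall>x. odd (ideg I (P t) x) \<longleftrightarrow> x = t \<or> x = \<iota> t)) \<and>
    (\<forall>t t'. odd (ideg I J t) \<longrightarrow> odd (ideg I J t') \<longrightarrow> t' \<noteq> t \<longrightarrow> t' \<noteq> \<iota> t \<longrightarrow> P t \<inter> P t' = {})"

lemma trail_systemD: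
  assumes "trail_system I J \<iota> P d" "odd (ideg I J t)"
  shows "odd (ideg I J (\<iota> t))" "\<iota> (\<iota> t) = t" "\<iota> t \<noteq> t" "P t \<subseteq> J" "P (\<iota> t) = P t"
    "e \<notin> P t \<Longrightarrow> d t e = 0"
    "(\<Sum>e\<in>J. d t e * of_bool (I e x)) = of_bool (x = t) - (-1) ^ card (P t) * of_bool (x = \<iota> t)"
    "odd (ideg I (P t) x) \<longleftrightarrow> x = t \<or> x = \<iota> t"
    "odd (ideg I J t') \<Longrightarrow> t' \<noteq> t \<Longrightarrow> t' \<noteq> \<iota> t \<Longrightarrow> P t \<inter> P t' = {}"
  using assms unfolding trail_system_def by simp_all

text \<open>Induction on the number of edges, removing an edge \<open>e\<close> at an odd node
  \<open>t\<close>. If the other end \<open>s\<close> is odd too, \<open>e\<close> is a trail by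
  itself. Otherwise \<open>s\<close> is odd in the remaining graph, and the trail starting at
  \<open>s\<close> is prolonged by \<open>e\<close>.\<close>

lemma trail_pairing:
  fixes I :: "'e \<Rightarrow> 'n \<Rightarrow> bool"
  assumes "finite J" "\<And>e. e \<in> J \<Longrightarrow> \<exists>x y. x \<noteq> y \<and> (\<forall>z. I e z \<longleftrightarrow> z = x \<or> z = y)"
  shows "\<exists>\<iota> P d. trail_system I J \<iota> P d"
  using assms
proof (induction "card J" arbitrary: J rule: less_induct)
  case less
  note fin = less.prems(1) and two = less.prems(2)
  show ?case
  proof (cases "\<exists>t. odd (ideg I J t)")
    case False
    then have "trail_system I J id (\<lambda>_. {}) (\<lambda>_ _. 0)" by (simp add: trail_system_def)
    then show ?thesis by blast
  next
    case True
    then obtain t where t: "odd (ideg I J t)" by blast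
    then have "{e \<in> J. I e t} \<noteq> {}" by (metis card.empty even_zero ideg_def)
    then obtain e where e: "e \<in> J" "I e t" by blast
    then obtain s where s: "s \<noteq> t" and Ie: "\<And>z. I e z \<longleftrightarrow> z = t \<or> z = s"
      using two[OF e(1)] by metis
    define K where "K = J - {e}"
    have JK: "J = insert e K" "e \<notin> K" "finite K" using e fin by (auto simp: K_def)
    have degJ: "ideg I J x = ideg I K x + of_bool (x = t \<or> x = s)" for x
      using ideg_insert[OF JK(3,2), of I x] by (simp add: JK(1)[symmetric] Ie)
    have sumJ: "(\<Sum>f\<in>J. g f * of_bool (I f x)) = g e * of_bool (x = t \<or> x = s) + (\<Sum>f\<in>K. g f * of_bool (I f x))"
      for g :: "'e \<Rightarrow> int" and x
      using JK by (simp add: Ie)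
    have "card K < card J" using JK by simp
    then have "\<exists>\<iota> P d. trail_system I K \<iota> P d" using JK two by (intro less.hyps) auto
    then obtain \<iota> P d where "trail_system I K \<iota> P d" by blast
    note IH = trail_systemD[OF this]
    have de: "d t' e = 0" if "odd (ideg I K t')" for t'
      using IH(4)[OF that] IH(6)[OF that, of e] JK(2) by blast
    have oddJ: "odd (ideg I J x) \<longleftrightarrow> (if x = t \<or> x = s then even (ideg I K x) else odd (ideg I K x))" for x
      using degJ[of x] by simp
    have tK: "even (ideg I K t)" using t oddJ by simp
    show ?thesis
    proof (cases "odd (ideg I J s)")
      case True
      then have sK: "even (ideg I K s)" using oddJ by simp
      have not_ts: "x \<noteq> t \<and> x \<noteq> s \<and> \<iota> x \<noteq> t \<and> \<iota> x \<noteq> s" if "odd (ideg I K x)" for x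
        using that IH(1)[OF that] tK sK by metis
      have cases: "x = t \<or> x = s \<or> odd (ideg I K x) \<and> x \<noteq> t \<and> x \<noteq> s" if "odd (ideg I J x)" for x
        using that oddJ[of x] by auto
      let ?\<iota> = "\<iota>(t := s, s := t)" and ?P = "P(t := {e}, s := {e})"
      let ?d = "d(t := (\<lambda>f. of_bool (f = e)), s := (\<lambda>f. of_bool (f = e)))"
      have single: "(\<Sum>f\<in>J. of_bool (f = e) * of_bool (I f x)) = (of_bool (x = t \<or> x = s) :: int)" for x
        unfolding sumJ using JK(2) by (auto intro!: sum.neutral)
      have degs: "ideg I {e} x = of_bool (x = t \<or> x = s)" for x
        using ideg_insert[of "{}" e I x] by (simp add: Ie ideg_def)
      show ?thesis
      unfolding trail_system_def
      proof (intro exI[of _ ?\<iota>] exI[of _ ?P] exI[of _ ?d] conjI allI impI)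
        fix x assume x: "odd (ideg I J x)"
        note c = cases[OF x]
        show "odd (ideg I J (?\<iota> x))" using c s True t IH(1)[of x] oddJ[of "\<iota> x"] not_ts[of x] by auto
        show "?\<iota> (?\<iota> x) = x" using c s IH(2)[of x] not_ts[of x] by auto
        show "?\<iota> x \<noteq> x" using c s IH(3)[of x] by auto
        show "?P x \<subseteq> J" using c s IH(4)[of x] JK by auto
        show "?P (?\<iota> x) = ?P x" using c s IH(5)[of x] not_ts[of x] by auto
        show "?d x f = 0" if "f \<notin> ?P x" for f using that c s IH(6)[of x f] by auto
        show "(\<Sum>f\<in>J. ?d x f * of_bool (I f y)) = of_bool (y = x) - (-1) ^ card (?P x) * of_bool (y = ?\<iota> x)" for y
        proof (cases "x = t \<or> x = s")
          case True
          then show ?thesis using single[of y] s by auto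
        next
          case False
          then have "odd (ideg I K x)" using c by auto
          then show ?thesis using False IH(7)[of x y] de[of x] by (simp add: sumJ)
        qed
        show "odd (ideg I (?P x) y) \<longleftrightarrow> y = x \<or> y = ?\<iota> x" for y
          using c s IH(8)[of x y] degs[of y] by auto
      next
        fix x y assume xy: "odd (ideg I J x)" "odd (ideg I J y)" "y \<noteq> x" "y \<noteq> ?\<iota> x"
        then show "?P x \<inter> ?P y = {}"
          using cases[OF xy(1)] cases[OF xy(2)] IH(4)[of x] IH(4)[of y] IH(9)[of x y] JK(2) s
          by (auto split: if_splits)
      qed
    next
      case False
      then have sK: "odd (ideg I K s)" using oddJ[of s] by auto
      define r where "r = \<iota> s"
      have r: "odd (ideg I K r)" "\<iota> r = s" "r \<noteq> s" "P r = P s" "r \<noteq> t"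
        using IH(1,2,3,5)[OF sK] tK by (auto simp: r_def)
      have cases: "x = t \<or> x = r \<or> odd (ideg I K x) \<and> x \<noteq> t \<and> x \<noteq> r \<and> x \<noteq> s \<and> \<iota> x \<noteq> t \<and> \<iota> x \<noteq> r \<and> \<iota> x \<noteq> s"
        if "odd (ideg I J x)" for x
      proof (cases "x = t \<or> x = r")
        case False
        have xs: "x \<noteq> s" using that \<open>\<not> odd (ideg I J s)\<close> by auto
        then have "odd (ideg I K x)" using that oddJ[of x] False by auto
        moreover from this have "\<iota> x \<noteq> t" using IH(1) tK by metis
        moreover have "\<iota> x \<noteq> r" using IH(2)[OF \<open>odd (ideg I K x)\<close>] r(2) xs by metis
        moreover have "\<iota> x \<noteq> s" using IH(2)[OF \<open>odd (ideg I K x)\<close>] r_def False by metis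
        ultimately show ?thesis using xs False by auto
      qed auto
      define Q where "Q = insert e (P s)"
      have Q: "Q \<subseteq> J" "finite Q" "card Q = Suc (card (P s))"
      proof -
        have "finite (P s)" "e \<notin> P s" using IH(4)[OF sK] JK(2,3) by (auto intro: finite_subset)
        then show "Q \<subseteq> J" "finite Q" "card Q = Suc (card (P s))"
          using IH(4)[OF sK] JK by (auto simp: Q_def)
      qed
      \<comment> \<open>Prolonging by \<open>e\<close> reverses all signs of the old trail.\<close>
      define D :: "'e \<Rightarrow> int" where "D = (\<lambda>f. of_bool (f = e) - d s f)"
      have D0: "D f = 0" if "f \<notin> Q" for f using that IH(6)[OF sK, of f] by (auto simp: D_def Q_def)
      have Dsum: "(\<Sum>f\<in>J. D f * of_bool (I f x)) = of_bool (x = t) - (-1) ^ card Q * of_bool (x = r)" for x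
      proof -
        have "(\<Sum>f\<in>K. D f * of_bool (I f x)) = - (\<Sum>f\<in>K. d s f * of_bool (I f x))"
          unfolding sum_negf[symmetric] using JK(2) by (intro sum.cong) (auto simp: D_def)
        moreover have "D e = 1" using de[OF sK] by (simp add: D_def)
        ultimately have "(\<Sum>f\<in>J. D f * of_bool (I f x)) =
            of_bool (x = t \<or> x = s) - (of_bool (x = s) - (-1) ^ card (P s) * of_bool (x = r))"
          by (simp only: sumJ IH(7)[OF sK] r_def)
        then show ?thesis using s by (auto simp: Q(3))
      qed
      have degQ: "odd (ideg I Q x) \<longleftrightarrow> x = t \<or> x = r" for x
      proof -
        have "finite (P s)" "e \<notin> P s" using IH(4)[OF sK] JK(2,3) by (auto intro: finite_subset)
        then have "ideg I Q x = ideg I (P s) x + of_bool (x = t \<or> x = s)"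
          unfolding Q_def by (simp add: ideg_insert Ie)
        then show ?thesis using IH(8)[OF sK, of x] s r(3,5) r_def by auto
      qed
      let ?\<iota> = "\<iota>(t := r, r := t)" and ?P = "P(t := Q, r := Q)"
      \<comment> \<open>Read from its far end \<open>r\<close>, the trail is rescaled by a sign so
        that the value at \<open>r\<close> becomes 1.\<close>
      let ?d = "d(t := D, r := (\<lambda>f. - ((-1) ^ card Q) * D f))"
      have Jr: "odd (ideg I J r)" using r oddJ[of r] by auto
      show ?thesis
      unfolding trail_system_def
      proof (intro exI[of _ ?\<iota>] exI[of _ ?P] exI[of _ ?d] conjI allI impI)
        fix x assume x: "odd (ideg I J x)"
        note c = cases[OF x]
        show "odd (ideg I J (?\<iota> x))" using c r(5) Jr t IH(1)[of x] oddJ[of "\<iota> x"] by auto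
        show "?\<iota> (?\<iota> x) = x" using c r(5) IH(2)[of x] by auto
        show "?\<iota> x \<noteq> x" using c r(5) IH(3)[of x] by auto
        show "?P x \<subseteq> J" using c r(5) IH(4)[of x] JK Q by auto
        show "?P (?\<iota> x) = ?P x" using c r(5) IH(5)[of x] by auto
        show "?d x f = 0" if "f \<notin> ?P x" for f using that c r(5) IH(6)[of x f] D0[of f] by auto
        show "(\<Sum>f\<in>J. ?d x f * of_bool (I f y)) = of_bool (y = x) - (-1) ^ card (?P x) * of_bool (y = ?\<iota> x)" for y
        proof -
          consider "x = t" | "x = r" | "odd (ideg I K x)" "x \<noteq> t" "x \<noteq> r" using c by blast
          then show ?thesis
          proof cases
            case 1
            then show ?thesis using Dsum[of y] r(5) by simp
          next
            case 2
            have "(\<Sum>f\<in>J. - ((-1) ^ card Q) * D f * of_bool (I f y)) =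
                - ((-1) ^ card Q) * (\<Sum>f\<in>J. D f * of_bool (I f y))"
              by (simp add: sum_distrib_left mult.assoc sum_negf)
            also have "\<dots> = of_bool (y = r) - (-1) ^ card Q * of_bool (y = t)"
              unfolding Dsum by (cases "even (card Q)") auto
            finally show ?thesis using 2 r(5) by simp
          next
            case 3
            then show ?thesis using IH(7)[of x y] de[of x] by (simp add: sumJ)
          qed
        qed
        show "odd (ideg I (?P x) y) \<longleftrightarrow> y = x \<or> y = ?\<iota> x" for y
          using c r(5) IH(8)[of x y] degQ[of y] by auto
      next
        fix x y assume xy: "odd (ideg I J x)" "odd (ideg I J y)" "y \<noteq> x" "y \<noteq> ?\<iota> x"
        have Qz: "Q \<inter> P z = {}" if "odd (ideg I K z)" "z \<noteq> s" "z \<noteq> r" for z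
          using IH(9)[OF sK that(1)] that(2,3) IH(4)[OF that(1)] JK(2) by (auto simp: Q_def r_def)
        consider "x = t" | "x = r" | "x \<noteq> t" "x \<noteq> r" by blast
        then show "?P x \<inter> ?P y = {}"
        proof cases
          case 1
          then have "y \<noteq> t" "y \<noteq> r" using xy r(5) by auto
          then show ?thesis using 1 r(5) cases[OF xy(2)] Qz[of y] by auto
        next
          case 2
          then have "y \<noteq> t" "y \<noteq> r" using xy r(5) by auto
          then show ?thesis using 2 r(5) cases[OF xy(2)] Qz[of y] by auto
        next
          case 3
          then have x3: "odd (ideg I K x)" "x \<noteq> s" using cases[OF xy(1)] by auto
          show ?thesis
          proof (cases "y = t \<or> y = r")
            case True
            then show ?thesis using 3 Qz[OF x3 3(2)] by auto
          next
            case False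
            then show ?thesis using 3 IH(9)[OF x3(1), of y] cases[OF xy(2)] xy by auto
          qed
        qed
      qed
    qed
  qed
qed

section \<open>Pairing of stubs along trails and within nodes\<close>

lemma fiber_pairing:
  assumes "finite R" "\<And>x. even (card {s \<in> R. \<nu> s = x})"
  shows "\<exists>\<kappa>. \<forall>s\<in>R. \<kappa> s \<in> R \<and> \<kappa> (\<kappa> s) = s \<and> \<kappa> s \<noteq> s \<and> \<nu> (\<kappa> s) = \<nu> s"
  using assms
proof (induction "card R" arbitrary: R rule: less_induct)
  case less
  show ?case
  proof (cases "R = {}")
    case False
    then obtain s where s: "s \<in> R" by auto
    let ?A = "{r \<in> R. \<nu> r = \<nu> s}"
    have "finite ?A" using less.prems(1) by simp
    have "?A \<noteq> {s}" using less.prems(2)[of "\<nu> s"] by auto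
    moreover have "s \<in> ?A" using s by simp
    ultimately obtain t where t: "t \<in> R" "\<nu> t = \<nu> s" "t \<noteq> s" by blast
    let ?R = "R - {s, t}"
    have "card ?R < card R" using s less.prems(1) by (intro psubset_card_mono) auto
    moreover have "even (card {r \<in> ?R. \<nu> r = x})" for x
    proof (cases "x = \<nu> s")
      case True
      have "{r \<in> ?R. \<nu> r = x} = ?A - {s, t}" using True by auto
      moreover have "card (?A - {s, t}) = card ?A - card {s, t}"
        using s t \<open>finite ?A\<close> by (intro card_Diff_subset) auto
      ultimately show ?thesis using less.prems(2)[of "\<nu> s"] t(3) by simp
    next
      case False
      then have "{r \<in> ?R. \<nu> r = x} = {r \<in> R. \<nu> r = x}" using t by auto
      then show ?thesis using less.prems(2)[of x] by simp
    qed
    ultimately obtain \<kappa> where \<kappa>: "\<forall>r\<in>?R. \<kappa> r \<in> ?R \<and> \<kappa> (\<kappa> r) = r \<and> \<kappa> r \<noteq> r \<and> \<nu> (\<kappa> r) = \<nu> r"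
      using less.hyps[of ?R] less.prems(1) by (metis finite_Diff)
    show ?thesis
      using \<kappa> s t by (intro exI[of _ "\<kappa>(s := t, t := s)"]) auto
  qed auto
qed

text \<open>Each stub sits at a node; the trails of the multigraph connect the nodes with an odd number
  of stubs.  The last hypothesis excludes trails whose two stubs would cancel.\<close>

lemma stub_pairing:
  fixes I :: "'e \<Rightarrow> 'n \<Rightarrow> bool" and sg :: "'s \<Rightarrow> int"
  assumes fin: "finite J" "finite S"
    and two: "\<And>e. e \<in> J \<Longrightarrow> \<exists>x y. x \<noteq> y \<and> (\<forall>z. I e z \<longleftrightarrow> z = x \<or> z = y)"
    and parity: "\<And>x. odd (card {s \<in> S. \<nu> s = x}) \<longleftrightarrow> odd (ideg I J x)"
    and sg: "\<And>s. s \<in> S \<Longrightarrow> sg s = 1 \<or> sg s = -1"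
    and distinct: "\<And>s s'. s \<in> S \<Longrightarrow> s' \<in> S \<Longrightarrow> s \<noteq> s' \<Longrightarrow> \<nu> s = \<nu> s' \<Longrightarrow> lab s \<noteq> lab s'"
    and nocancel: "\<And>s s' P. s \<in> S \<Longrightarrow> s' \<in> S \<Longrightarrow> \<nu> s \<noteq> \<nu> s' \<Longrightarrow>
      (\<And>r. r \<in> S \<Longrightarrow> \<nu> r = \<nu> s \<Longrightarrow> r = s) \<Longrightarrow> (\<And>r. r \<in> S \<Longrightarrow> \<nu> r = \<nu> s' \<Longrightarrow> r = s') \<Longrightarrow>
      lab s = lab s' \<Longrightarrow> P \<subseteq> J \<Longrightarrow> (\<And>x. odd (ideg I P x) \<longleftrightarrow> x = \<nu> s \<or> x = \<nu> s') \<Longrightarrow>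
      sg s * sg s' * (-1) ^ card P = -1"
  shows "\<exists>\<iota> \<eta> p. (\<forall>s\<in>S. \<iota> s \<in> S \<and> \<iota> (\<iota> s) = s \<and> \<iota> s \<noteq> s \<and> (\<eta> s = 1 \<or> \<eta> s = -1) \<and> \<eta> (\<iota> s) = \<eta> s \<and>
      (lab s \<noteq> lab (\<iota> s) \<or> \<eta> s = -1) \<and> (\<forall>e. p s e \<noteq> 0 \<longrightarrow> e \<in> J) \<and>
      (\<forall>x. (\<Sum>e\<in>J. p s e * of_bool (I e x)) = sg s * of_bool (x = \<nu> s) - \<eta> s * sg (\<iota> s) * of_bool (x = \<nu> (\<iota> s)))) \<and>
    (\<forall>e. card {s \<in> S. p s e \<noteq> (0::int)} \<le> 2)"
proof -
  define T where "T = {t. odd (ideg I J t)}"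
  obtain \<iota> P d where ts: "trail_system I J \<iota> P d" using trail_pairing[of J I] fin(1) two by blast
  have inT: "odd (ideg I J t) \<longleftrightarrow> t \<in> T" for t by (simp add: T_def)
  note tr = trail_systemD[OF ts, unfolded inT]
  have oddT: "odd (card {s \<in> S. \<nu> s = t}) \<longleftrightarrow> t \<in> T" for t using parity by (simp add: T_def)
  have fibT: "\<exists>s\<in>S. \<nu> s = t" if "t \<in> T" for t
    using that oddT[of t] by (metis (mono_tags, lifting) Collect_empty_eq card.empty even_zero)
  have "T \<subseteq> \<nu> ` S" using fibT by blast
  then have "finite T" using fin(2) by (auto intro: finite_subset)
  then obtain R where R: "R \<subseteq> T" "R \<inter> \<iota> ` R = {}" "R \<union> \<iota> ` R = T"
    using involution_transversal[of T \<iota>] tr(1,2,3) by auto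
  \<comment> \<open>The product of signs is the \<eta> that a pair at the two ends of the trail will
    receive; \<open>ok\<close> says that 1_a - \<eta> 1_b is not zero.\<close>
  define ok where "ok t s s' \<longleftrightarrow> lab s \<noteq> lab s' \<or> sg s * sg s' * (-1) ^ card (P t) = -1" for t s s'
  have "\<exists>s s'. s \<in> S \<and> s' \<in> S \<and> \<nu> s = t \<and> \<nu> s' = \<iota> t \<and> ok t s s'" if t: "t \<in> T" for t
  proof -
    obtain s s' where s: "s \<in> S" "s' \<in> S" "\<nu> s = t" "\<nu> s' = \<iota> t" using fibT[OF t] fibT[OF tr(1)[OF t]] by blast
    show ?thesis
    proof (rule ccontr)
      assume neg: "\<not> ?thesis"
      \<comment> \<open>If no choice is \<open>ok\<close>, all stubs at both ends share one label.
        Labels at one node are distinct, so each end has a single stub, and \<open>nocancel\<close>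
        yields the required sign after all.\<close>
      then have no: "lab a = lab b" if "a \<in> S" "b \<in> S" "\<nu> a = t" "\<nu> b = \<iota> t" for a b
        using that unfolding ok_def by blast
      have u1: "r = s" if "r \<in> S" "\<nu> r = \<nu> s" for r
        using distinct[OF that(1) s(1)] that no[of r s'] no[of s s'] s by metis
      have u2: "r = s'" if "r \<in> S" "\<nu> r = \<nu> s'" for r
        using distinct[OF that(1) s(2)] that no[of s r] no[of s s'] s by metis
      have "sg s * sg s' * (-1) ^ card (P t) = -1"
        using s tr(3,4)[OF t] tr(8)[OF t] no[OF s] by (intro nocancel u1 u2) auto
      then show False using neg s unfolding ok_def by blast
    qed
  qed
  then obtain f g where fg: "\<And>t. t \<in> T \<Longrightarrow> f t \<in> S \<and> g t \<in> S \<and> \<nu> (f t) = t \<and> \<nu> (g t) = \<iota> t \<and> ok t (f t) (g t)"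
    by metis
  \<comment> \<open>The choice is made on a transversal of the pairs of ends, so that both ends of a
    trail refer to the same two stubs.\<close>
  define l where "l t = (if t \<in> R then f t else g (\<iota> t))" for t
  have RT: "t \<in> R \<longleftrightarrow> \<iota> t \<notin> R" if tT: "t \<in> T" for t
  proof
    show "t \<in> R \<Longrightarrow> \<iota> t \<notin> R" using R(2) by blast
    assume no: "\<iota> t \<notin> R"
    show "t \<in> R"
    proof (rule ccontr)
      assume "t \<notin> R"
      then obtain r where "r \<in> R" "t = \<iota> r" using R(3) tT by blast
      then show False using no tr(2)[of r] R(1) by auto
    qed
  qed
  have l: "l t \<in> S" "\<nu> (l t) = t" if "t \<in> T" for t
    using fg[OF that] fg[OF tr(1)[OF that]] tr(2)[OF that] by (auto simp: l_def)
  have lok: "ok t (l t) (l (\<iota> t))" if "t \<in> T" for t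
  proof (cases "t \<in> R")
    case True
    then show ?thesis using fg[OF that] RT[OF that] tr(2)[OF that] by (simp add: l_def)
  next
    case False
    then show ?thesis using fg[OF tr(1)[OF that]] RT[OF that] tr(2)[OF that] tr(5)[OF that]
      by (auto simp: l_def ok_def mult.commute)
  qed
  \<comment> \<open>One stub of each odd node leaves along its trail. The stubs left behind are even
    in number at every node and are paired in place, where their contributions cancel without any
    routing.\<close>
  define left where "left s \<longleftrightarrow> \<nu> s \<in> T \<and> s = l (\<nu> s)" for s
  let ?R = "{s \<in> S. \<not> left s}"
  have even_fib: "even (card {s \<in> ?R. \<nu> s = x})" for x
  proof (cases "x \<in> T")
    case True
    have "{s \<in> ?R. \<nu> s = x} = {s \<in> S. \<nu> s = x} - {l x}" using True by (auto simp: left_def)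
    moreover have "l x \<in> {s \<in> S. \<nu> s = x}" using l[OF True] by simp
    moreover have "odd (card {s \<in> S. \<nu> s = x})" using True oddT by simp
    ultimately show ?thesis by (metis card_Diff_singleton even_diff_nat odd_one odd_pos Suc_leI One_nat_def even_add le_add_diff_inverse)
  next
    case False
    then have "{s \<in> ?R. \<nu> s = x} = {s \<in> S. \<nu> s = x}" by (auto simp: left_def)
    then show ?thesis using False oddT[of x] by simp
  qed
  have "finite ?R" using fin(2) by simp
  then have "\<exists>\<kappa>. \<forall>s\<in>?R. \<kappa> s \<in> ?R \<and> \<kappa> (\<kappa> s) = s \<and> \<kappa> s \<noteq> s \<and> \<nu> (\<kappa> s) = \<nu> s"
    using even_fib by (rule fiber_pairing)
  then obtain \<kappa> where \<kappa>: "\<forall>s\<in>?R. \<kappa> s \<in> ?R \<and> \<kappa> (\<kappa> s) = s \<and> \<kappa> s \<noteq> s \<and> \<nu> (\<kappa> s) = \<nu> s" ..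
  define \<iota>' where "\<iota>' s = (if left s then l (\<iota> (\<nu> s)) else \<kappa> s)" for s
  define \<eta> where "\<eta> s = (if left s then sg s * sg (\<iota>' s) * (-1) ^ card (P (\<nu> s)) else sg s * sg (\<iota>' s))" for s
  define p where "p s e = (if left s then sg s * d (\<nu> s) e else 0)" for s e
  have leftl: "left (l t)" if "t \<in> T" for t using l[OF that] that by (simp add: left_def)
  have main: "\<iota>' s \<in> S \<and> \<iota>' (\<iota>' s) = s \<and> \<iota>' s \<noteq> s \<and> (\<eta> s = 1 \<or> \<eta> s = -1) \<and> \<eta> (\<iota>' s) = \<eta> s \<and>
      (lab s \<noteq> lab (\<iota>' s) \<or> \<eta> s = -1) \<and> (\<forall>e. p s e \<noteq> 0 \<longrightarrow> e \<in> J) \<and>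
      (\<forall>x. (\<Sum>e\<in>J. p s e * of_bool (I e x)) = sg s * of_bool (x = \<nu> s) - \<eta> s * sg (\<iota>' s) * of_bool (x = \<nu> (\<iota>' s)))"
    if s: "s \<in> S" for s
  proof (cases "left s")
    case True
    define t where "t = \<nu> s"
    have t: "t \<in> T" "s = l t" using True by (auto simp: left_def t_def)
    note it = tr(1)[OF t(1)]
    have i: "\<iota>' s = l (\<iota> t)" using True by (simp add: \<iota>'_def t_def)
    have nu: "\<nu> (l (\<iota> t)) = \<iota> t" "l (\<iota> t) \<in> S" using l[OF it] by auto
    have iis: "\<iota>' (\<iota>' s) = s" unfolding i using leftl[OF it] nu tr(2)[OF t(1)] t(2) by (simp add: \<iota>'_def)
    have e1: "\<eta> s = sg s * sg (l (\<iota> t)) * (-1) ^ card (P t)" using True i by (simp add: \<eta>_def t_def)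
    have e2: "\<eta> (\<iota>' s) = \<eta> s"
      using leftl[OF it] nu iis i tr(5)[OF t(1)] e1 by (simp add: \<eta>_def)
    have pm: "(-1) ^ card (P t) = (1 :: int) \<or> (-1) ^ card (P t) = (-1 :: int)" by (cases "even (card (P t))") auto
    note sgs = sg[OF s] sg[OF nu(2)]
    have "(\<Sum>e\<in>J. p s e * of_bool (I e x)) = sg s * of_bool (x = \<nu> s) - \<eta> s * sg (\<iota>' s) * of_bool (x = \<nu> (\<iota>' s))" for x
    proof -
      have "(\<Sum>e\<in>J. p s e * of_bool (I e x)) = sg s * (\<Sum>e\<in>J. d t e * of_bool (I e x))"
        using True by (simp add: p_def t_def sum_distrib_left mult.assoc)
      also have "\<dots> = sg s * of_bool (x = t) - sg s * (-1) ^ card (P t) * of_bool (x = \<iota> t)"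
        unfolding tr(7)[OF t(1)] by (simp add: algebra_simps)
      also have "sg s * (-1) ^ card (P t) = \<eta> s * sg (l (\<iota> t))"
        unfolding e1 using sgs(2) by auto
      finally show ?thesis by (simp add: i nu(1) t_def[symmetric])
    qed
    moreover have "p s e \<noteq> 0 \<longrightarrow> e \<in> J" for e
      using tr(4,6)[OF t(1)] True by (auto simp: p_def t_def)
    moreover have "lab s \<noteq> lab (\<iota>' s) \<or> \<eta> s = -1"
      using lok[OF t(1)] unfolding ok_def i e1 t(2)[symmetric] .
    moreover have "\<eta> s = 1 \<or> \<eta> s = -1" unfolding e1 using sgs pm by auto
    moreover have "\<iota>' s \<noteq> s" using nu(1) tr(3)[OF t(1)] i t_def by auto
    ultimately show ?thesis using nu(2) i iis e2 by simp
  next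
    case False
    then have k: "\<kappa> s \<in> S" "\<not> left (\<kappa> s)" "\<kappa> (\<kappa> s) = s" "\<kappa> s \<noteq> s" "\<nu> (\<kappa> s) = \<nu> s" using \<kappa>[rule_format, of s] s by auto
    have i: "\<iota>' s = \<kappa> s" "\<iota>' (\<kappa> s) = s" using False k by (auto simp: \<iota>'_def)
    have e: "\<eta> s = sg s * sg (\<kappa> s)" "\<eta> (\<kappa> s) = sg s * sg (\<kappa> s)" using False k i by (auto simp: \<eta>_def)
    have "lab s \<noteq> lab (\<kappa> s)" using distinct[OF s k(1)] k(4,5) by auto
    moreover have "p s e = 0" for e using False by (simp add: p_def)
    ultimately show ?thesis using i e k sg[OF s] sg[OF k(1)] by auto
  qed
  have "card {s \<in> S. p s e \<noteq> 0} \<le> 2" for e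
  proof (cases "{s \<in> S. p s e \<noteq> 0} = {}")
    case True
    then show ?thesis by (simp only: card.empty)
  next
    case False
    then obtain s where s: "s \<in> S" "p s e \<noteq> 0" by blast
    have P: "\<nu> r \<in> T \<and> r = l (\<nu> r) \<and> e \<in> P (\<nu> r)" if "p r e \<noteq> 0" for r
      using that tr(6) by (auto simp: p_def left_def split: if_splits)
    have "{s \<in> S. p s e \<noteq> 0} \<subseteq> {l (\<nu> s), l (\<iota> (\<nu> s))}"
    proof
      fix r assume "r \<in> {s \<in> S. p s e \<noteq> 0}"
      then have "\<nu> r \<in> T" "r = l (\<nu> r)" "e \<in> P (\<nu> r)" using P by auto
      moreover have "\<nu> r = \<nu> s \<or> \<nu> r = \<iota> (\<nu> s)"
        using tr(9)[of "\<nu> s" "\<nu> r"] P[OF s(2)] calculation by blast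
      ultimately show "r \<in> {l (\<nu> s), l (\<iota> (\<nu> s))}" by auto
    qed
    then have "card {s \<in> S. p s e \<noteq> 0} \<le> card {l (\<nu> s), l (\<iota> (\<nu> s))}" by (intro card_mono) auto
    also have "\<dots> \<le> 2" by (simp add: card_insert_if)
    finally show ?thesis .
  qed
  then show ?thesis using main by blast
qed

section \<open>Assembling a certificate along a cut\<close>

abbreviation unit :: "nat set \<Rightarrow> nat set \<Rightarrow> int" where
  "unit h \<equiv> (\<lambda>g. of_bool (g = h))"

lemma form_unit: "finite E \<Longrightarrow> h \<in> E \<Longrightarrow> form E (unit h) v = of_bool (v \<in> h)"
proof -
  assume "finite E" "h \<in> E"
  then have "form E (unit h) v = (\<Sum>g\<in>{h}. unit h g * of_bool (v \<in> g))"
    unfolding form_def by (intro sum.mono_neutral_right) auto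
  then show ?thesis by simp
qed

lemma form_add: "form E (\<lambda>g. c g + d g) v = form E c v + form E d v"
  by (simp add: form_def distrib_right sum.distrib)

lemma form_diff: "form E (\<lambda>g. c g - d g) v = form E c v - form E d v"
  by (simp add: form_def left_diff_distrib sum_subtractf)

lemma form_scale: "form E (\<lambda>g. k * c g) v = k * form E c v"
  by (simp add: form_def sum_distrib_left mult.assoc)

lemma load_Un: "load (R \<union> Q) c g \<le> load R c g + load Q c g"
proof -
  have "{s \<in> R \<union> Q. c s g \<noteq> 0} = {s \<in> R. c s g \<noteq> 0} \<union> {s \<in> Q. c s g \<noteq> 0}" by auto
  then show ?thesis unfolding load_def by (simp only: card_Un_le)
qed

lemma load_cong: "(\<And>s. s \<in> R \<Longrightarrow> c s g = d s g) \<Longrightarrow> load R c g = load R d g"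
  unfolding load_def by (rule arg_cong[of _ _ card]) auto

lemma card_2_MinMax:
  assumes "card (e :: nat set) = 2"
  shows "e = {Min e, Max e}" "Min e < Max e"
proof -
  obtain x y where "e = {x, y}" "x \<noteq> y" using assms by (meson card_2_iff)
  then show "e = {Min e, Max e}" "Min e < Max e" by (auto simp: min_def max_def)
qed

text \<open>A column supported on one part vanishes at the vertices of the other, so the matrix has
  a zero block and the permanent factors.\<close>

lemma certified_disjoint_Un:
  assumes fin: "finite E" "finite F" and ne: "\<And>e. e \<in> E \<union> F \<Longrightarrow> card e = 2"
    and disj: "\<And>e f. e \<in> E \<Longrightarrow> f \<in> F \<Longrightarrow> e \<inter> f = {}"
    and "certified E" "certified F"
  shows "certified (E \<union> F)"
proof -
  obtain c d where c: "\<forall>g\<in>E. load E c g \<le> 4"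
      "permanent E (\<lambda>r s. form E (c s) (Min r) - form E (c s) (Max r)) \<noteq> 0"
    and d: "\<forall>g\<in>F. load F d g \<le> 4"
      "permanent F (\<lambda>r s. form F (d s) (Min r) - form F (d s) (Max r)) \<noteq> 0"
    using assms unfolding certified_def by blast
  have EF: "E \<inter> F = {}" using disj ne by (metis Int_absorb UnCI card.empty disjoint_iff zero_neq_numeral)
  define b where "b s g = (if s \<in> E then of_bool (g \<in> E) * c s g else of_bool (g \<in> F) * d s g)" for s g
  have mem: "Min e \<in> e" "Max e \<in> e" if "e \<in> E \<union> F" for e
    using card_2_MinMax(1)[OF ne[OF that]] by (metis insertCI)+
  have f1: "form (E \<union> F) (b s) v = form E (c s) v" if "s \<in> E" for s v
    unfolding form_def using fin EF that by (intro sum.mono_neutral_cong_right) (auto simp: b_def)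
  have f2: "form (E \<union> F) (b s) v = form F (d s) v" if "s \<in> F" for s v
    unfolding form_def using fin EF that by (intro sum.mono_neutral_cong_right) (auto simp: b_def)
  have z: "form E (c s) v = 0" if "r \<in> F" "v \<in> r" for s r v
    unfolding form_def using disj that by (intro sum.neutral) auto
  let ?A = "\<lambda>r s. form (E \<union> F) (b s) (Min r) - form (E \<union> F) (b s) (Max r)"
  have "permanent (E \<union> F) ?A = permanent E ?A * permanent F ?A"
    using fin EF by (rule permanent_block_triangular) (use f1 z mem in auto)
  also have "permanent E ?A = permanent E (\<lambda>r s. form E (c s) (Min r) - form E (c s) (Max r))"
    by (rule permanent_cong) (simp add: f1)
  also have "permanent F ?A = permanent F (\<lambda>r s. form F (d s) (Min r) - form F (d s) (Max r))"
    by (rule permanent_cong) (simp add: f2)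
  finally have "permanent (E \<union> F) ?A \<noteq> 0" using c(2) d(2) by simp
  moreover have "load (E \<union> F) b g \<le> 4" if "g \<in> E \<union> F" for g
  proof (cases "g \<in> E")
    case True
    then have "{s \<in> E \<union> F. b s g \<noteq> 0} = {s \<in> E. c s g \<noteq> 0}" using EF by (auto simp: b_def)
    then show ?thesis using c(1) True by (simp add: load_def)
  next
    case False
    then have "{s \<in> E \<union> F. b s g \<noteq> 0} = {s \<in> F. d s g \<noteq> 0}" using EF that by (auto simp: b_def)
    then show ?thesis using d(1) that False by (auto simp add: load_def)
  qed
  ultimately show ?thesis unfolding certified_def by blast
qed

locale cut_graph =
  fixes E :: "nat set set" and X :: "nat set"
  assumes finE: "finite E"
    and card2: "e \<in> E \<Longrightarrow> card e = 2"
    and indep: "e \<in> E \<Longrightarrow> \<not> e \<subseteq> X"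
begin

definition B where "B = {e \<in> E. e \<inter> X \<noteq> {}}"
definition UU where "UU = {e \<in> E. e \<inter> X = {}}"
definition lam :: "nat set \<Rightarrow> nat" where "lam s = (if Min s \<in> X then Min s else Max s)"
definition mu :: "nat set \<Rightarrow> nat" where "mu s = (if Min s \<in> X then Max s else Min s)"

lemma BE: "B \<subseteq> E" and UUE: "UU \<subseteq> E" and EBU: "E = B \<union> UU" and BU: "B \<inter> UU = {}"
  by (auto simp: B_def UU_def)

lemma finB: "finite B" and finUU: "finite UU"
  using finE BE UUE by (auto intro: finite_subset)

lemma edge_ends: "e \<in> E \<Longrightarrow> e = {Min e, Max e}" "e \<in> E \<Longrightarrow> Min e \<noteq> Max e"
  using card_2_MinMax[OF card2, of e] by (blast, metis less_irrefl)

lemma cut_ends: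
  assumes "s \<in> B"
  shows "s = {lam s, mu s}" "lam s \<in> X" "mu s \<notin> X"
proof -
  have s: "s \<in> E" "s \<inter> X \<noteq> {}" using assms by (auto simp: B_def)
  note e = edge_ends[OF s(1)] indep[OF s(1)]
  show "s = {lam s, mu s}" using e(1) by (auto simp: lam_def mu_def)
  obtain x where "x \<in> s" "x \<in> X" using s(2) by auto
  then have "Min s \<in> X \<or> Max s \<in> X" by (subst (asm) e(1)) auto
  then show "lam s \<in> X" by (auto simp: lam_def)
  obtain y where "y \<in> s" "y \<notin> X" using e(3) by auto
  then have "Min s \<notin> X \<or> Max s \<notin> X" by (subst (asm) e(1)) auto
  then show "mu s \<notin> X" by (auto simp: mu_def)
qed

lemma cut_eq: "x \<in> X \<Longrightarrow> u \<notin> X \<Longrightarrow> s = {x, u} \<Longrightarrow> lam s = x \<and> mu s = u"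
  by (auto simp: lam_def mu_def min_def max_def)

lemma cut_mem: "s \<in> B \<Longrightarrow> v \<in> s \<Longrightarrow> v \<in> X \<Longrightarrow> v = lam s" "s \<in> B \<Longrightarrow> v \<in> s \<Longrightarrow> v \<notin> X \<Longrightarrow> v = mu s"
proof -
  assume s: "s \<in> B" "v \<in> s"
  have "v = lam s \<or> v = mu s" using s(2) by (subst (asm) cut_ends(1)[OF s(1)]) simp
  then show "v \<in> X \<Longrightarrow> v = lam s" "v \<notin> X \<Longrightarrow> v = mu s" using cut_ends(2,3)[OF s(1)] by auto
qed

lemma cutI: "{x, u} \<in> E \<Longrightarrow> x \<in> X \<Longrightarrow> {x, u} \<in> B"
  by (auto simp: B_def)

text \<open>Columns of cut edges vanish outside \<open>X\<close>, so the rows of \<open>UU\<close>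
  are zero on them and the permanent factors. A row of a cut edge then sees only its end in
  \<open>X\<close>, up to a sign. The block of \<open>UU\<close> is handled by
  \<open>permanent_ranked\<close>, an edge being ranked by its lower end.\<close>

lemma permanent_assembly:
  fixes rank :: "nat \<Rightarrow> nat" and low :: "nat set \<Rightarrow> nat"
  assumes low: "\<And>e. e \<in> UU \<Longrightarrow> low e \<in> e" "\<And>e v. e \<in> UU \<Longrightarrow> v \<in> e \<Longrightarrow> v \<noteq> low e \<Longrightarrow> rank (low e) < rank v"
    and inj: "inj_on rank (\<Union>E - X)"
    and cB: "\<And>s v. s \<in> B \<Longrightarrow> v \<notin> X \<Longrightarrow> form E (c s) v = 0"
    and c1: "\<And>e. e \<in> UU \<Longrightarrow> form E (c e) (low e) = 1"
    and c0: "\<And>e v. e \<in> UU \<Longrightarrow> v \<notin> X \<Longrightarrow> rank v > rank (low e) \<Longrightarrow> form E (c e) v = 0"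
    and block: "permanent B (\<lambda>r s. form E (c s) (lam r)) \<noteq> 0"
  shows "permanent E (\<lambda>r s. form E (c s) (Min r) - form E (c s) (Max r)) \<noteq> 0"
proof -
  let ?A = "\<lambda>r s. form E (c s) (Min r) - form E (c s) (Max r)"
  have UUX: "v \<notin> X" "v \<in> \<Union>E - X" if "r \<in> UU" "v \<in> r" for r v using that by (auto simp: UU_def)
  have ends: "Min r \<in> r" "Max r \<in> r" "\<And>v. v \<in> r \<Longrightarrow> v = Min r \<or> v = Max r" "Min r \<noteq> Max r" if "r \<in> E" for r
    using edge_ends[OF that] by blast+
  have "permanent E ?A = permanent B ?A * permanent UU ?A"
  proof -
    have "permanent (B \<union> UU) ?A = permanent B ?A * permanent UU ?A"
    proof (rule permanent_block_triangular[OF finB finUU BU])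
      fix r s assume "r \<in> UU" "s \<in> B"
      then show "?A r s = 0"
        using cB[of s] ends(1,2)[of r] UUX(1)[of r] UUE by auto
    qed
    then show ?thesis by (simp only: EBU[symmetric])
  qed
  moreover have "permanent B ?A \<noteq> 0"
  proof -
    have "permanent B ?A = (\<Prod>r\<in>B. (if Min r \<in> X then 1 else -1)) * permanent B (\<lambda>r s. form E (c s) (lam r))"
    proof (rule permanent_row_factor)
      fix r s assume rs: "r \<in> B" "s \<in> B"
      have "form E (c s) (mu r) = 0" using cB[OF rs(2) cut_ends(3)[OF rs(1)]] .
      then show "?A r s = (if Min r \<in> X then 1 else -1) * form E (c s) (lam r)"
        by (auto simp: lam_def mu_def)
    qed
    then show ?thesis using block finB by (auto split: if_splits)
  qed
  moreover have "permanent UU ?A \<noteq> 0"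
  proof (rule permanent_ranked[OF finUU, where rk = "\<lambda>e. rank (low e)" and c = "\<lambda>r. if low r = Min r then 1 else -1"])
    fix r s assume rs: "r \<in> UU" "s \<in> UU"
    have rE: "r \<in> E" using rs UUE by auto
    show "rank (low r) \<le> rank (low s)" if "?A r s \<noteq> 0"
    proof (rule ccontr)
      assume "\<not> ?thesis"
      then have "rank v > rank (low s)" if "v \<in> r" for v
        using low(2)[OF rs(1) that] by (cases "v = low r") auto
      then have "form E (c s) v = 0" if "v \<in> r" for v using c0[OF rs(2)] UUX[OF rs(1)] that by blast
      then show False using that ends(1,2)[OF rE] by simp
    qed
    show "?A r s = (if low r = Min r then 1 else -1)" if eq: "rank (low r) = rank (low s)"
    proof -
      have "low r = low s"
        using inj eq UUX(2)[OF rs(1) low(1)[OF rs(1)]] UUX(2)[OF rs(2) low(1)[OF rs(2)]] by (auto dest: inj_onD)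
      then have one: "form E (c s) (low r) = 1" using c1[OF rs(2)] by simp
      have zero: "form E (c s) v = 0" if "v \<in> r" "v \<noteq> low r" for v
        using c0[OF rs(2)] UUX(1)[OF rs(1) that(1)] low(2)[OF rs(1) that] eq by simp
      consider "low r = Min r" | "low r = Max r" "low r \<noteq> Min r" using ends(3)[OF rE low(1)[OF rs(1)]] by blast
      then show ?thesis
        using one zero[of "Min r"] zero[of "Max r"] ends(1,2,4)[OF rE] by cases auto
    qed
  qed auto
  ultimately show ?thesis by simp
qed

definition low :: "(nat \<Rightarrow> nat) \<Rightarrow> nat set \<Rightarrow> nat" where
  "low rank e = (if rank (Min e) < rank (Max e) then Min e else Max e)"

definition high :: "(nat \<Rightarrow> nat) \<Rightarrow> nat set \<Rightarrow> nat" where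
  "high rank e = (if rank (Min e) < rank (Max e) then Max e else Min e)"

lemma low_high:
  assumes inj: "inj_on rank (\<Union>E - X)" and e: "e \<in> UU"
  shows "e = {low rank e, high rank e}" "rank (low rank e) < rank (high rank e)"
proof -
  have eE: "e \<in> E" using e UUE by auto
  note ends = edge_ends[OF eE]
  show "e = {low rank e, high rank e}" using ends(1) by (auto simp: low_def high_def)
  have "Min e \<in> e" "Max e \<in> e" using ends(1) by blast+
  then have "Min e \<in> \<Union>E - X" "Max e \<in> \<Union>E - X" using e by (auto simp: UU_def)
  then have "rank (Min e) \<noteq> rank (Max e)" using inj ends(2) by (auto dest: inj_onD)
  then show "rank (low rank e) < rank (high rank e)" by (auto simp: low_def high_def)
qed

text \<open>The edges outside \<open>M\<close> with a common upper end \<open>u\<close> form a chain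
  ordered by their lower ends. The column of an edge is the edge minus its predecessor, or minus
  \<open>{\<gamma> u, u}\<close> for the first one; the value at \<open>u\<close> cancels. So each
  edge of a chain lies in at most two columns and \<open>{\<gamma> u, u}\<close> starts at most one
  chain. The column of an edge of \<open>M\<close> is instead the rooted edge at its lower end,
  which keeps \<open>M\<close> free of load.\<close>

lemma ground_columns:
  fixes rank :: "nat \<Rightarrow> nat"
  assumes inj: "inj_on rank (\<Union>E - X)"
    and \<gamma>: "\<forall>u\<in>\<Union>E - X. \<gamma> u \<in> X \<and> {\<gamma> u, u} \<in> E"
    and M: "M \<subseteq> UU"
  defines "lo \<equiv> low rank"
  shows "\<exists>c. (\<forall>e\<in>UU. form E (c e) (lo e) = 1 \<and>
      (\<forall>v. v \<notin> X \<longrightarrow> rank v > rank (lo e) \<longrightarrow> form E (c e) v = 0)) \<and>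
    (\<forall>g\<in>M. load UU c g = 0) \<and> (\<forall>g\<in>UU. load UU c g \<le> 2) \<and>
    (\<forall>g\<in>B. load UU c g \<le> (if g = {\<gamma> (mu g), mu g}
       then of_bool (\<exists>b. {b, mu g} \<in> UU - M \<and> rank b < rank (mu g)) + card {e \<in> M. lo e = mu g} else 0))"
proof -
  note \<gamma> = \<gamma>[rule_format]
  define hi where "hi = high rank"
  define Pv where "Pv e = {b. {b, hi e} \<in> UU - M \<and> rank b < rank (lo e)}" for e
  define prev where "prev e = (ARG_MAX rank b. b \<in> Pv e)" for e
  define gd where "gd e = (if Pv e = {} then {\<gamma> (hi e), hi e} else {prev e, hi e})" for e
  define c where "c e = (if e \<in> M then unit {\<gamma> (lo e), lo e} else (\<lambda>g. unit e g - unit (gd e) g))" for e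
  note lh = low_high[OF inj, folded lo_def hi_def]
  have V: "lo e \<in> \<Union>E - X" "hi e \<in> \<Union>E - X" "lo e \<in> e" "hi e \<in> e" "lo e \<noteq> hi e" if "e \<in> UU" for e
    using lh[OF that] that UUE by (auto simp: UU_def)
  have prev: "prev e \<in> Pv e" "\<And>b. b \<in> Pv e \<Longrightarrow> rank b \<le> rank (prev e)" if ne: "Pv e \<noteq> {}" and "e \<in> UU" for e
  proof -
    obtain k where k: "k \<in> Pv e" using ne by auto
    have "\<forall>y. y \<in> Pv e \<longrightarrow> rank y < Suc (rank (lo e))" by (auto simp: Pv_def)
    then have "prev e \<in> Pv e \<and> (\<forall>y. y \<in> Pv e \<longrightarrow> rank y \<le> rank (prev e))"
      unfolding prev_def by (rule arg_max_nat_lemma[of "\<lambda>b. b \<in> Pv e", OF k])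
    then show "prev e \<in> Pv e" "\<And>b. b \<in> Pv e \<Longrightarrow> rank b \<le> rank (prev e)" by auto
  qed
  have gdE: "gd e \<in> E" if "e \<in> UU" for e
    using prev[of e] that \<gamma>[OF V(2)[OF that]] UUE by (auto simp: gd_def Pv_def)
  have gdv: "v = hi e \<or> v \<in> X \<or> rank v < rank (lo e)" if "e \<in> UU" "v \<in> gd e" for e v
    using that prev[of e] \<gamma>[OF V(2)[OF that(1)]] by (auto simp: gd_def Pv_def split: if_splits)
  have hig: "hi e \<in> gd e" for e by (auto simp: gd_def)
  have f: "form E (c e) v = (if e \<in> M then of_bool (v \<in> {\<gamma> (lo e), lo e}) else of_bool (v \<in> e) - of_bool (v \<in> gd e))"
    if "e \<in> UU" for e v
    using that \<gamma>[OF V(1)[OF that]] gdE[OF that] UUE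
    by (auto simp: c_def form_diff form_unit[OF finE] simp del: insert_iff)
  have nz: "e = g \<or> gd e = g" if "c e g \<noteq> 0" "e \<notin> M" for e g
    using that by (cases "g = e"; cases "g = gd e") (simp_all add: c_def)
  have nzM: "g = {\<gamma> (lo e), lo e}" if "c e g \<noteq> 0" "e \<in> M" for e g
    using that by (simp add: c_def)
  \<comment> \<open>Predecessors determine the edge: if two edges have the same upper end, the
    smaller lower end is a candidate for the predecessor of the other edge, which therefore lies at
    or above it, while the predecessor of the first edge lies strictly below it.\<close>
  have uniq: "e = e'" if e: "e \<in> UU - M" "e' \<in> UU - M" "hi e = hi e'" "gd e = gd e'" for e e'
  proof -
    have aux: False if e: "e \<in> UU - M" "e' \<in> UU - M" "hi e = hi e'" "gd e = gd e'" and lt: "rank (lo e) < rank (lo e')" for e e'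
    proof -
      have mem: "lo e \<in> Pv e'" using e lt lh(1)[of e] by (auto simp: Pv_def)
      then have p': "prev e' \<in> Pv e'" "rank (lo e) \<le> rank (prev e')" using prev[of e'] e(2) by auto
      have "prev e' \<in> gd e'" using mem by (auto simp: gd_def)
      then have "prev e' \<in> gd e" using e(4) by simp
      moreover have "rank (prev e') < rank (hi e)" using p'(1) e(2,3) lh(2)[of e'] by (auto simp: Pv_def)
      moreover have "prev e' \<notin> X" using p'(1) by (auto simp: Pv_def UU_def)
      ultimately have "rank (prev e') < rank (lo e)" using gdv[of e "prev e'"] e(1) by auto
      then show False using p'(2) by simp
    qed
    have "rank (lo e) = rank (lo e')" using aux[OF e] aux[OF e(2,1) e(3)[symmetric] e(4)[symmetric]] linorder_less_linear by blast
    then have "lo e = lo e'" using inj V(1)[of e] V(1)[of e'] e(1,2) by (auto dest: inj_onD)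
    then show ?thesis using lh(1)[of e] lh(1)[of e'] e by auto
  qed
  have P1: "form E (c e) (lo e) = 1" if e: "e \<in> UU" for e
  proof -
    have "lo e \<notin> gd e" using gdv[OF e, of "lo e"] V[OF e] by auto
    then show ?thesis using f[OF e] V(3)[OF e] by simp
  qed
  have P2: "form E (c e) v = 0" if e: "e \<in> UU" and v: "v \<notin> X" "rank v > rank (lo e)" for e v
  proof -
    have "v \<noteq> lo e" using v by auto
    moreover have "v \<noteq> \<gamma> (lo e)" using v \<gamma>[OF V(1)[OF e]] by auto
    moreover have "v \<in> gd e \<longleftrightarrow> v = hi e" using gdv[OF e, of v] v hig by auto
    moreover have "v \<in> e \<longleftrightarrow> v = lo e \<or> v = hi e" using lh(1)[OF e] by blast
    ultimately show ?thesis using f[OF e] by simp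
  qed
  have P3: "load UU c g = 0" if g: "g \<in> M" for g
  proof -
    have "c e g = 0" if e: "e \<in> UU" for e
    proof (cases "e \<in> M")
      case True
      have "g \<noteq> {\<gamma> (lo e), lo e}" using \<gamma>[OF V(1)[OF e]] g M by (auto simp: UU_def)
      then show ?thesis using nzM[OF _ True] by blast
    next
      case False
      have "gd e \<noteq> g"
      proof
        assume eq: "gd e = g"
        then have "Pv e \<noteq> {}" using \<gamma>[OF V(2)[OF e]] g M by (auto simp: gd_def UU_def)
        then have "gd e = {prev e, hi e}" "prev e \<in> Pv e"
          using prev(1)[OF _ e] by (auto simp: gd_def)
        then show False using eq g by (auto simp: Pv_def)
      qed
      then show ?thesis using nz[OF _ False, of g] False g by auto
    qed
    then show ?thesis unfolding load_def by (simp cong: conj_cong)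
  qed
  have one: "card {e \<in> UU - M. gd e = g \<and> hi e = h} \<le> 1" for g h
    using uniq by (subst card_le_Suc0_iff_eq[unfolded One_nat_def[symmetric]]) (use finUU in auto)
  have P4: "load UU c g \<le> 2" if g: "g \<in> UU" for g
  proof -
    have "{e \<in> UU. c e g \<noteq> 0} \<subseteq> {g} \<union> {e \<in> UU - M. gd e = g \<and> hi e = hi g}"
    proof
      fix e assume "e \<in> {e \<in> UU. c e g \<noteq> 0}"
      then have e: "e \<in> UU" "c e g \<noteq> 0" by auto
      have eM: "e \<notin> M" using nzM[OF e(2)] \<gamma>[OF V(1)[OF e(1)]] g by (auto simp: UU_def)
      show "e \<in> {g} \<union> {e \<in> UU - M. gd e = g \<and> hi e = hi g}"
      proof (cases "e = g")
        case False
        then have eq: "gd e = g" using nz[OF e(2) eM] by auto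
        then have P: "Pv e \<noteq> {}" using \<gamma>[OF V(2)[OF e(1)]] g by (auto simp: gd_def UU_def)
        have lt: "rank (prev e) < rank (hi e)" using prev(1)[OF P e(1)] lh(2)[OF e(1)] by (auto simp: Pv_def)
        have "{prev e, hi e} = {lo g, hi g}" using eq P lh(1)[OF g] by (auto simp: gd_def)
        then have "hi e = hi g" using lt lh(2)[OF g] by (metis doubleton_eq_iff less_asym)
        then show ?thesis using eq e(1) eM by auto
      qed simp
    qed
    then have "load UU c g \<le> card ({g} \<union> {e \<in> UU - M. gd e = g \<and> hi e = hi g})"
      unfolding load_def using finUU by (intro card_mono) auto
    also have "\<dots> \<le> card {g} + card {e \<in> UU - M. gd e = g \<and> hi e = hi g}" by (rule card_Un_le)
    also have "\<dots> \<le> 2" using one[of g "hi g"] by simp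
    finally show ?thesis .
  qed
  have P5: "load UU c g \<le> (if g = {\<gamma> (mu g), mu g}
       then of_bool (\<exists>b. {b, mu g} \<in> UU - M \<and> rank b < rank (mu g)) + card {e \<in> M. lo e = mu g} else 0)"
    if g: "g \<in> B" for g
  proof -
    let ?u = "mu g"
    have col: "g = {\<gamma> ?u, ?u} \<and> (e \<in> M \<and> lo e = ?u \<or> e \<in> UU - M \<and> gd e = g \<and> hi e = ?u)"
      if e: "e \<in> UU" "c e g \<noteq> 0" for e
    proof (cases "e \<in> M")
      case True
      then have "g = {\<gamma> (lo e), lo e}" using nzM e by auto
      moreover from this have "mu g = lo e" using cut_eq[of "\<gamma> (lo e)" "lo e" g] V(1)[OF e(1)] \<gamma>[OF V(1)[OF e(1)]] by auto
      ultimately show ?thesis using True by auto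
    next
      case False
      have "e \<noteq> g" using e g BU by auto
      then have eq: "gd e = g" using nz[OF e(2) False] by auto
      have "Pv e = {}"
      proof (rule ccontr)
        assume "Pv e \<noteq> {}"
        then have "g \<in> UU" using prev(1)[OF _ e(1)] eq by (auto simp: gd_def Pv_def)
        then show False using g BU by auto
      qed
      then have "g = {\<gamma> (hi e), hi e}" using eq by (auto simp: gd_def)
      moreover from this have "mu g = hi e" using cut_eq[of "\<gamma> (hi e)" "hi e" g] V(2)[OF e(1)] \<gamma>[OF V(2)[OF e(1)]] by auto
      ultimately show ?thesis using False e eq by auto
    qed
    show ?thesis
    proof (cases "g = {\<gamma> ?u, ?u}")
      case False
      then have "{e \<in> UU. c e g \<noteq> 0} = {}" using col by blast
      then have "load UU c g = 0" unfolding load_def by (simp only: card.empty)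
      then show ?thesis by simp
    next
      case True
      let ?A = "{e \<in> UU - M. gd e = g \<and> hi e = ?u}" and ?D = "{e \<in> M. lo e = ?u}"
      have "{e \<in> UU. c e g \<noteq> 0} \<subseteq> ?A \<union> ?D" using col by blast
      moreover have "finite (?A \<union> ?D)" using finUU M by (auto intro: finite_subset)
      ultimately have "load UU c g \<le> card (?A \<union> ?D)" unfolding load_def by (rule card_mono[rotated])
      also have "\<dots> \<le> card ?A + card ?D" by (rule card_Un_le)
      finally have le: "load UU c g \<le> card ?A + card ?D" .
      have "card ?A \<le> of_bool (\<exists>b. {b, ?u} \<in> UU - M \<and> rank b < rank ?u)"
      proof (cases "?A = {}")
        case True
        then show ?thesis by (simp only: card.empty)
      next
        case False
        then obtain e where "e \<in> ?A" by blast
        then have "e = {lo e, ?u}" "rank (lo e) < rank ?u" "e \<in> UU - M" using lh[of e] by auto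
        then have "\<exists>b. {b, ?u} \<in> UU - M \<and> rank b < rank ?u" by metis
        then show ?thesis using one[of g ?u] by simp
      qed
      then have "load UU c g \<le> of_bool (\<exists>b. {b, ?u} \<in> UU - M \<and> rank b < rank ?u) + card ?D" using le by linarith
      then show ?thesis unfolding if_P[OF True] .
    qed
  qed
  show ?thesis using P1 P2 P3 P4 P5 by (intro exI[of _ c]) blast
qed

end

section \<open>Odd joins and the absence of cancelling trails\<close>

abbreviation dg :: "nat set set \<Rightarrow> nat \<Rightarrow> nat" where
  "dg \<equiv> ideg (\<lambda>e v. v \<in> e)"

lemma ideg_Un_disjoint:
  assumes "finite A" "finite C" "A \<inter> C = {}"
  shows "ideg I (A \<union> C) x = ideg I A x + ideg I C x"
proof -
  have "{e \<in> A \<union> C. I e x} = {e \<in> A. I e x} \<union> {e \<in> C. I e x}" by auto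
  then show ?thesis unfolding ideg_def using assms
    by (simp only:) (intro card_Un_disjoint; auto)
qed

lemma odd_ideg_sym_diff:
  assumes "finite A" "finite C"
  shows "odd (ideg I (sym_diff A C) x) \<longleftrightarrow> odd (ideg I A x) \<noteq> odd (ideg I C x)"
proof -
  have 1: "ideg I A x = ideg I (A - C) x + ideg I (A \<inter> C) x"
  proof -
    have "A - C \<union> A \<inter> C = A" by auto
    then show ?thesis using ideg_Un_disjoint[of "A - C" "A \<inter> C" I x] assms by auto
  qed
  have 2: "ideg I C x = ideg I (C - A) x + ideg I (A \<inter> C) x"
  proof -
    have "C - A \<union> A \<inter> C = C" by auto
    then show ?thesis using ideg_Un_disjoint[of "C - A" "A \<inter> C" I x] assms by auto
  qed
  have 3: "ideg I (sym_diff A C) x = ideg I (A - C) x + ideg I (C - A) x"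
    using assms by (intro ideg_Un_disjoint) auto
  show ?thesis unfolding 1 2 3 by auto
qed

lemma ideg_singleton: "ideg I {e} x = of_bool (I e x)"
  using ideg_insert[of "{}" e I x] by (simp add: ideg_def)

lemma ideg_pos: "ideg I A x \<noteq> 0 \<Longrightarrow> \<exists>e\<in>A. I e x"
  unfolding ideg_def by (metis (mono_tags, lifting) Collect_empty_eq card.empty)

context cut_graph
begin

lemma B_mem: "s \<in> B \<Longrightarrow> mu s \<in> s" "s \<in> B \<Longrightarrow> lam s \<in> s" "s \<in> B \<Longrightarrow> mu s \<in> \<Union>E - X" "s \<in> B \<Longrightarrow> lam s \<in> \<Union>E"
proof -
  assume s: "s \<in> B"
  then show "mu s \<in> s" "lam s \<in> s" using cut_ends(1)[OF s] by blast+
  then show "mu s \<in> \<Union>E - X" "lam s \<in> \<Union>E" using s BE cut_ends(3)[OF s] by auto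
qed

lemma B_eqI: "s \<in> B \<Longrightarrow> s' \<in> B \<Longrightarrow> mu s = mu s' \<Longrightarrow> lam s = lam s' \<Longrightarrow> s = s'"
  using cut_ends(1) by metis

lemma B_in: "s \<in> B \<Longrightarrow> v \<in> s \<longleftrightarrow> v = lam s \<or> v = mu s"
  using cut_ends(1)[of s] by blast

lemma dgB: "v \<notin> X \<Longrightarrow> dg B v = card {s \<in> B. mu s = v}"
  unfolding ideg_def using cut_mem(2) B_mem(1) by (intro arg_cong[of _ _ card]) auto

end

text \<open>\<open>W\<close> holds at most one vertex, which repairs the parity of the number of cut edges; there the column
  of \<open>t0\<close> is left unpaired.  The second clause of \<open>Jmin\<close> breaks ties between sets of equal size.\<close>

locale main_case = cut_graph E X for E X +
  fixes W :: "nat set" and J :: "nat set set" and \<gamma> :: "nat \<Rightarrow> nat" and t0 :: "nat set" and M :: "nat set set"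
  assumes W: "W \<noteq> {} \<Longrightarrow> t0 \<in> B \<and> W = {mu t0} \<and> lam t0 \<noteq> \<gamma> (mu t0)"
    and JE: "J \<subseteq> E"
    and Jodd: "\<And>v. odd (dg J v) \<longleftrightarrow> v \<in> \<Union>E - X \<and> odd (dg B v + of_bool (v \<in> W))"
    and Jmin: "\<And>C. C \<subseteq> E \<Longrightarrow> (\<And>v. even (dg C v)) \<Longrightarrow>
      card (C \<inter> J) \<le> card (C - J) \<and> (card (C \<inter> J) = card (C - J) \<longrightarrow> card (C \<inter> J \<inter> UU) \<le> card ((C - J) \<inter> UU))"
  fixes Z Z2 :: "nat set"
  defines "Z \<equiv> {u \<in> \<Union>E - X. \<forall>s\<in>B. u \<in> s \<longrightarrow> s \<in> J}"
    and "Z2 \<equiv> {u \<in> Z. dg B u = 2 \<and> u \<notin> W \<and> (\<forall>g\<in>J. u \<in> g \<longrightarrow> g \<in> B)}"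
  assumes \<gamma>: "\<And>u. u \<in> \<Union>E - X \<Longrightarrow> \<gamma> u \<in> X \<and> {\<gamma> u, u} \<in> E"
    and \<gamma>inj: "inj_on \<gamma> Z"
    and \<gamma>J: "\<And>u. u \<in> \<Union>E - X \<Longrightarrow> u \<notin> Z \<Longrightarrow> {\<gamma> u, u} \<notin> J"
    and ME: "\<And>e. e \<in> M \<Longrightarrow> e \<in> E \<and> e \<subseteq> Z2"
    and Mdisj: "\<And>e f. e \<in> M \<Longrightarrow> f \<in> M \<Longrightarrow> e \<noteq> f \<Longrightarrow> e \<inter> f = {}"
    and Mmax: "\<And>e. e \<in> E \<Longrightarrow> e \<subseteq> Z2 \<Longrightarrow> \<exists>f\<in>M. e \<inter> f \<noteq> {}"
begin

text \<open>A cut edge is a stub with label \<open>lam s\<close>, sitting at \<open>pos s\<close>.  The stubs in \<open>canc\<close> sit at their end in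
  \<open>X\<close>, so that the edge \<open>{\<gamma> u, u}\<close> drops out of \<open>J\<close> and carries no load; those in \<open>spec\<close> are paired
  directly across the edges of \<open>M\<close>.  A vertex \<open>u\<close> of \<open>S3\<close> keeps a single stub.  Placing that stub at a
  separate node \<open>(u, True)\<close>, incident with \<open>t u\<close> only, prevents its trail from leaving along the stub.\<close>

definition Y0 where "Y0 = Z2 - \<Union>M"
text \<open>Vertices of \<open>Y0\<close> must not have a stub cancelled: they have two cut edges
  and no other edge of \<open>J\<close>, so the remaining stub could be routed only along its own
  cut edge. Matched vertices of \<open>Z2\<close> avoid this by pairing that stub across
  \<open>M\<close>. Unmatched ones keep both stubs; no edge of \<open>E\<close> joins two of them,
  which permits placing them first in the ordering.\<close>

definition Zc where "Zc = Z - Y0"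
definition canc where "canc = {s \<in> B. mu s \<in> Zc \<and> lam s = \<gamma> (mu s)}"
text \<open>The edges of \<open>M\<close> restore parity: at a matched vertex no stub is left in
  \<open>S\<close>, \<open>J\<close> loses one of its two edges, and one edge of \<open>M\<close> is
  gained.\<close>

definition J1 where "J1 = (J - canc) \<union> M"
definition Tz where "Tz = (if W = {} then {} else {t0})"
definition spec where "spec = {s \<in> B. mu s \<in> \<Union>M \<and> lam s \<noteq> \<gamma> (mu s)}"
definition S where "S = B - Tz - spec"
definition pos where "pos s = (if s \<in> canc then lam s else mu s)"
text \<open>Chosen so that the contribution of a stub is always 1 at \<open>lam s\<close> minus
  \<open>sg s\<close> at \<open>pos s\<close>: the edge itself if it is not cancelled, and zero if
  it is.\<close>

definition sg :: "nat set \<Rightarrow> int" where "sg s = (if s \<in> canc then 1 else -1)"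
definition n where "n v = card {s \<in> S. pos s = v}"
definition S3 where "S3 = {u \<in> Zc - \<Union>M. n u = 1}"
definition t where "t u = (SOME g. g \<in> J \<and> u \<in> g \<and> g \<in> UU)"
text \<open>An edge meets exactly one node over each of its ends, so it still has two nodes and the
  degree of a vertex is the sum of the degrees of its two nodes. The node \<open>(u, True)\<close>
  is met by \<open>t u\<close> alone, and only for \<open>u\<close> in \<open>S3\<close>.\<close>

definition I :: "nat set \<Rightarrow> nat \<times> bool \<Rightarrow> bool" where
  "I g x \<longleftrightarrow> fst x \<in> g \<and> snd x = (fst x \<in> S3 \<and> g = t (fst x))"
definition \<nu> where "\<nu> s = (pos s, pos s \<in> S3)"

lemma Z2Z: "Z2 \<subseteq> Z" and ZU: "Z \<subseteq> \<Union>E - X" and MZ2: "\<Union>M \<subseteq> Z2" and ZcZ: "Zc \<subseteq> Z"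
  using ME by (auto simp: Z2_def Z_def Zc_def)

lemma Z2D: "u \<in> Z2 \<Longrightarrow> dg B u = 2" "u \<in> Z2 \<Longrightarrow> u \<notin> W" "u \<in> Z2 \<Longrightarrow> g \<in> J \<Longrightarrow> u \<in> g \<Longrightarrow> g \<in> B"
  by (auto simp: Z2_def)

lemma ZJ: "u \<in> Z \<Longrightarrow> s \<in> B \<Longrightarrow> u \<in> s \<Longrightarrow> s \<in> J"
  by (auto simp: Z_def)

lemma MU: "e \<in> M \<Longrightarrow> e \<in> UU"
  using ME[of e] Z2Z ZU by (auto simp: UU_def)

lemma MJ: "M \<inter> J = {}"
proof -
  have False if "e \<in> M" "e \<in> J" for e
  proof -
    have "e \<subseteq> Z2" "e \<in> UU" "e \<noteq> {}" using ME[OF that(1)] MU[OF that(1)] card2[of e] by auto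
    then show False using Z2D(3)[OF _ that(2)] BU by blast
  qed
  then show ?thesis by blast
qed

lemma finJ: "finite J" and finM: "finite M" and finS: "finite S" and finJ1: "finite J1"
proof -
  show "finite J" using JE finE by (rule finite_subset)
  moreover show "finite M" using ME finE by (meson finite_subset subsetI)
  ultimately show "finite J1" by (simp add: J1_def)
  show "finite S" using finB by (simp add: S_def)
qed

lemma \<gamma>_edge:
  assumes "u \<in> \<Union>E - X"
  shows "{\<gamma> u, u} \<in> B" "mu {\<gamma> u, u} = u" "lam {\<gamma> u, u} = \<gamma> u"
  using \<gamma>[OF assms] assms cutI[of "\<gamma> u" u] cut_eq[of "\<gamma> u" u "{\<gamma> u, u}"] by auto

lemma eq_\<gamma>_edge: "s \<in> B \<Longrightarrow> lam s = \<gamma> (mu s) \<longleftrightarrow> s = {\<gamma> (mu s), mu s}"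
  using cut_ends(1)[of s] \<gamma>_edge[OF B_mem(3), of s] by metis

lemma cancJ: "canc \<subseteq> J" and cancB: "canc \<subseteq> B"
  using ZJ B_mem(1) ZcZ by (auto simp: canc_def)

lemma TzB: "Tz \<subseteq> B" and Tz_mem: "s \<in> Tz \<Longrightarrow> s = t0 \<and> W = {mu s} \<and> lam s \<noteq> \<gamma> (mu s)"
  using W by (auto simp: Tz_def split: if_splits)

lemma disjoint_parts: "canc \<inter> Tz = {}" "canc \<inter> spec = {}" "Tz \<inter> spec = {}"
proof -
  show "canc \<inter> Tz = {}" "canc \<inter> spec = {}" using Tz_mem by (auto simp: canc_def spec_def)
  have "False" if "s \<in> Tz" "s \<in> spec" for s
    using Tz_mem[OF that(1)] that(2) MZ2 Z2D(2)[of "mu s"] by (auto simp: spec_def)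
  then show "Tz \<inter> spec = {}" by blast
qed

lemma cancS: "canc \<subseteq> S"
  using disjoint_parts cancB by (auto simp: S_def)

lemma SB: "S \<subseteq> B" by (auto simp: S_def)

lemma J1JM: "J1 \<subseteq> J \<union> M" and J1E: "J1 \<subseteq> E"
  using JE ME by (auto simp: J1_def)

lemma dgM: "dg M v = of_bool (v \<in> \<Union>M)"
proof (cases "v \<in> \<Union>M")
  case True
  then obtain e where e: "e \<in> M" "v \<in> e" by auto
  then have "{f \<in> M. v \<in> f} = {e}" using Mdisj by blast
  then show ?thesis using True by (simp add: ideg_def)
next
  case False
  then have "{f \<in> M. v \<in> f} = {}" by auto
  then show ?thesis using False by (simp only: ideg_def) simp
qed

section \<open>Numbers of stubs and their parity at the nodes\<close>

lemma card_canc_at: "v \<in> \<Union>E - X \<Longrightarrow> card {s \<in> canc. mu s = v} = of_bool (v \<in> Zc)"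
proof -
  assume v: "v \<in> \<Union>E - X"
  have "{s \<in> canc. mu s = v} = (if v \<in> Zc then {{\<gamma> v, v}} else {})"
  proof (intro equalityI subsetI)
    fix s assume "s \<in> {s \<in> canc. mu s = v}"
    then have "s \<in> B" "mu s = v" "lam s = \<gamma> v" "v \<in> Zc" by (auto simp: canc_def)
    moreover from this have "s = {\<gamma> v, v}" using cut_ends(1)[of s] by simp
    ultimately show "s \<in> (if v \<in> Zc then {{\<gamma> v, v}} else {})" by simp
  next
    fix s assume "s \<in> (if v \<in> Zc then {{\<gamma> v, v}} else {})"
    then have "v \<in> Zc" "s = {\<gamma> v, v}" by (auto split: if_splits)
    then show "s \<in> {s \<in> canc. mu s = v}" using \<gamma>_edge[OF v] by (simp add: canc_def)
  qed
  then show ?thesis by simp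
qed

lemma card_Tz_at: "card {s \<in> Tz. mu s = v} = of_bool (v \<in> W)"
proof -
  have "{s \<in> Tz. mu s = v} = (if v \<in> W then {t0} else {})"
    using W by (auto simp: Tz_def)
  then show ?thesis by simp
qed

lemma spec_at:
  assumes "v \<in> \<Union>M"
  shows "\<exists>s. {r \<in> spec. mu r = v} = {s}"
proof -
  have v: "v \<in> Z2" "v \<in> \<Union>E - X" using assms MZ2 Z2Z ZU by blast+
  let ?A = "{s \<in> B. mu s = v}"
  have "card ?A = 2" using Z2D(1)[OF v(1)] dgB[of v] v by simp
  moreover have "{\<gamma> v, v} \<in> ?A" using \<gamma>_edge[OF v(2)] by simp
  moreover have "{r \<in> spec. mu r = v} = ?A - {{\<gamma> v, v}}"
    using assms \<gamma>_edge[OF v(2)] eq_\<gamma>_edge by (auto simp: spec_def)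
  ultimately have "card {r \<in> spec. mu r = v} = 1" by simp
  then show ?thesis by (simp add: card_1_singleton_iff)
qed

lemma card_spec_at: "card {s \<in> spec. mu s = v} = of_bool (v \<in> \<Union>M)"
proof (cases "v \<in> \<Union>M")
  case True
  then show ?thesis using spec_at[OF True] by auto
next
  case False
  then have "{s \<in> spec. mu s = v} = {}" by (auto simp: spec_def)
  then show ?thesis using False by (simp only: card.empty) simp
qed

lemma n_U:
  assumes v: "v \<in> \<Union>E - X"
  shows "n v + of_bool (v \<in> W) + of_bool (v \<in> \<Union>M) + of_bool (v \<in> Zc) = dg B v"
proof -
  let ?P = "\<lambda>A. {s \<in> A. mu s = v}"
  have fin: "finite (?P A)" if "A \<subseteq> B" for A using that finB by (auto intro: finite_subset)
  have specB: "spec \<subseteq> B" by (auto simp: spec_def)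
  have N: "{s \<in> S. pos s = v} = ?P (S - canc)"
    using v cut_ends(2) SB cancB by (auto simp: pos_def)
  have "?P B = ?P (S - canc) \<union> (?P Tz \<union> (?P spec \<union> ?P canc))"
    using cancB TzB specB by (auto simp: S_def)
  then have "dg B v = card (?P (S - canc) \<union> (?P Tz \<union> (?P spec \<union> ?P canc)))"
    using dgB[of v] v by simp
  also have "\<dots> = card (?P (S - canc)) + (card (?P Tz) + (card (?P spec) + card (?P canc)))"
  proof (subst card_Un_disjoint)
    show "finite (?P (S - canc))" "finite (?P Tz \<union> (?P spec \<union> ?P canc))"
      using fin[of "S - canc"] fin[of Tz] fin[of spec] fin[of canc] SB TzB specB cancB by auto
    show "?P (S - canc) \<inter> (?P Tz \<union> (?P spec \<union> ?P canc)) = {}" by (auto simp: S_def)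
    show "card (?P (S - canc)) + card (?P Tz \<union> (?P spec \<union> ?P canc)) =
        card (?P (S - canc)) + (card (?P Tz) + (card (?P spec) + card (?P canc)))"
      using fin[of Tz] fin[of spec] fin[of canc] TzB specB cancB disjoint_parts
      by (subst card_Un_disjoint; (subst card_Un_disjoint)?) auto
  qed
  finally show ?thesis
    using N card_canc_at[OF v] card_Tz_at[of v] card_spec_at[of v] by (simp add: n_def)
qed

lemma dg_J1: "dg J1 v + dg canc v = dg J v + dg M v"
proof -
  have "dg J1 v = dg (J - canc) v + dg M v"
    unfolding J1_def using finJ finM MJ by (intro ideg_Un_disjoint) auto
  moreover have "dg J v = dg (J - canc) v + dg canc v"
  proof -
    have "J - canc \<union> canc = J" "finite canc" using cancJ finJ by (auto intro: finite_subset)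
    then show ?thesis using ideg_Un_disjoint[of "J - canc" canc "\<lambda>e v. v \<in> e" v] finJ by auto
  qed
  ultimately show ?thesis by simp
qed

text \<open>Every change to the stubs is compensated by a change to the edges. Cancelling a stub
  moves it from one end of its edge to the other, and the edge leaves \<open>J\<close>, so both
  parities agree at both ends. A stub in \<open>spec\<close> is offset by an edge of
  \<open>M\<close>, and the unpaired one by the correction with \<open>W\<close> in
  \<open>Jodd\<close>.\<close>

lemma n_parity: "odd (n v) \<longleftrightarrow> odd (dg J1 v)"
proof -
  consider "v \<in> \<Union>E - X" | "v \<in> X" | "v \<notin> \<Union>E" by blast
  then show ?thesis
  proof cases
    case 1
    have c: "dg canc v = of_bool (v \<in> Zc)"
    proof -
      have "{s \<in> canc. v \<in> s} = {s \<in> canc. mu s = v}" using 1 cancB cut_mem(2) B_mem(1) by auto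
      then show ?thesis using card_canc_at[OF 1] by (simp add: ideg_def)
    qed
    have j: "even (dg J v) \<longleftrightarrow> even (dg B v + of_bool (v \<in> W))" using Jodd[of v] 1 by blast
    have "even (n v + of_bool (v \<in> W) + of_bool (v \<in> \<Union>M) + of_bool (v \<in> Zc)) = even (dg B v)"
      by (simp only: n_U[OF 1])
    moreover have "even (dg J1 v + of_bool (v \<in> Zc)) = even (dg J v + of_bool (v \<in> \<Union>M))"
      using dg_J1[of v] by (simp only: c dgM)
    ultimately show ?thesis using j unfolding even_add by blast
  next
    case 2
    have "{s \<in> S. pos s = v} = {s \<in> canc. v \<in> s}"
    proof (intro equalityI subsetI)
      fix s assume s: "s \<in> {s \<in> S. pos s = v}"
      then have "s \<in> canc" using 2 SB cut_ends(3)[of s] by (auto simp: pos_def split: if_splits)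
      then show "s \<in> {s \<in> canc. v \<in> s}" using s cancB B_mem(2) by (auto simp: pos_def)
    next
      fix s assume s: "s \<in> {s \<in> canc. v \<in> s}"
      then show "s \<in> {s \<in> S. pos s = v}" using 2 cancB cancS cut_mem(1)[of s v] by (auto simp: pos_def)
    qed
    then have "n v = dg canc v" by (simp add: n_def ideg_def)
    moreover have "dg M v = 0" using 2 dgM[of v] MZ2 Z2Z ZU by auto
    moreover have "even (dg J v)" using Jodd[of v] 2 by simp
    moreover have "even (dg J1 v + dg canc v) = even (dg J v + dg M v)" by (simp only: dg_J1)
    ultimately show ?thesis by simp
  next
    case 3
    have "pos s \<in> \<Union>E" if "s \<in> S" for s
      using B_mem(3,4)[of s] that SB unfolding pos_def by (cases "s \<in> canc") auto
    then have "{s \<in> S. pos s = v} = {}" using 3 by blast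
    then have "n v = 0" unfolding n_def by (simp only: card.empty)
    moreover have "{e \<in> J1. v \<in> e} = {}" using 3 J1E by auto
    then have "dg J1 v = 0" unfolding ideg_def by (simp only: card.empty)
    ultimately show ?thesis by simp
  qed
qed

text \<open>Otherwise the edges of \<open>J\<close> at \<open>u\<close> are exactly its cut edges,
  two of them, or three if \<open>u\<close> is in \<open>W\<close>. Two would put \<open>u\<close>
  into \<open>Z2\<close>, which is disjoint from \<open>S3\<close>; three has the wrong parity for
  \<open>Jodd\<close>.\<close>

lemma S3_t: "u \<in> S3 \<Longrightarrow> t u \<in> J \<and> u \<in> t u \<and> t u \<in> UU"
proof -
  assume u: "u \<in> S3"
  have uZ: "u \<in> Z" "u \<in> Zc" "u \<notin> \<Union>M" "n u = 1" "u \<notin> Z2" "u \<in> \<Union>E - X"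
    using u ZcZ ZU by (auto simp: S3_def Zc_def Y0_def)
  have "\<exists>g. g \<in> J \<and> u \<in> g \<and> g \<in> UU"
  proof (rule ccontr)
    assume neg: "\<not> ?thesis"
    have JB: "g \<in> B" if "g \<in> J" "u \<in> g" for g using neg that JE EBU by blast
    then have "{g \<in> J. u \<in> g} = {g \<in> B. u \<in> g}" using ZJ[OF uZ(1)] by auto
    then have eq: "dg J u = dg B u" by (simp add: ideg_def)
    have k: "dg B u = 2 + of_bool (u \<in> W)" using n_U[OF uZ(6)] uZ by simp
    have "u \<in> W" using uZ(1,5) JB k by (auto simp: Z2_def)
    then show False using Jodd[of u] eq k uZ(6) by simp
  qed
  then show ?thesis unfolding t_def by (rule someI_ex)
qed

lemma t_J1: "u \<in> S3 \<Longrightarrow> t u \<in> J1"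
  using S3_t[of u] cancB BU by (auto simp: J1_def)

lemma dg_nodes: "finite P \<Longrightarrow> dg P v = ideg I P (v, False) + ideg I P (v, True)"
proof -
  assume "finite P"
  have "{e \<in> P. v \<in> e} = {e \<in> P. I e (v, False)} \<union> {e \<in> P. I e (v, True)}" by (auto simp: I_def)
  then show ?thesis unfolding ideg_def using \<open>finite P\<close>
    by (simp only:) (intro card_Un_disjoint; auto simp: I_def)
qed

text \<open>At a vertex of \<open>S3\<close> the tagged node carries its single stub and the single
  edge \<open>t v\<close>; the degree left for the untagged node is even.\<close>

lemma node_parity: "odd (card {s \<in> S. \<nu> s = x}) \<longleftrightarrow> odd (ideg I J1 x)"
proof -
  obtain v b where x: "x = (v, b)" by force
  have card: "card {s \<in> S. \<nu> s = x} = (if b = (v \<in> S3) then n v else 0)"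
  proof (cases "b = (v \<in> S3)")
    case True
    then have "{s \<in> S. \<nu> s = x} = {s \<in> S. pos s = v}" by (auto simp: x \<nu>_def)
    then show ?thesis using True by (simp add: n_def)
  next
    case False
    then have "{s \<in> S. \<nu> s = x} = {}" by (auto simp: x \<nu>_def)
    then show ?thesis using False by (simp only: card.empty) simp
  qed
  note sum = dg_nodes[OF finJ1, of v]
  show ?thesis
  proof (cases "v \<in> S3")
    case True
    have "{e \<in> J1. I e (v, True)} = {t v}" using True t_J1[OF True] S3_t[OF True] by (auto simp: I_def)
    then have T: "ideg I J1 (v, True) = 1" by (simp add: ideg_def)
    moreover have "n v = 1" using True by (simp add: S3_def)
    moreover have "odd (dg J1 v)" using n_parity[of v] calculation by simp
    ultimately have "even (ideg I J1 (v, False))" using sum by simp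
    then show ?thesis unfolding card using T \<open>n v = 1\<close> True by (cases b) (auto simp: x)
  next
    case False
    have "{e \<in> J1. I e (v, True)} = {}" using False by (auto simp: I_def)
    then have T: "ideg I J1 (v, True) = 0" by (simp only: ideg_def card.empty)
    then show ?thesis unfolding card using sum n_parity[of v] False by (cases b) (auto simp: x)
  qed
qed

lemma two_nodes: "e \<in> J1 \<Longrightarrow> \<exists>x y. x \<noteq> y \<and> (\<forall>z. I e z \<longleftrightarrow> z = x \<or> z = y)"
proof -
  assume "e \<in> J1"
  then have e: "e = {Min e, Max e}" "Min e \<noteq> Max e" using edge_ends J1E by auto
  let ?nd = "\<lambda>v. (v, v \<in> S3 \<and> e = t v)"
  have "I e z \<longleftrightarrow> z = ?nd (Min e) \<or> z = ?nd (Max e)" for z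
  proof -
    have "fst z \<in> e \<longleftrightarrow> fst z = Min e \<or> fst z = Max e" using e(1) by blast
    then show ?thesis unfolding I_def prod_eq_iff fst_conv snd_conv by metis
  qed
  then show ?thesis using e(2) by (intro exI[of _ "?nd (Min e)"] exI[of _ "?nd (Max e)"]) auto
qed

text \<open>Stubs at an outer vertex are different cut edges there. Cancelled stubs at the same
  \<open>x\<close> in \<open>X\<close> come from vertices of \<open>Z\<close> with \<gamma>-value
  \<open>x\<close>; this is where injectivity from the marriage theorem enters.\<close>

lemma labels_distinct:
  assumes "s \<in> S" "s' \<in> S" "s \<noteq> s'" "\<nu> s = \<nu> s'"
  shows "lam s \<noteq> lam s'"
proof
  assume eq: "lam s = lam s'"
  have B: "s \<in> B" "s' \<in> B" using assms SB by auto
  have p: "pos s = pos s'" using assms(4) by (simp add: \<nu>_def)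
  note X = cut_ends(2,3)[OF B(1)] cut_ends(2,3)[OF B(2)]
  have "mu s = mu s'"
  proof (cases "s \<in> canc")
    case True
    then have "s' \<in> canc" using p X by (auto simp: pos_def split: if_splits)
    then show ?thesis using True eq \<gamma>inj ZcZ by (auto simp: canc_def dest: inj_onD)
  next
    case False
    then have "s' \<notin> canc" using p X by (auto simp: pos_def split: if_splits)
    then show ?thesis using False p by (simp add: pos_def)
  qed
  then show False using B_eqI[OF B] eq assms(3) by blast
qed

text \<open>An edge of \<open>M\<close> in an even set drags along a cut edge of \<open>J\<close> at each of its two ends.\<close>

lemma matching_count:
  assumes A: "A \<subseteq> J \<union> M" and ev: "\<And>y. y \<in> \<Union>M \<Longrightarrow> even (dg A y)"
    and R: "R \<subseteq> A \<inter> J" "\<And>e. e \<in> R \<Longrightarrow> \<exists>u\<in>e. u \<notin> X \<and> u \<notin> \<Union>M"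
  shows "2 * card (A \<inter> M) + card R \<le> card (A \<inter> J)"
proof -
  let ?G = "{g \<in> A \<inter> J. g \<in> B \<and> mu g \<in> \<Union>M}"
  have finA: "finite A" using A finJ finM by (meson finite_UnI finite_subset)
  have "card (\<Union>(A \<inter> M)) = (\<Sum>e\<in>A \<inter> M. card e)"
  proof (rule card_Union_disjoint)
    show "disjoint (A \<inter> M)" using Mdisj by (auto simp: disjoint_def)
    show "finite e" if "e \<in> A \<inter> M" for e using that ME card2 by (metis Int_iff card.infinite zero_neq_numeral)
  qed
  also have "\<dots> = (\<Sum>e\<in>A \<inter> M. 2)" using ME card2 by (intro sum.cong) auto
  finally have "2 * card (A \<inter> M) = card (\<Union>(A \<inter> M))" by simp
  also have "card (\<Union>(A \<inter> M)) \<le> card (mu ` ?G)"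
  proof (rule card_mono, use finA in simp, rule subsetI)
    \<comment> \<open>Evenness gives a second edge of \<open>A\<close> at \<open>y\<close>. It is
      not in \<open>M\<close>, as \<open>M\<close> is a matching, so it lies in \<open>J\<close>
      and, by definition of \<open>Z2\<close>, is a cut edge. Its outer end recovers
      \<open>y\<close>, so different \<open>y\<close> yield different edges.\<close>
    fix y assume "y \<in> \<Union>(A \<inter> M)"
    then obtain e where e: "e \<in> A" "e \<in> M" "y \<in> e" by auto
    have y: "y \<in> \<Union>M" "y \<in> Z2" "y \<notin> X" using e MZ2 Z2Z ZU by auto
    have "\<exists>g\<in>A - {e}. y \<in> g"
    proof -
      have "dg A y = dg (A - {e}) y + 1"
        using ideg_insert[of "A - {e}" e "\<lambda>e v. v \<in> e" y] finA e by (simp add: insert_absorb)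
      then have "dg (A - {e}) y \<noteq> 0" using ev[OF y(1)] by (metis add_0 odd_one)
      then show ?thesis by (rule ideg_pos)
    qed
    then obtain g where g: "g \<in> A" "g \<noteq> e" "y \<in> g" by auto
    have "g \<notin> M" using Mdisj[OF _ e(2) g(2)] g(3) e(3) by auto
    then have gJ: "g \<in> J" using g A by auto
    then have gB: "g \<in> B" using Z2D(3)[OF y(2) gJ g(3)] by simp
    then have "mu g = y" using cut_mem(2)[OF gB g(3) y(3)] by simp
    then show "y \<in> mu ` ?G" using g gJ gB y(1) by auto
  qed
  also have "\<dots> \<le> card ?G" using finA by (intro card_image_le) simp
  finally have "2 * card (A \<inter> M) \<le> card ?G" .
  moreover have "card ?G + card R \<le> card (A \<inter> J)"
  proof -
    have "?G \<inter> R = {}" using R(2) cut_mem(2) by fastforce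
    then have "card ?G + card R = card (?G \<union> R)"
      using finA R(1) by (subst card_Un_disjoint) (auto intro: finite_subset)
    also have "\<dots> \<le> card (A \<inter> J)" using finA R(1) by (intro card_mono) auto
    finally show ?thesis .
  qed
  ultimately show ?thesis by linarith
qed

lemma diff_J_eq: "A \<subseteq> J \<union> M \<Longrightarrow> A - J = A \<inter> M"
  using MJ by auto

text \<open>With \<open>m\<close> edges of \<open>M\<close> there are at least \<open>2 m\<close>
  edges of \<open>J\<close>, but minimality allows at most \<open>m\<close>; so \<open>m = 0\<close>
  and nothing is left.\<close>

lemma no_even_subset:
  assumes C: "C \<subseteq> J \<union> M" and ev: "\<And>v. even (dg C v)"
  shows "C = {}"
proof -
  have finC: "finite C" using C finJ finM by (meson finite_UnI finite_subset)
  have CE: "C \<subseteq> E" using C JE ME by auto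
  have "2 * card (C \<inter> M) \<le> card (C \<inter> J)" using matching_count[OF C ev, of "{}"] by simp
  moreover have "card (C \<inter> J) \<le> card (C \<inter> M)" using Jmin[OF CE ev] diff_J_eq[OF C] by simp
  ultimately have "card (C \<inter> M) = 0" "card (C \<inter> J) = 0" by auto
  then show ?thesis using finC C by auto
qed

text \<open>The cut edge \<open>{x, u}\<close> closes \<open>A\<close> to an even set. The edge of
  \<open>A\<close> at \<open>u\<close> is in \<open>J\<close> and is not charged to any edge of
  \<open>M\<close>, so with \<open>m\<close> edges of \<open>M\<close> the number of edges of
  \<open>J\<close> is at least \<open>2 m + 1\<close>, and by minimality at most
  \<open>m + 1\<close>. Hence \<open>A\<close> is a single edge with ends \<open>u\<close> and
  \<open>x\<close>, which would be the excluded one.\<close>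

lemma no_near_cut_trail:
  assumes A: "A \<subseteq> J \<union> M" and u: "u \<in> \<Union>E - X" "u \<notin> Z2" and x: "x \<in> X" and s: "{x, u} \<in> E" "{x, u} \<notin> J"
    and bd: "\<And>y. odd (dg A y) \<longleftrightarrow> y = u \<or> y = x"
  shows False
proof -
  let ?s = "{x, u}"
  have finA: "finite A" using A finJ finM by (meson finite_UnI finite_subset)
  have uM: "u \<notin> \<Union>M" using u(2) MZ2 by auto
  have xM: "x \<notin> \<Union>M" using x MZ2 Z2Z ZU by auto
  have sA: "?s \<notin> A" using s A uM by auto
  have ne: "x \<noteq> u" using x u by auto
  have "dg A u \<noteq> 0" using bd[of u] by (metis even_zero)
  then obtain e where e: "e \<in> A" "u \<in> e" using ideg_pos by fastforce
  then have eJ: "e \<in> J" using A uM by auto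
  have "2 * card (A \<inter> M) + card {e} \<le> card (A \<inter> J)"
  proof (rule matching_count[OF A])
    show "even (dg A y)" if "y \<in> \<Union>M" for y using bd[of y] that uM xM by auto
  qed (use e eJ u uM in auto)
  then have big: "2 * card (A \<inter> M) + 1 \<le> card (A \<inter> J)" by simp
  let ?C = "insert ?s A"
  have "even (dg ?C v)" for v
    using ideg_insert[OF finA sA, of "\<lambda>e v. v \<in> e" v] bd[of v] ne by auto
  moreover have "?C \<subseteq> E" using A s JE ME by auto
  ultimately have "card (?C \<inter> J) \<le> card (?C - J)" using Jmin by blast
  moreover have "?C \<inter> J = A \<inter> J" using s by auto
  moreover have "?C - J = insert ?s (A \<inter> M)" using s diff_J_eq[OF A] by auto
  ultimately have "card (A \<inter> J) \<le> card (insert ?s (A \<inter> M))" by simp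
  also have "\<dots> \<le> Suc (card (A \<inter> M))" using finA by (simp add: card_insert_if)
  finally have le: "card (A \<inter> J) \<le> Suc (card (A \<inter> M))" .
  have "card (A \<inter> M) = 0" using big le by linarith
  moreover from this have "card (A \<inter> J) = 1" using big le by linarith
  ultimately have "card (A \<inter> M) = 0" "card (A \<inter> J) = 1" .
  then have "A \<inter> M = {}" "card (A \<inter> J) = 1" using finA by auto
  moreover from this have "A = A \<inter> J" using A by auto
  ultimately obtain f where f: "A = {f}" by (metis card_1_singletonE)
  have "v \<in> f \<longleftrightarrow> v = u \<or> v = x" for v using bd[of v] unfolding f by (simp add: ideg_singleton)
  then have "f = ?s" by blast
  then show False using f sA by simp
qed

text \<open>If \<open>v = mu s\<close> is outside \<open>Z\<close>, then
  \<open>{\<gamma> v, v}\<close> is a stub at \<open>v\<close>, so it is \<open>s\<close> and lies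
  outside \<open>J\<close>. If \<open>v\<close> is in \<open>Z\<close>, then \<open>n_U\<close>
  excludes \<open>Z2\<close>, whose matched vertices keep no stub and whose unmatched ones keep
  two.\<close>

lemma single_stub:
  assumes s: "s \<in> S" "s \<notin> canc" and single: "\<And>r. r \<in> S \<Longrightarrow> \<nu> r = \<nu> s \<Longrightarrow> r = s"
  shows "mu s \<in> S3 \<and> s \<in> J \<or> mu s \<notin> Z \<and> s \<notin> J \<and> dg B (mu s) = 1 + of_bool (mu s \<in> W)"
proof -
  let ?v = "mu s"
  have sB: "s \<in> B" using s SB by auto
  have v: "?v \<in> \<Union>E - X" "pos s = ?v" using B_mem(3)[OF sB] s by (auto simp: pos_def)
  have "r = s" if "r \<in> S" "pos r = ?v" for r using single[of r] that v(2) by (simp add: \<nu>_def)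
  then have "{r \<in> S. pos r = ?v} = {s}" using s v by auto
  then have n1: "n ?v = 1" by (simp add: n_def)
  note k = n_U[OF v(1), unfolded n1]
  show ?thesis
  proof (cases "?v \<in> Z")
    case True
    have sJ: "s \<in> J" using ZJ[OF True sB B_mem(1)[OF sB]] .
    have "?v \<notin> \<Union>M"
    proof
      assume m: "?v \<in> \<Union>M"
      then have "?v \<in> Zc" "?v \<in> Z2" using MZ2 True by (auto simp: Zc_def Y0_def)
      then show False using k m Z2D(1,2)[of ?v] by simp
    qed
    moreover have "?v \<notin> Y0"
    proof
      assume m: "?v \<in> Y0"
      then have "?v \<notin> Zc" "?v \<in> Z2" by (auto simp: Zc_def Y0_def)
      then show False using k calculation Z2D(1,2)[of ?v] by simp
    qed
    ultimately show ?thesis using True sJ n1 by (auto simp: S3_def Zc_def)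
  next
    case False
    then have nz: "?v \<notin> Zc" "?v \<notin> \<Union>M" using ZcZ MZ2 Z2Z by auto
    let ?g = "{\<gamma> ?v, ?v}"
    have "?g \<notin> canc" "?g \<notin> spec" "?g \<notin> Tz"
      using nz \<gamma>_edge[OF v(1)] Tz_mem[of ?g] by (auto simp: canc_def spec_def)
    then have "?g \<in> S" "pos ?g = ?v" using \<gamma>_edge[OF v(1)] by (auto simp: S_def pos_def)
    then have "?g = s" using single[of ?g] v(2) by (simp add: \<nu>_def)
    then have "s \<notin> J" using \<gamma>J[OF v(1) False] by simp
    then show ?thesis using False k nz by simp
  qed
qed

lemma S3_trail:
  assumes P: "P \<subseteq> J1" and u: "u \<in> S3" and odd: "odd (ideg I P (u, True))"
  shows "t u \<in> P"
proof -
  have "ideg I P (u, True) \<noteq> 0" using odd by (metis even_zero)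
  then obtain e where "e \<in> P" "I e (u, True)" using ideg_pos by fastforce
  then show ?thesis by (simp add: I_def)
qed

lemma W_single: "u \<in> W \<Longrightarrow> v \<in> W \<Longrightarrow> u = v"
  using W by auto

text \<open>The symmetric difference with \<open>s'\<close> turns the trail into an even set. If
  \<open>s'\<close> is in \<open>J\<close>, this set is empty by minimality; yet it contains
  \<open>t (mu s')\<close>, which the tagged node forces into the trail and which is no cut edge. If
  \<open>s'\<close> is not in \<open>J\<close>, \<open>no_near_cut_trail\<close> applies.\<close>

lemma no_cancel_one_X:
  assumes s: "s \<in> canc" and s': "s' \<in> S" "s' \<notin> canc" "lam s = lam s'"
    and single: "\<And>r. r \<in> S \<Longrightarrow> \<nu> r = \<nu> s' \<Longrightarrow> r = s'"
    and P: "P \<subseteq> J1" and bdI: "\<And>x. odd (ideg I P x) \<longleftrightarrow> x = \<nu> s \<or> x = \<nu> s'"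
    and bd: "\<And>y. odd (dg P y) \<longleftrightarrow> y = pos s \<or> y = pos s'"
  shows False
proof -
  have s'B: "s' \<in> B" using s' SB by auto
  let ?v = "mu s'"
  have finP: "finite P" using P finJ1 by (rule finite_subset)
  have PJM: "P \<subseteq> J \<union> M" using P J1JM by auto
  have pos: "pos s = lam s'" "pos s' = ?v" using s s' by (auto simp: pos_def)
  note ends = cut_ends[OF s'B]
  have ne: "lam s' \<noteq> ?v" using ends by auto
  consider "?v \<in> S3" "s' \<in> J" | "?v \<notin> Z" "s' \<notin> J" using single_stub[OF s'(1,2) single] by auto
  then show False
  proof cases
    case 1
    have "odd (ideg I P (?v, True))" using bdI[of "(?v, True)"] 1 pos by (simp add: \<nu>_def)
    then have tP: "t ?v \<in> P" using S3_trail[OF P 1(1)] by simp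
    let ?C = "sym_diff P {s'}"
    have "even (dg ?C y)" for y
      using odd_ideg_sym_diff[OF finP, of "{s'}" "\<lambda>e v. v \<in> e" y] bd[of y] pos ne B_in[OF s'B, of y]
      by (auto simp: ideg_singleton)
    then have "?C = {}" using PJM 1(2) by (intro no_even_subset) auto
    moreover have "t ?v \<in> ?C" using tP S3_t[OF 1(1)] s'B BU by auto
    ultimately show False by blast
  next
    case 2
    show False
    proof (rule no_near_cut_trail[OF PJM])
      show "?v \<in> \<Union>E - X" using B_mem(3)[OF s'B] .
      show "?v \<notin> Z2" using 2 Z2Z by auto
      show "lam s' \<in> X" "{lam s', ?v} \<in> E" "{lam s', ?v} \<notin> J" using ends s'B BE 2 by auto
      show "odd (dg P y) \<longleftrightarrow> y = ?v \<or> y = lam s'" for y using bd[of y] pos by auto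
    qed
  qed
qed

text \<open>The symmetric difference with \<open>s\<close> moves one end of the trail from
  \<open>mu s\<close> to the common label in \<open>X\<close>. What remains is the situation of
  \<open>no_cancel_one_X\<close>, with the contradiction now provided by \<open>t (mu s)\<close> if
  \<open>s'\<close> is in \<open>J\<close>.\<close>

lemma no_cancel_one_S3:
  assumes s: "s \<in> S" "s \<notin> canc" "mu s \<in> S3" "s \<in> J" and s': "s' \<in> S" "s' \<notin> canc" "lam s = lam s'" "mu s \<noteq> mu s'"
    and single': "\<And>r. r \<in> S \<Longrightarrow> \<nu> r = \<nu> s' \<Longrightarrow> r = s'"
    and P: "P \<subseteq> J1" and bdI: "\<And>x. odd (ideg I P x) \<longleftrightarrow> x = \<nu> s \<or> x = \<nu> s'"
    and bd: "\<And>y. odd (dg P y) \<longleftrightarrow> y = pos s \<or> y = pos s'"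
  shows False
proof -
  have B: "s \<in> B" "s' \<in> B" using s s' SB by auto
  let ?v = "mu s" and ?v' = "mu s'"
  have finP: "finite P" using P finJ1 by (rule finite_subset)
  have PJM: "P \<subseteq> J \<union> M" using P J1JM by auto
  have pos: "pos s = ?v" "pos s' = ?v'" using s s' by (auto simp: pos_def)
  note ends = cut_ends[OF B(1)] cut_ends[OF B(2)]
  have ne: "lam s' \<noteq> ?v" "lam s' \<noteq> ?v'" using ends by auto
  let ?A = "sym_diff P {s}"
  have finA: "finite ?A" using finP by simp
  have bdA: "odd (dg ?A y) \<longleftrightarrow> y = ?v' \<or> y = lam s'" for y
    using odd_ideg_sym_diff[OF finP, of "{s}" "\<lambda>e v. v \<in> e" y] bd[of y] pos ne B_in[OF B(1), of y] s'(3,4)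
    by (auto simp: ideg_singleton)
  have AJM: "?A \<subseteq> J \<union> M" using PJM s(4) by auto
  consider "s' \<in> J" | "?v' \<notin> Z" "s' \<notin> J" using single_stub[OF s'(1,2) single'] by auto
  then show False
  proof cases
    case 1
    have "odd (ideg I P (?v, True))" using bdI[of "(?v, True)"] s(3) pos by (simp add: \<nu>_def)
    then have tP: "t ?v \<in> P" using S3_trail[OF P s(3)] by simp
    let ?C = "sym_diff ?A {s'}"
    have "even (dg ?C y)" for y
      using odd_ideg_sym_diff[OF finA, of "{s'}" "\<lambda>e v. v \<in> e" y] bdA[of y] B_in[OF B(2), of y]
      by (auto simp: ideg_singleton)
    then have "?C = {}" using AJM 1 by (intro no_even_subset) auto
    moreover have "t ?v \<in> ?C" using tP S3_t[OF s(3)] B BU by auto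
    ultimately show False by blast
  next
    case 2
    show False
    proof (rule no_near_cut_trail[OF AJM])
      show "?v' \<in> \<Union>E - X" using B_mem(3)[OF B(2)] .
      show "?v' \<notin> Z2" using 2 Z2Z by auto
      show "lam s' \<in> X" "{lam s', ?v'} \<in> E" "{lam s', ?v'} \<notin> J" using ends B BE 2 by auto
      show "odd (dg ?A y) \<longleftrightarrow> y = ?v' \<or> y = lam s'" for y by (rule bdA)
    qed
  qed
qed

text \<open>Together with \<open>s\<close> and \<open>s'\<close> the trail becomes an even set with
  two cut edges outside \<open>J\<close>. Counting leaves equality in \<open>Jmin\<close> as the
  only possibility, and the tie-break then makes all edges of \<open>J\<close> in it cut edges. But
  the only cut edge at \<open>mu s'\<close> is \<open>s'\<close>, which is not in
  \<open>J\<close>.\<close>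

lemma no_cancel_NN:
  assumes B: "s \<in> B" "s' \<in> B" and nJ: "s \<notin> J" "s' \<notin> J" and nZ: "mu s \<notin> Z" "mu s' \<notin> Z"
    and lab: "lam s = lam s'" and ne: "mu s \<noteq> mu s'" and k: "dg B (mu s') = 1"
    and P: "P \<subseteq> J1" and bd: "\<And>y. odd (dg P y) \<longleftrightarrow> y = mu s \<or> y = mu s'" and ev: "even (card P)"
  shows False
proof -
  let ?v = "mu s" and ?v' = "mu s'"
  have finP: "finite P" using P finJ1 by (rule finite_subset)
  have PJM: "P \<subseteq> J \<union> M" using P J1JM by auto
  note ends = cut_ends[OF B(1)] cut_ends[OF B(2)]
  have nM: "?v \<notin> \<Union>M" "?v' \<notin> \<Union>M" using nZ MZ2 Z2Z by auto
  have nP: "s \<notin> P" "s' \<notin> P" using PJM nJ B MU BU by blast+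
  have d: "dg P ?v \<noteq> 0" "dg P ?v' \<noteq> 0" using bd by (metis even_zero)+
  have "\<exists>e\<in>P. ?v \<in> e" using d(1) by (rule ideg_pos)
  moreover have "\<exists>e\<in>P. ?v' \<in> e" using d(2) by (rule ideg_pos)
  ultimately obtain e e' where e: "e \<in> P" "?v \<in> e" "e' \<in> P" "?v' \<in> e'" by blast
  then have eJ: "e \<in> J" "e' \<in> J" using PJM nM by auto
  \<comment> \<open>An edge joining both ends would be the whole trail, whose length would be
    odd.\<close>
  have "e \<noteq> e'"
  proof
    assume eq: "e = e'"
    have "e = {?v, ?v'}"
    proof -
      have c: "card e = 2" using card2 eJ(1) JE by blast
      moreover have "finite e" using c by (intro card_ge_0_finite) simp
      ultimately have "{?v, ?v'} = e" using e eq ne by (intro card_subset_eq) auto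
      then show ?thesis by simp
    qed
    then have "even (dg (sym_diff P {e}) y)" for y
      using odd_ideg_sym_diff[OF finP, of "{e}" "\<lambda>e v. v \<in> e" y] bd[of y] by (auto simp: ideg_singleton)
    then have "sym_diff P {e} = {}" using PJM eJ by (intro no_even_subset) auto
    then have "P = {e}" by auto
    then show False using ev by simp
  qed
  have big: "2 * card (P \<inter> M) + card {e, e'} \<le> card (P \<inter> J)"
  proof (rule matching_count[OF PJM])
    show "even (dg P y)" if "y \<in> \<Union>M" for y using bd[of y] that nM by auto
    show "\<exists>u\<in>f. u \<notin> X \<and> u \<notin> \<Union>M" if "f \<in> {e, e'}" for f using that e ends(3,6) nM by auto
  qed (use e eJ in auto)
  let ?C = "insert s (insert s' P)"
  have ss: "s \<noteq> s'" using ne by auto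
  have evC: "even (dg ?C y)" for y
  proof -
    have "dg (insert s' P) y = dg P y + of_bool (y \<in> s')"
      using ideg_insert[OF finP nP(2)] .
    moreover have "dg ?C y = dg (insert s' P) y + of_bool (y \<in> s)"
      using finP nP ss by (intro ideg_insert) auto
    ultimately have "even (dg ?C y) \<longleftrightarrow> (even (dg P y) \<longleftrightarrow> (y \<in> s \<longleftrightarrow> y \<in> s'))" by simp
    moreover have "lam s' \<noteq> ?v" "lam s' \<noteq> ?v'" using ends(3,5,6) by auto
    then have "(y = lam s' \<or> y = ?v \<longleftrightarrow> y = lam s' \<or> y = ?v') \<longleftrightarrow> \<not> (y = ?v \<or> y = ?v')" using ne by metis
    then have "even (dg P y) \<longleftrightarrow> (y \<in> s \<longleftrightarrow> y \<in> s')"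
      unfolding B_in[OF B(1), of y] B_in[OF B(2), of y] lab using bd[of y] by blast
    ultimately show ?thesis by blast
  qed
  have CE: "?C \<subseteq> E" using B BE P J1E by auto
  have CJ: "?C \<inter> J = P \<inter> J" using nJ by auto
  have CD: "?C - J = insert s (insert s' (P \<inter> M))" using nJ diff_J_eq[OF PJM] by auto
  have "card (?C - J) = card (P \<inter> M) + 2"
    unfolding CD using finP nP ss by simp
  then have min: "card (P \<inter> J) \<le> card (P \<inter> M) + 2"
      "card (P \<inter> J) = card (P \<inter> M) + 2 \<Longrightarrow> card (?C \<inter> J \<inter> UU) \<le> card ((?C - J) \<inter> UU)"
    using Jmin[OF CE evC] CJ by auto
  \<comment> \<open>With \<open>m = card (P \<inter> M)\<close> the two bounds read
    \<open>2 m + 2 \<le> m + 2\<close>, so \<open>m = 0\<close> and equality holds.\<close>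
  then have M0: "card (P \<inter> M) = 0" "card (P \<inter> J) = 2" using big \<open>e \<noteq> e'\<close> by auto
  then have "P \<inter> M = {}" using finP by auto
  then have "(?C - J) \<inter> UU = {}" using CD B BU by auto
  then have "card (?C \<inter> J \<inter> UU) = 0" using min(2) M0 by simp
  then have noU: "P \<inter> J \<inter> UU = {}" using CJ finP by simp
  have "e' \<in> B" using noU e eJ JE EBU by auto
  have "{g \<in> B. mu g = ?v'} = {s'}"
  proof -
    have "card {g \<in> B. mu g = ?v'} = 1" using k dgB[of ?v'] ends(6) by simp
    then show ?thesis using B(2) by (metis (mono_tags, lifting) card_1_singletonE mem_Collect_eq singletonD)
  qed
  moreover have "mu e' = ?v'" using cut_mem(2)[OF \<open>e' \<in> B\<close> e(4)] ends(6) by simp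
  ultimately have "e' = s'" using \<open>e' \<in> B\<close> by auto
  then show False using eJ nJ by simp
qed

text \<open>Most cases are impossible outright. The length of the trail matters only when both stubs
  sit at vertices outside \<open>Z\<close>: both signs are then -1, so a wrong sign means even
  length. At most one of the two vertices is in \<open>W\<close>, so the other has a single cut
  edge.\<close>

lemma no_cancel:
  assumes s: "s \<in> S" "s' \<in> S" "\<nu> s \<noteq> \<nu> s'"
    and single: "\<And>r. r \<in> S \<Longrightarrow> \<nu> r = \<nu> s \<Longrightarrow> r = s" "\<And>r. r \<in> S \<Longrightarrow> \<nu> r = \<nu> s' \<Longrightarrow> r = s'"
    and lab: "lam s = lam s'" and P: "P \<subseteq> J1" and bdI: "\<And>x. odd (ideg I P x) \<longleftrightarrow> x = \<nu> s \<or> x = \<nu> s'"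
  shows "sg s * sg s' * (-1) ^ card P = -1"
proof (rule ccontr)
  assume bad: "\<not> ?thesis"
  have finP: "finite P" using P finJ1 by (rule finite_subset)
  have B: "s \<in> B" "s' \<in> B" using s SB by auto
  have ne: "pos s \<noteq> pos s'" using s(3) by (auto simp: \<nu>_def)
  have bd: "odd (dg P y) \<longleftrightarrow> y = pos s \<or> y = pos s'" for y
    unfolding dg_nodes[OF finP] using bdI[of "(y, False)"] bdI[of "(y, True)"] ne by (auto simp: \<nu>_def)
  have bdI': "odd (ideg I P x) \<longleftrightarrow> x = \<nu> s' \<or> x = \<nu> s" for x using bdI by blast
  have bd': "odd (dg P y) \<longleftrightarrow> y = pos s' \<or> y = pos s" for y using bd by blast
  consider "s \<in> canc" "s' \<in> canc" | "s \<in> canc" "s' \<notin> canc" | "s \<notin> canc" "s' \<in> canc" | "s \<notin> canc" "s' \<notin> canc" by blast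
  then show False
  proof cases
    case 1
    then show False using ne lab by (simp add: pos_def)
  next
    case 2
    then show False using no_cancel_one_X[OF 2(1) s(2) 2(2) lab single(2) P bdI bd] by simp
  next
    case 3
    then show False using no_cancel_one_X[OF 3(2) s(1) 3(1) lab[symmetric] single(1) P bdI' bd'] by simp
  next
    case 4
    have mu: "mu s \<noteq> mu s'" "pos s = mu s" "pos s' = mu s'" using ne 4 by (auto simp: pos_def)
    note t = single_stub[OF s(1) 4(1) single(1)] single_stub[OF s(2) 4(2) single(2)]
    consider "mu s \<in> S3" "s \<in> J" | "mu s' \<in> S3" "s' \<in> J" |
      "mu s \<notin> Z" "s \<notin> J" "mu s' \<notin> Z" "s' \<notin> J" "dg B (mu s) = 1 + of_bool (mu s \<in> W)" "dg B (mu s') = 1 + of_bool (mu s' \<in> W)"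
      using t by blast
    then show False
    proof cases
      case 1
      then show False using no_cancel_one_S3[OF s(1) 4(1) 1 s(2) 4(2) lab mu(1) single(2) P bdI bd] by simp
    next
      case 2
      then show False
        using no_cancel_one_S3[OF s(2) 4(2) 2 s(1) 4(1) lab[symmetric] mu(1)[symmetric] single(1) P bdI' bd'] by simp
    next
      case 3
      have ev: "even (card P)" using bad 4 by (cases "even (card P)") (auto simp: sg_def)
      have "mu s \<notin> W \<or> mu s' \<notin> W" using W_single mu(1) by blast
      then show False
      proof
        assume "mu s' \<notin> W"
        then have "dg B (mu s') = 1" using 3(6) by simp
        then show False
          using no_cancel_NN[OF B 3(2,4,1,3) lab mu(1) _ P _ ev] bd mu by simp
      next
        assume "mu s \<notin> W"
        then have "dg B (mu s) = 1" using 3(5) by simp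
        then show False
          using no_cancel_NN[OF B(2,1) 3(4,2,3,1) lab[symmetric] mu(1)[symmetric] _ P _ ev] bd' mu by simp
      qed
    qed
  qed
qed

end

section \<open>The certificate of the main case\<close>

context main_case
begin

section \<open>Pairing across the matching\<close>

lemma M_mate:
  assumes "y \<in> \<Union>M"
  shows "\<exists>y'. {y, y'} \<in> M \<and> y' \<noteq> y"
proof -
  obtain e where e: "e \<in> M" "y \<in> e" using assms by auto
  then have "card e = 2" using ME card2 by blast
  then obtain a b where "e = {a, b}" "a \<noteq> b" by (meson card_2_iff)
  then show ?thesis using e by (metis doubleton_eq_iff insertE singletonD)
qed

definition mate where "mate y = (SOME y'. {y, y'} \<in> M \<and> y' \<noteq> y)"
definition sp where "sp y = (SOME s. s \<in> spec \<and> mu s = y)"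

lemma mate:
  assumes "y \<in> \<Union>M"
  shows "{y, mate y} \<in> M" "mate y \<noteq> y" "mate y \<in> \<Union>M" "mate (mate y) = y"
proof -
  have *: "{y, mate y} \<in> M \<and> mate y \<noteq> y" if "y \<in> \<Union>M" for y
    unfolding mate_def using M_mate[OF that] by (rule someI_ex)
  show 1: "{y, mate y} \<in> M" "mate y \<noteq> y" using *[OF assms] by auto
  then show 2: "mate y \<in> \<Union>M" by blast
  have "{mate y, mate (mate y)} \<in> M" "mate (mate y) \<noteq> mate y" using *[OF 2] by auto
  moreover have "{mate y, mate (mate y)} = {y, mate y}"
    using Mdisj[OF calculation(1) 1(1)] by auto
  ultimately show "mate (mate y) = y" by (metis doubleton_eq_iff)
qed

lemma sp:
  assumes "y \<in> \<Union>M"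
  shows "sp y \<in> spec" "mu (sp y) = y"
proof -
  have "\<exists>s. s \<in> spec \<and> mu s = y" using spec_at[OF assms] by blast
  then have "sp y \<in> spec \<and> mu (sp y) = y" unfolding sp_def by (rule someI_ex)
  then show "sp y \<in> spec" "mu (sp y) = y" by auto
qed

lemma sp_mu: "s \<in> spec \<Longrightarrow> sp (mu s) = s"
proof -
  assume s: "s \<in> spec"
  then have m: "mu s \<in> \<Union>M" by (simp add: spec_def)
  show ?thesis using spec_at[OF m] sp[OF m] s by blast
qed

lemma specM: "s \<in> spec \<Longrightarrow> mu s \<in> \<Union>M" and specB: "spec \<subseteq> B"
  by (auto simp: spec_def)

definition pair where "pair s = sp (mate (mu s))"

lemma pair:
  assumes "s \<in> spec"
  shows "pair s \<in> spec" "pair (pair s) = s" "pair s \<noteq> s" "mu (pair s) = mate (mu s)"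
proof -
  note m = specM[OF assms]
  note mm = mate[OF m]
  show "pair s \<in> spec" "mu (pair s) = mate (mu s)" using sp[OF mm(3)] by (auto simp: pair_def)
  then show "pair (pair s) = s" using mm(4) sp_mu[OF assms] by (simp add: pair_def)
  show "pair s \<noteq> s" using \<open>mu (pair s) = mate (mu s)\<close> mm(2) by metis
qed

lemma BS: "B - Tz = S \<union> spec" "S \<inter> spec = {}"
  using disjoint_parts(3) specB by (auto simp: S_def)

text \<open>Placing \<open>Y0\<close> first means that a vertex of \<open>Y0\<close> can have lower
  neighbours only in \<open>Y0\<close>; there are none because \<open>M\<close> is a maximal
  matching inside \<open>Z2\<close>. The shift exceeds every vertex and thus separates the two
  groups.\<close>

definition rank where "rank v = (if v \<in> Y0 then v else v + Suc (Max (insert 0 (\<Union>E))))"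

lemma finV: "finite (\<Union>E)"
  using finE card2 by (intro finite_Union) (auto intro: card_ge_0_finite)

lemma Y0U: "Y0 \<subseteq> \<Union>E - X" "Y0 \<subseteq> Z2" "Y0 \<inter> \<Union>M = {}" "Y0 \<inter> W = {}" "Y0 \<inter> Zc = {}" "Y0 \<subseteq> Z"
  using Z2Z ZU Z2D(2) by (auto simp: Y0_def Zc_def)

lemma rank_Y0: "v \<in> Y0 \<Longrightarrow> rank b < rank v \<Longrightarrow> b \<in> Y0"
proof (rule ccontr)
  assume v: "v \<in> Y0" "rank b < rank v" "b \<notin> Y0"
  have "v \<le> Max (insert 0 (\<Union>E))" using v(1) Y0U(1) finV by (intro Max_ge) auto
  then show False using v by (simp add: rank_def)
qed

lemma rank_inj: "inj_on rank (\<Union>E - X)"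
proof (rule inj_onI)
  fix v w assume vw: "v \<in> \<Union>E - X" "w \<in> \<Union>E - X" "rank v = rank w"
  have "v \<le> Max (insert 0 (\<Union>E))" "w \<le> Max (insert 0 (\<Union>E))" using vw finV by (auto intro!: Max_ge)
  then show "v = w" using vw(3) by (auto simp: rank_def split: if_splits)
qed

lemma MUU: "M \<subseteq> UU" using MU by auto

text \<open>For a cancelled stub both sides are zero, since \<open>pos s = lam s\<close> and
  \<open>sg s = 1\<close>.\<close>

lemma base_form: "s \<in> S \<Longrightarrow> form E (\<lambda>g. of_bool (s \<notin> canc) * unit s g) v = of_bool (v = lam s) - sg s * of_bool (v = pos s)"
proof -
  assume s: "s \<in> S"
  then have sB: "s \<in> B" and sE: "s \<in> E" using SB BE by auto
  have "form E (\<lambda>g. of_bool (s \<notin> canc) * unit s g) v = of_bool (s \<notin> canc) * of_bool (v \<in> s)"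
    unfolding form_scale form_unit[OF finE sE] ..
  then show ?thesis using cut_ends(2,3)[OF sB] unfolding B_in[OF sB] by (auto simp: sg_def pos_def)
qed

text \<open>Adding the equations for the two nodes over \<open>v\<close> undoes the splitting of
  vertices.\<close>

lemma trail_form:
  assumes p: "\<And>e. p e \<noteq> 0 \<Longrightarrow> e \<in> J1"
    and nodes: "\<And>x. (\<Sum>e\<in>J1. p e * of_bool (I e x)) = a * of_bool (x = \<nu> s) - b * of_bool (x = \<nu> s')"
  shows "form E p v = a * of_bool (v = pos s) - b * of_bool (v = pos s')"
proof -
  have "form E p v = (\<Sum>e\<in>J1. p e * of_bool (v \<in> e))"
    unfolding form_def using finE J1E p by (intro sum.mono_neutral_right) auto
  also have "\<dots> = (\<Sum>e\<in>J1. p e * of_bool (I e (v, False))) + (\<Sum>e\<in>J1. p e * of_bool (I e (v, True)))"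
    unfolding sum.distrib[symmetric] by (intro sum.cong) (auto simp: I_def)
  also have "\<dots> = a * of_bool (v = pos s) - b * of_bool (v = pos s')"
    unfolding nodes by (auto simp: \<nu>_def)
  finally show ?thesis .
qed

lemma card_le_2_of_pair: "A \<subseteq> {x, y} \<Longrightarrow> card A \<le> 2"
  by (rule order_trans[OF card_mono[of "{x, y}"]]) (auto simp: card_insert_if)

lemma main_certified: "certified E"
proof -
  have "\<exists>\<iota> \<eta> p. (\<forall>s\<in>S. \<iota> s \<in> S \<and> \<iota> (\<iota> s) = s \<and> \<iota> s \<noteq> s \<and> (\<eta> s = 1 \<or> \<eta> s = -1) \<and> \<eta> (\<iota> s) = \<eta> s \<and>
      (lam s \<noteq> lam (\<iota> s) \<or> \<eta> s = -1) \<and> (\<forall>e. p s e \<noteq> 0 \<longrightarrow> e \<in> J1) \<and>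
      (\<forall>x. (\<Sum>e\<in>J1. p s e * of_bool (I e x)) = sg s * of_bool (x = \<nu> s) - \<eta> s * sg (\<iota> s) * of_bool (x = \<nu> (\<iota> s)))) \<and>
    (\<forall>e. card {s \<in> S. p s e \<noteq> (0::int)} \<le> 2)"
  proof (rule stub_pairing[OF finJ1 finS])
    show "\<exists>x y. x \<noteq> y \<and> (\<forall>z. I e z \<longleftrightarrow> z = x \<or> z = y)" if "e \<in> J1" for e using two_nodes[OF that] .
    show "odd (card {s \<in> S. \<nu> s = x}) \<longleftrightarrow> odd (ideg I J1 x)" for x by (rule node_parity)
    show "sg s = 1 \<or> sg s = -1" for s by (simp add: sg_def)
    show "lam s \<noteq> lam s'" if "s \<in> S" "s' \<in> S" "s \<noteq> s'" "\<nu> s = \<nu> s'" for s s' using labels_distinct[OF that] .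
    show "sg s * sg s' * (-1) ^ card P = -1"
      if "s \<in> S" "s' \<in> S" "\<nu> s \<noteq> \<nu> s'" "\<And>r. r \<in> S \<Longrightarrow> \<nu> r = \<nu> s \<Longrightarrow> r = s" "\<And>r. r \<in> S \<Longrightarrow> \<nu> r = \<nu> s' \<Longrightarrow> r = s'"
        "lam s = lam s'" "P \<subseteq> J1" "\<And>x. odd (ideg I P x) \<longleftrightarrow> x = \<nu> s \<or> x = \<nu> s'" for s s' P
      using no_cancel[OF that] .
  qed
  then obtain \<iota> \<eta> and p :: "nat set \<Rightarrow> nat set \<Rightarrow> int" where
    pr: "\<forall>s\<in>S. \<iota> s \<in> S \<and> \<iota> (\<iota> s) = s \<and> \<iota> s \<noteq> s \<and> (\<eta> s = 1 \<or> \<eta> s = -1) \<and> \<eta> (\<iota> s) = \<eta> s \<and>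
      (lam s \<noteq> lam (\<iota> s) \<or> \<eta> s = -1) \<and> (\<forall>e. p s e \<noteq> 0 \<longrightarrow> e \<in> J1) \<and>
      (\<forall>x. (\<Sum>e\<in>J1. p s e * of_bool (I e x)) = sg s * of_bool (x = \<nu> s) - \<eta> s * sg (\<iota> s) * of_bool (x = \<nu> (\<iota> s)))"
    and pload: "\<forall>e. card {s \<in> S. p s e \<noteq> 0} \<le> 2"
    by (elim exE conjE)
  have \<gamma>': "\<forall>u\<in>\<Union>E - X. \<gamma> u \<in> X \<and> {\<gamma> u, u} \<in> E" using \<gamma> by blast
  obtain cU where cU: "\<forall>e\<in>UU. form E (cU e) (low rank e) = 1 \<and>
      (\<forall>v. v \<notin> X \<longrightarrow> rank v > rank (low rank e) \<longrightarrow> form E (cU e) v = 0)"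
    and lM: "\<forall>g\<in>M. load UU cU g = 0" and lU: "\<forall>g\<in>UU. load UU cU g \<le> 2"
    and lB: "\<forall>g\<in>B. load UU cU g \<le> (if g = {\<gamma> (mu g), mu g}
       then of_bool (\<exists>b. {b, mu g} \<in> UU - M \<and> rank b < rank (mu g)) + card {e \<in> M. low rank e = mu g} else 0)"
    using ground_columns[OF rank_inj \<gamma>' MUU] by (elim exE conjE)
  define b where "b s g = of_bool (s \<notin> canc) * unit s g" for s g
  \<comment> \<open>The contributions of \<open>s\<close> and of its partner leave values at
    \<open>pos s\<close> and \<open>pos (\<iota> s)\<close>; \<open>p s\<close> was constructed to
    cancel exactly these.\<close>
  define cS where "cS s g = (b s g + p s g) - \<eta> s * b (\<iota> s) g" for s g
  \<comment> \<open>The matching edge removes both outer ends and leaves 1 at the two labels: a pair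
    with sign -1, which cannot vanish.\<close>
  define cM where "cM s g = (unit s g - unit {mu s, mate (mu s)} g) + unit (pair s) g" for s g
  \<comment> \<open>Both edges share the outer end, so a difference of two labels remains; the
    hypothesis on \<open>W\<close> makes them distinct.\<close>
  define cT where "cT s g = unit s g - unit {\<gamma> (mu s), mu s} g" for s g
  define c where "c s = (if s \<in> S then cS s else if s \<in> spec then cM s else if s \<in> Tz then cT s else cU s)" for s
  define \<kappa> where "\<kappa> s = (if s \<in> S then \<iota> s else pair s)" for s
  define \<theta> where "\<theta> s = (if s \<in> S then \<eta> s else -1)" for s

  have bf: "form E (b s) v = of_bool (v = lam s) - sg s * of_bool (v = pos s)" if "s \<in> S" for s v
    using base_form[OF that, of v] unfolding b_def .
  have formS: "form E (c s) v = of_bool (v = lam s) - \<theta> s * of_bool (v = lam (\<kappa> s))" if s: "s \<in> S" for s v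
  proof -
    have i: "\<iota> s \<in> S" using pr s by blast
    have "form E (p s) v = sg s * of_bool (v = pos s) - \<eta> s * sg (\<iota> s) * of_bool (v = pos (\<iota> s))"
      using pr s by (intro trail_form) blast+
    then have "form E (cS s) v = of_bool (v = lam s) - \<eta> s * of_bool (v = lam (\<iota> s))"
      unfolding cS_def form_diff form_add form_scale bf[OF s] bf[OF i]
      by (simp add: algebra_simps)
    then show ?thesis using s by (simp add: c_def \<theta>_def \<kappa>_def)
  qed
  have formM: "form E (c s) v = of_bool (v = lam s) - \<theta> s * of_bool (v = lam (\<kappa> s))" if s: "s \<in> spec" for s v
  proof -
    have sS: "s \<notin> S" using s BS(2) by auto
    note pp = pair[OF s] and mm = mate[OF specM[OF s]]
    have B: "s \<in> B" "pair s \<in> B" using s pp(1) specB by auto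
    have E: "s \<in> E" "pair s \<in> E" "{mu s, mate (mu s)} \<in> E" using B BE ME[OF mm(1)] by auto
    have "form E (cM s) v = of_bool (v \<in> s) - of_bool (v \<in> {mu s, mate (mu s)}) + of_bool (v \<in> pair s)"
      unfolding cM_def form_diff form_add form_unit[OF finE E(1)] form_unit[OF finE E(2)] form_unit[OF finE E(3)] ..
    also have "\<dots> = of_bool (v = lam s) + of_bool (v = lam (pair s))"
    proof -
      have "lam s \<noteq> mu s" "lam s \<noteq> mate (mu s)" "lam (pair s) \<noteq> mu s" "lam (pair s) \<noteq> mate (mu s)"
        using cut_ends(2,3)[OF B(1)] cut_ends(2,3)[OF B(2)] pp(4) by metis+
      then show ?thesis unfolding B_in[OF B(1)] B_in[OF B(2)] pp(4) using mm(2) by auto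
    qed
    finally show ?thesis using s sS by (simp add: c_def \<theta>_def \<kappa>_def)
  qed
  have formT: "form E (c s) v = of_bool (v = lam s) - of_bool (v = \<gamma> (mu s))" if s: "s \<in> Tz" for s v
  proof -
    have no: "s \<notin> S" "s \<notin> spec" using s disjoint_parts by (auto simp: S_def)
    have B: "s \<in> B" using s TzB by auto
    note u = B_mem(3)[OF B]
    have E: "s \<in> E" "{\<gamma> (mu s), mu s} \<in> E" using B BE \<gamma>[OF u] by auto
    have "form E (cT s) v = of_bool (v \<in> s) - of_bool (v \<in> {\<gamma> (mu s), mu s})"
      unfolding cT_def form_diff form_unit[OF finE E(1)] form_unit[OF finE E(2)] ..
    also have "\<dots> = of_bool (v = lam s) - of_bool (v = \<gamma> (mu s))"
      unfolding B_in[OF B] using cut_ends(2,3)[OF B] \<gamma>[OF u] by auto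
    finally show ?thesis using s no by (simp add: c_def)
  qed
  have Bcases: "s \<in> S \<or> s \<in> spec \<or> s \<in> Tz" if "s \<in> B" for s using that by (auto simp: S_def)
  have pairing: "\<kappa> s \<in> S \<union> spec \<and> \<kappa> (\<kappa> s) = s \<and> \<kappa> s \<noteq> s \<and> (\<theta> s = 1 \<or> \<theta> s = -1) \<and> \<theta> (\<kappa> s) = \<theta> s \<and>
      (lam s \<noteq> lam (\<kappa> s) \<or> \<theta> s = -1)" if "s \<in> S \<union> spec" for s
  proof (cases "s \<in> S")
    case True
    then show ?thesis using pr[rule_format, OF True] by (auto simp: \<kappa>_def \<theta>_def)
  next
    case False
    then have "s \<in> spec" using that by auto
    moreover from this have "pair s \<notin> S" using pair(1) BS(2) by auto
    ultimately show ?thesis using False pair[of s] by (auto simp: \<kappa>_def \<theta>_def)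
  qed
  have finSS: "finite (S \<union> spec)" using finS specB finB by (auto intro: finite_subset)
  obtain P where P: "P \<subseteq> S \<union> spec" "P \<inter> \<kappa> ` P = {}" "P \<union> \<kappa> ` P = S \<union> spec"
    using involution_transversal[OF finSS, of \<kappa>] pairing by auto
  interpret sp: signed_pairing "S \<union> spec" \<kappa> \<theta> lam "\<lambda>s. form E (c s)" P
  proof
    show "finite (S \<union> spec)" by (rule finSS)
    show "P \<subseteq> S \<union> spec" "P \<inter> \<kappa> ` P = {}" "P \<union> \<kappa> ` P = S \<union> spec" by (fact P)+
    show "form E (c s) x = of_bool (x = lam s) - \<theta> s * of_bool (x = lam (\<kappa> s))" if "s \<in> S \<union> spec" for s x
      using that formS formM by blast
  qed (use pairing in blast)+
  have block: "permanent B (\<lambda>r s. form E (c s) (lam r)) \<noteq> 0"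
  proof (cases "W = {}")
    case True
    then have "Tz = {}" unfolding Tz_def by (rule if_P)
    then have "S \<union> spec = B" using BS(1) by blast
    then show ?thesis using sp.permanent_even by simp
  next
    case False
    then have t: "t0 \<in> Tz" "Tz = {t0}" by (auto simp: Tz_def)
    then have "B = insert t0 (S \<union> spec)" using BS(1) TzB by auto
    moreover have "permanent (insert t0 (S \<union> spec)) (\<lambda>r s. form E (c s) (lam r)) \<noteq> 0"
    proof (rule sp.permanent_odd)
      show "t0 \<notin> S \<union> spec" using t BS(1) by auto
      show "\<gamma> (mu t0) \<noteq> lam t0" using Tz_mem[OF t(1)] by metis
      show "form E (c t0) x = of_bool (x = lam t0) - of_bool (x = \<gamma> (mu t0))" for x using formT[OF t(1)] .
    qed
    ultimately show ?thesis by simp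
  qed
  have cUU: "c e = cU e" if "e \<in> UU" for e
    using that SB specB TzB BU by (auto simp: c_def)
  have perm: "permanent E (\<lambda>r s. form E (c s) (Min r) - form E (c s) (Max r)) \<noteq> 0"
  proof (rule permanent_assembly[where rank = rank and low = "low rank"])
    fix e assume e: "e \<in> UU"
    note lh = low_high[OF rank_inj e]
    show "low rank e \<in> e" using lh(1) by blast
    show "rank (low rank e) < rank v" if "v \<in> e" "v \<noteq> low rank e" for v
    proof -
      have "v = high rank e" using that lh(1) by blast
      then show ?thesis using lh(2) by simp
    qed
    show "form E (c e) (low rank e) = 1" using cU e cUU by simp
    show "form E (c e) v = 0" if "v \<notin> X" "rank (low rank e) < rank v" for v using that cU e cUU by simp
  next
    fix s v assume s: "s \<in> B" and v: "v \<notin> X"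
    have "\<kappa> s \<in> B" if "s \<in> S \<union> spec" using pairing[OF that] SB specB by auto
    then show "form E (c s) v = 0"
      using Bcases[OF s] formS[of s v] formM[of s v] formT[of s v] v cut_ends(2)[OF s] cut_ends(2)[of "\<kappa> s"] \<gamma>[OF B_mem(3)[OF s]]
      by auto
  qed (fact rank_inj block)+

  \<comment> \<open>Accounting of loads. For routed stubs, two units come from \<open>g\<close>
    itself occurring in the columns of the stub \<open>g\<close> and its partner, and two from the
    single trail through \<open>g\<close>.\<close>
  have ldU: "load UU c g = load UU cU g" for g by (rule load_cong) (simp add: cUU)
  have ldS: "load S c g \<le> (if g \<in> S - canc then 2 else 0) + (if g \<in> J1 then 2 else 0)" for g
  proof -
    have "{s \<in> S. c s g \<noteq> 0} \<subseteq> (if g \<in> S - canc then {g, \<iota> g} else {}) \<union> (if g \<in> J1 then {s \<in> S. p s g \<noteq> 0} else {})"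
    proof
      fix s assume "s \<in> {s \<in> S. c s g \<noteq> 0}"
      then have s: "s \<in> S" "cS s g \<noteq> 0" by (auto simp: c_def)
      consider "p s g \<noteq> 0" | "b s g \<noteq> 0" | "b (\<iota> s) g \<noteq> 0" 
        using s(2) by (cases "p s g = 0"; cases "b s g = 0"; cases "b (\<iota> s) g = 0") (auto simp: cS_def)
      then show "s \<in> (if g \<in> S - canc then {g, \<iota> g} else {}) \<union> (if g \<in> J1 then {s \<in> S. p s g \<noteq> 0} else {})"
      proof cases
        case 1
        then have "g \<in> J1" using pr[rule_format, OF s(1)] by blast
        then show ?thesis using 1 s(1) by simp
      next
        case 2
        then have "g = s" "s \<notin> canc" by (auto simp: b_def split: if_splits)
        then show ?thesis using s(1) by simp
      next
        case 3
        then have "g = \<iota> s" "g \<notin> canc" by (auto simp: b_def split: if_splits)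
        then show ?thesis using pr[rule_format, OF s(1)] by simp
      qed
    qed
    then have "load S c g \<le> card ((if g \<in> S - canc then {g, \<iota> g} else {}) \<union> (if g \<in> J1 then {s \<in> S. p s g \<noteq> 0} else {}))"
      unfolding load_def using finS by (intro card_mono) auto
    also have "\<dots> \<le> card (if g \<in> S - canc then {g, \<iota> g} else {}) + card (if g \<in> J1 then {s \<in> S. p s g \<noteq> 0} else {})"
      by (rule card_Un_le)
    also have "\<dots> \<le> (if g \<in> S - canc then 2 else 0) + (if g \<in> J1 then 2 else 0)"
      using pload card_le_2_of_pair[of "{g, \<iota> g}" g "\<iota> g"] by (intro add_mono) (auto simp del: card_insert_if)
    finally show ?thesis .
  qed
  have ldM: "load spec c g \<le> (if g \<in> spec \<or> g \<in> M then 2 else 0)" for g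
  proof -
    have col: "s = g \<or> {mu s, mate (mu s)} = g \<or> pair s = g" if "s \<in> spec" "c s g \<noteq> 0" for s
    proof (rule ccontr)
      assume "\<not> ?thesis"
      then have "g \<noteq> s" "g \<noteq> {mu s, mate (mu s)}" "g \<noteq> pair s" by blast+
      then have "cM s g = 0" by (simp add: cM_def)
      moreover have "s \<notin> S" using that(1) BS(2) by blast
      ultimately show False using that by (simp add: c_def)
    qed
    consider "g \<in> spec" | "g \<in> M" "g \<notin> spec" | "g \<notin> spec" "g \<notin> M" by blast
    then show ?thesis
    proof cases
      case 1
      have "{s \<in> spec. c s g \<noteq> 0} \<subseteq> {g, pair g}"
      proof
        fix s assume "s \<in> {s \<in> spec. c s g \<noteq> 0}"
        then have s: "s \<in> spec" "c s g \<noteq> 0" by auto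
        have "{mu s, mate (mu s)} \<noteq> g" using mate(1)[OF specM[OF s(1)]] MUU 1 specB BU by blast
        then show "s \<in> {g, pair g}" using col[OF s] pair(2)[OF s(1)] by auto
      qed
      then have "load spec c g \<le> 2" unfolding load_def by (rule card_le_2_of_pair)
      then show ?thesis using 1 by simp
    next
      case 2
      obtain y z where yz: "g = {y, z}" using ME[OF 2(1)] card2 by (meson card_2_iff)
      have "{s \<in> spec. c s g \<noteq> 0} \<subseteq> {sp y, sp z}"
      proof
        fix s assume "s \<in> {s \<in> spec. c s g \<noteq> 0}"
        then have s: "s \<in> spec" "c s g \<noteq> 0" by auto
        have "{mu s, mate (mu s)} = g" using col[OF s] 2(2) s(1) pair(1)[OF s(1)] by auto
        then have "mu s = y \<or> mu s = z" using yz by auto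
        then show "s \<in> {sp y, sp z}" using sp_mu[OF s(1)] by auto
      qed
      then have "load spec c g \<le> 2" unfolding load_def by (rule card_le_2_of_pair)
      then show ?thesis using 2 by simp
    next
      case 3
      have "c s g = 0" if "s \<in> spec" for s
        using col[OF that] 3 pair(1)[OF that] mate(1)[OF specM[OF that]] that by metis
      then have "{s \<in> spec. c s g \<noteq> 0} = {}" by blast
      then have "load spec c g = 0" unfolding load_def by (simp only: card.empty)
      then show ?thesis by simp
    qed
  qed
  have ldT: "load Tz c g \<le> of_bool (g \<in> Tz \<or> (\<exists>w\<in>W. g = {\<gamma> w, w}))" for g
  proof (cases "{s \<in> Tz. c s g \<noteq> 0} = {}")
    case True
    then have "load Tz c g = 0" unfolding load_def by (simp only: card.empty)
    then show ?thesis by simp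
  next
    case False
    then obtain s where s: "s \<in> Tz" "c s g \<noteq> 0" by blast
    moreover have "s \<notin> S" "s \<notin> spec" using s(1) disjoint_parts(3) unfolding S_def by blast+
    ultimately have "cT s g \<noteq> 0" by (simp add: c_def)
    then have "g = s \<or> g = {\<gamma> (mu s), mu s}" by (cases "g = s"; cases "g = {\<gamma> (mu s), mu s}") (simp_all add: cT_def)
    then have "g \<in> Tz \<or> (\<exists>w\<in>W. g = {\<gamma> w, w})" using s(1) Tz_mem[OF s(1)] by auto
    moreover have "card {s \<in> Tz. c s g \<noteq> 0} \<le> 1"
      by (rule order_trans[OF card_mono[of "{t0}"]]) (auto simp: Tz_def split: if_splits)
    ultimately show ?thesis by (simp add: load_def)
  qed
  have "load E c g \<le> 4" if g: "g \<in> E" for g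
  proof -
    have "E = (S \<union> spec) \<union> (Tz \<union> UU)" using EBU BS(1) TzB by blast
    then have "load E c g \<le> load (S \<union> spec) c g + load (Tz \<union> UU) c g" using load_Un by metis
    also have "\<dots> \<le> (load S c g + load spec c g) + (load Tz c g + load UU c g)"
      by (intro add_mono load_Un)
    finally have total: "load E c g \<le> (load S c g + load spec c g) + (load Tz c g + load UU cU g)" by (simp add: ldU)
    note bounds = ldS[of g] ldM[of g] ldT[of g]
    show ?thesis
    proof (cases "g \<in> UU")
      case True
      have "g \<notin> B" using True BU by auto
      then have no: "g \<notin> S" "g \<notin> spec" "g \<notin> Tz" using SB specB TzB by auto
      have noW: "\<not> (\<exists>w\<in>W. g = {\<gamma> w, w})"
      proof
        assume "\<exists>w\<in>W. g = {\<gamma> w, w}"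
        then obtain w where w: "w \<in> W" "g = {\<gamma> w, w}" by auto
        then have "w \<in> \<Union>E - X" using W B_mem(3) by blast
        then show False using \<gamma>_edge(1) w \<open>g \<notin> B\<close> by simp
      qed
      show ?thesis
      \<comment> \<open>An edge of \<open>M\<close> pays two units for routing and two for pairs in
        \<open>spec\<close>; any other edge outside the cut pays two for routing and two for its
        chain.\<close>
      proof (cases "g \<in> M")
        case True
        then have "load UU cU g = 0" using lM by auto
        then show ?thesis using total bounds no noW by (auto split: if_splits)
      next
        case False
        then have "load UU cU g \<le> 2" using lU \<open>g \<in> UU\<close> by auto
        then show ?thesis using total bounds no noW False by (auto split: if_splits)
      qed
    next
      case False
      then have gB: "g \<in> B" using g EBU by auto
      let ?u = "mu g"
      note u = B_mem(3)[OF gB]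
      have gM: "g \<notin> M" using False MUU by auto
      have J1: "g \<in> J1 \<longleftrightarrow> g \<in> J \<and> g \<notin> canc" using gM by (auto simp: J1_def)
      have w: "(\<exists>w\<in>W. g = {\<gamma> w, w}) \<longleftrightarrow> ?u \<in> W \<and> g = {\<gamma> ?u, ?u}"
      proof
        assume "\<exists>w\<in>W. g = {\<gamma> w, w}"
        then obtain w where w: "w \<in> W" "g = {\<gamma> w, w}" by auto
        then have "w \<in> \<Union>E - X" using W B_mem(3) by blast
        then have "?u = w" using \<gamma>_edge(2) w by simp
        then show "?u \<in> W \<and> g = {\<gamma> ?u, ?u}" using w by simp
      qed auto
      have cM1: "card {e \<in> M. low rank e = ?u} \<le> of_bool (?u \<in> \<Union>M)"
      proof -
        have "{e \<in> M. low rank e = ?u} \<subseteq> {e \<in> M. ?u \<in> e}"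
        proof
          fix e assume e: "e \<in> {e \<in> M. low rank e = ?u}"
          then have "e \<in> UU" using MUU by auto
          then have "low rank e \<in> e" using low_high(1)[OF rank_inj, of e] by blast
          then show "e \<in> {e \<in> M. ?u \<in> e}" using e by simp
        qed
        then have "card {e \<in> M. low rank e = ?u} \<le> dg M ?u" unfolding ideg_def using finM by (intro card_mono) auto
        then show ?thesis by (simp add: dgM)
      qed
      show ?thesis
      proof (cases "g = {\<gamma> ?u, ?u}")
        case False
        have U0: "load UU cU g = 0" using lB[rule_format, OF gB] unfolding if_not_P[OF False] by simp
        have "(g \<in> Tz \<or> (\<exists>w\<in>W. g = {\<gamma> w, w})) = (g \<in> Tz)" using False w by blast
        then have T: "load Tz c g \<le> of_bool (g \<in> Tz)" using ldT[of g] by (simp only:)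
        have "g \<in> S \<and> g \<notin> spec \<and> g \<notin> Tz \<or> g \<notin> S \<and> g \<in> spec \<and> g \<notin> Tz \<or> g \<notin> S \<and> g \<notin> spec \<and> g \<in> Tz"
          using Bcases[OF gB] disjoint_parts by (auto simp: S_def)
        then show ?thesis using total ldS[of g] ldM[of g] T U0 gM by (auto split: if_splits)
      next
        case True
        then have lam: "lam g = \<gamma> ?u" using eq_\<gamma>_edge[OF gB] by blast
        have gT: "g \<notin> Tz" using Tz_mem[of g] lam by auto
        have gS: "g \<notin> spec" using lam by (auto simp: spec_def)
        have Mb: "load spec c g = 0" using ldM[of g] gS gM by simp
        have Tb: "load Tz c g \<le> of_bool (?u \<in> W)" using ldT[of g] gT w by auto
        have Ub: "load UU cU g \<le> of_bool (\<exists>b. {b, ?u} \<in> UU - M \<and> rank b < rank ?u) + of_bool (?u \<in> \<Union>M)"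
          using lB[rule_format, OF gB] cM1 unfolding if_P[OF True] by linarith
        have Ub1: "load UU cU g \<le> 1 + of_bool (?u \<in> \<Union>M)" using Ub by (rule order_trans) simp
        \<comment> \<open>In \<open>Zc\<close> the edge is cancelled and pays at most one unit for
          the unpaired column and two for triangular columns. In \<open>Y0\<close> stubs and routing
          may take all four, since nothing is rooted there. Outside \<open>Z\<close> it is not
          routed along: two for the stubs, one for a chain and one for the unpaired column.\<close>
        consider "?u \<in> Zc" | "?u \<in> Y0" | "?u \<notin> Z" by (auto simp: Zc_def)
        then show ?thesis
        proof cases
          case 1
          then have "g \<in> canc" using gB lam by (simp add: canc_def)
          then have "load S c g = 0" using ldS[of g] J1 by simp
          moreover have "of_bool (?u \<in> W) \<le> (1::nat)" "of_bool (?u \<in> \<Union>M) \<le> (1::nat)" by simp_all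
          ultimately show ?thesis using total Mb Tb Ub1 by linarith
        next
          case 2
          have none: "(\<exists>b. {b, ?u} \<in> UU - M \<and> rank b < rank ?u) = False"
          proof (rule iffI)
            assume "\<exists>b. {b, ?u} \<in> UU - M \<and> rank b < rank ?u"
            then obtain b where b: "{b, ?u} \<in> UU - M" "rank b < rank ?u" by auto
            then have "b \<in> Y0" using rank_Y0[OF 2] by simp
            then have "{b, ?u} \<subseteq> Z2" "{b, ?u} \<inter> \<Union>M = {}" using 2 Y0U by auto
            then show False using Mmax[of "{b, ?u}"] b(1) UUE by blast
          qed simp
          have no: "(?u \<in> \<Union>M) = False" "(?u \<in> W) = False" using 2 Y0U by auto
          have "load UU cU g \<le> 0" using Ub unfolding none no by simp
          moreover have "load Tz c g \<le> 0" using Tb unfolding no by simp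
          moreover have "load S c g \<le> 4" using ldS[of g] by (auto split: if_splits)
          ultimately show ?thesis using total Mb by linarith
        next
          case 3
          then have "g \<notin> J" using \<gamma>J[OF u] True by simp
          then have "load S c g \<le> 2" using ldS[of g] J1 by (auto split: if_splits)
          moreover have "?u \<notin> \<Union>M" using 3 MZ2 Z2Z by auto
          then have "load UU cU g \<le> 1" using Ub1 by simp
          moreover have "of_bool (?u \<in> W) \<le> (1::nat)" by simp
          ultimately show ?thesis using total Mb Tb by linarith
        qed
      qed
    qed
  qed
  then show ?thesis using perm unfolding certified_def by blast
qed

end

section \<open>Choice of the cut and reduction to connected graphs\<close>

definition connected_edges :: "nat set set \<Rightarrow> bool" where
  "connected_edges E \<longleftrightarrow> (\<forall>A. A \<subseteq> E \<longrightarrow> A \<noteq> {} \<longrightarrow> A \<noteq> E \<longrightarrow> (\<exists>e\<in>A. \<exists>f\<in>E - A. e \<inter> f \<noteq> {}))"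

lemma connected_closed:
  assumes conn: "connected_edges E" and R: "\<And>e. e \<in> E \<Longrightarrow> e \<inter> R \<noteq> {} \<Longrightarrow> e \<subseteq> R"
    and v: "v \<in> R" "v \<in> \<Union>E"
  shows "\<Union>E \<subseteq> R"
proof -
  let ?A = "{e \<in> E. e \<inter> R \<noteq> {}}"
  have "?A = E"
  proof (rule ccontr)
    assume ne: "?A \<noteq> E"
    have sub: "?A \<subseteq> E" and nonempty: "?A \<noteq> {}" using v by auto
    have "?A \<subseteq> E \<longrightarrow> ?A \<noteq> {} \<longrightarrow> ?A \<noteq> E \<longrightarrow> (\<exists>e\<in>?A. \<exists>f\<in>E - ?A. e \<inter> f \<noteq> {})"
      using conn unfolding connected_edges_def by (rule spec)
    then have "\<exists>e\<in>?A. \<exists>f\<in>E - ?A. e \<inter> f \<noteq> {}" using sub nonempty ne by iprover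
    then obtain e f where ef: "e \<in> ?A" "f \<in> E - ?A" "e \<inter> f \<noteq> {}" by blast
    then have "e \<subseteq> R" using R by simp
    then show False using ef by blast
  qed
  then show ?thesis using R by blast
qed

text \<open>The exclusive disjunction makes \<open>P\<close> an even set when \<open>v = w\<close>,
  so the empty set starts the growth of the reachable set; each further edge is added modulo
  2.\<close>

lemma connected_path:
  assumes fin: "finite E" and two: "\<And>e. e \<in> E \<Longrightarrow> card e = 2" and conn: "connected_edges E"
    and v: "v \<in> \<Union>E" and w: "w \<in> \<Union>E"
  shows "\<exists>P\<subseteq>E. \<forall>y. odd (dg P y) \<longleftrightarrow> (y = v) \<noteq> (y = w)"
proof -
  define R where "R = {w. \<exists>P\<subseteq>E. \<forall>y. odd (dg P y) \<longleftrightarrow> (y = v) \<noteq> (y = w)}"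
  have vR: "v \<in> R" unfolding R_def by (auto intro!: exI[of _ "{}"] simp: ideg_def)
  have "\<Union>E \<subseteq> R"
  proof (rule connected_closed[OF conn _ vR v])
    fix e assume e: "e \<in> E" "e \<inter> R \<noteq> {}"
    then obtain a where a: "a \<in> e" "a \<in> R" by auto
    then obtain P where P: "P \<subseteq> E" "\<And>y. odd (dg P y) \<longleftrightarrow> (y = v) \<noteq> (y = a)" unfolding R_def by blast
    have finP: "finite P" using P fin by (auto intro: finite_subset)
    show "e \<subseteq> R"
    proof
      fix b assume b: "b \<in> e"
      show "b \<in> R"
      proof (cases "b = a")
        case False
        obtain c d where "e = {c, d}" using two[OF e(1)] by (meson card_2_iff)
        then have eab: "e = {a, b}" using a(1) b False by auto
        have "odd (dg (sym_diff P {e}) y) \<longleftrightarrow> (y = v) \<noteq> (y = b)" for y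
          unfolding odd_ideg_sym_diff[OF finP finite.insertI[OF finite.emptyI]] P(2) ideg_singleton
          using False by (auto simp: eab)
        moreover have "sym_diff P {e} \<subseteq> E" using P(1) e(1) by auto
        ultimately show ?thesis unfolding R_def by blast
      qed (use a in simp)
    qed
  qed
  then show ?thesis using w unfolding R_def by blast
qed

lemma odd_join_exists:
  assumes fin: "finite E" and two: "\<And>e. e \<in> E \<Longrightarrow> card e = 2" and conn: "connected_edges E"
    and T: "T \<subseteq> \<Union>E" "finite T" "even (card T)"
  shows "\<exists>J\<subseteq>E. \<forall>y. odd (dg J y) \<longleftrightarrow> y \<in> T"
  using T
proof (induction "card T" arbitrary: T rule: less_induct)
  case less
  show ?case
  proof (cases "T = {}")
    case True
    then show ?thesis by (intro exI[of _ "{}"]) (simp add: ideg_def)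
  next
    case False
    then obtain v where v: "v \<in> T" by auto
    have "T \<noteq> {v}" using less.prems(3) by auto
    then obtain w where w: "w \<in> T" "w \<noteq> v" using v by auto
    let ?T = "T - {v, w}"
    have c: "card ?T = card T - 2" using v w less.prems(2) by (subst card_Diff_subset) auto
    moreover have "card T > 0" using v less.prems(2) by (auto simp: card_gt_0_iff)
    ultimately have "card ?T < card T" by simp
    moreover have "even (card ?T)" using c less.prems(3) by simp
    ultimately obtain J where J: "J \<subseteq> E" "\<And>y. odd (dg J y) \<longleftrightarrow> y \<in> ?T"
      using less.hyps[of ?T] less.prems by blast
    obtain P where P: "P \<subseteq> E" "\<And>y. odd (dg P y) \<longleftrightarrow> (y = v) \<noteq> (y = w)"
      using connected_path[OF fin two conn, of v w] v w less.prems(1) by blast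
    have f: "finite J" "finite P" using J P fin by (auto intro: finite_subset)
    have "odd (dg (sym_diff J P) y) \<longleftrightarrow> y \<in> T" for y
      unfolding odd_ideg_sym_diff[OF f] J(2) P(2) using v w by auto
    moreover have "sym_diff J P \<subseteq> E" using J P by auto
    ultimately show ?thesis by blast
  qed
qed

text \<open>The cost \<open>?c\<close> orders odd joins lexicographically, by size and then by the
  part in \<open>D\<close>, as the second term is at most \<open>card E\<close>. The symmetric
  difference with an even set \<open>C\<close> is again an odd join and exchanges
  \<open>C \<inter> J\<close> for \<open>C - J\<close>.\<close>

lemma minimal_odd_join:
  assumes fin: "finite E" and ex: "\<exists>J\<subseteq>E. \<forall>y. odd (dg J y) \<longleftrightarrow> y \<in> T"
  shows "\<exists>J\<subseteq>E. (\<forall>y. odd (dg J y) \<longleftrightarrow> y \<in> T) \<and> (\<forall>C\<subseteq>E. (\<forall>v. even (dg C v)) \<longrightarrow>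
      card (C \<inter> J) \<le> card (C - J) \<and> (card (C \<inter> J) = card (C - J) \<longrightarrow> card (C \<inter> J \<inter> D) \<le> card ((C - J) \<inter> D)))"
proof -
  let ?P = "\<lambda>J. J \<subseteq> E \<and> (\<forall>y. odd (dg J y) \<longleftrightarrow> y \<in> T)"
  let ?c = "\<lambda>J. card J * Suc (card E) + card (J \<inter> D)"
  obtain J0 where "?P J0" using ex by blast
  then have "\<exists>J. ?P J \<and> (\<forall>K. ?P K \<longrightarrow> ?c J \<le> ?c K)" by (rule ex_has_least_nat)
  then obtain J where J: "J \<subseteq> E" "\<And>y. odd (dg J y) \<longleftrightarrow> y \<in> T" and min: "\<And>K. ?P K \<Longrightarrow> ?c J \<le> ?c K" by blast
  have "card (C \<inter> J) \<le> card (C - J) \<and> (card (C \<inter> J) = card (C - J) \<longrightarrow> card (C \<inter> J \<inter> D) \<le> card ((C - J) \<inter> D))"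
    if C: "C \<subseteq> E" and ev: "\<forall>v. even (dg C v)" for C
  proof -
    have f: "finite J" "finite C" using J C fin by (auto intro: finite_subset)
    let ?K = "sym_diff J C"
    have PK: "?P ?K"
    proof (intro conjI allI)
      show "?K \<subseteq> E" using J C by auto
      show "odd (dg ?K y) \<longleftrightarrow> y \<in> T" for y unfolding odd_ideg_sym_diff[OF f] J(2) using ev by simp
    qed
    have swap: "card (?K \<inter> F) + card (C \<inter> J \<inter> F) = card (J \<inter> F) + card ((C - J) \<inter> F)" for F
    proof -
      have 1: "card (?K \<inter> F) = card ((J - C) \<inter> F) + card ((C - J) \<inter> F)"
        using f by (subst card_Un_disjoint[symmetric]) (auto intro!: arg_cong[of _ _ card])
      have 2: "card (J \<inter> F) = card ((J - C) \<inter> F) + card (C \<inter> J \<inter> F)"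
        using f by (subst card_Un_disjoint[symmetric]) (auto intro!: arg_cong[of _ _ card])
      show ?thesis using 1 2 by simp
    qed
    have s1: "card ?K + card (C \<inter> J) = card J + card (C - J)" using swap[of UNIV] by simp
    have le: "?c J \<le> ?c ?K" by (rule min[OF PK])
    have KE: "card (?K \<inter> D) \<le> card E" using J C fin by (intro card_mono) auto
    have "card J \<le> card ?K"
    proof (rule ccontr)
      assume "\<not> ?thesis"
      then have "Suc (card ?K) \<le> card J" by simp
      then have "Suc (card ?K) * Suc (card E) \<le> card J * Suc (card E)" by (rule mult_le_mono1)
      then show False using le KE by simp
    qed
    then have "card (C \<inter> J) \<le> card (C - J)" using s1 by linarith
    moreover have "card (C \<inter> J \<inter> D) \<le> card ((C - J) \<inter> D)" if "card (C \<inter> J) = card (C - J)"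
    proof -
      have "card J = card ?K" using s1 that by linarith
      then have "card (J \<inter> D) \<le> card (?K \<inter> D)" using le by simp
      then show ?thesis using swap[of D] by linarith
    qed
    ultimately show ?thesis by blast
  qed
  then show ?thesis using J by blast
qed

lemma maximal_matching:
  assumes fin: "finite F" and ne: "{} \<notin> F"
  shows "\<exists>M\<subseteq>F. (\<forall>e\<in>M. \<forall>f\<in>M. e \<noteq> f \<longrightarrow> e \<inter> f = {}) \<and> (\<forall>e\<in>F. \<exists>f\<in>M. e \<inter> f \<noteq> {})"
proof -
  let ?P = "\<lambda>M. M \<subseteq> F \<and> (\<forall>e\<in>M. \<forall>f\<in>M. e \<noteq> f \<longrightarrow> e \<inter> f = {})"
  have "\<exists>M. ?P M \<and> (\<forall>N. ?P N \<longrightarrow> card N \<le> card M)"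
  proof (rule ex_has_greatest_nat[of ?P "{}" card "Suc (card F)"])
    show "\<forall>N. ?P N \<longrightarrow> card N < Suc (card F)" using fin by (auto intro: card_mono simp: less_Suc_eq_le)
  qed simp
  then obtain M where M: "M \<subseteq> F" "\<forall>e\<in>M. \<forall>f\<in>M. e \<noteq> f \<longrightarrow> e \<inter> f = {}"
    and max: "\<And>N. ?P N \<Longrightarrow> card N \<le> card M" by blast
  have "\<exists>f\<in>M. e \<inter> f \<noteq> {}" if e: "e \<in> F" for e
  proof (rule ccontr)
    assume no: "\<not> ?thesis"
    then have eM: "e \<notin> M" using e ne by (metis Int_absorb)
    have "?P (insert e M)" using M e no by blast
    then have "card (insert e M) \<le> card M" by (rule max)
    moreover have "finite M" using M fin by (auto intro: finite_subset)
    ultimately show False using eM by simp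
  qed
  then have "\<forall>e\<in>F. \<exists>f\<in>M. e \<inter> f \<noteq> {}" by (rule ballI)
  then show ?thesis using M(1,2) by (intro exI[of _ M] conjI)
qed

section \<open>Maximum independent sets and the marriage condition\<close>

definition independent_in :: "nat set set \<Rightarrow> nat set \<Rightarrow> bool" where
  "independent_in E X \<longleftrightarrow> X \<subseteq> \<Union>E \<and> (\<forall>e\<in>E. \<not> e \<subseteq> X)"

definition max_independent :: "nat set set \<Rightarrow> nat set \<Rightarrow> bool" where
  "max_independent E X \<longleftrightarrow> independent_in E X \<and> (\<forall>Y. independent_in E Y \<longrightarrow> card Y \<le> card X)"

lemma max_independent_exists:
  assumes "finite (\<Union>E)" "{} \<notin> E"
  shows "\<exists>X. max_independent E X"
  unfolding max_independent_def
proof (rule ex_has_greatest_nat[of "independent_in E" "{}" card "Suc (card (\<Union>E))"])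
  show "independent_in E {}" using assms(2) by (auto simp: independent_in_def)
  show "\<forall>Y. independent_in E Y \<longrightarrow> card Y < Suc (card (\<Union>E))"
    using assms(1) by (auto simp: independent_in_def less_Suc_eq_le intro: card_mono)
qed

lemma max_independent_neighbour:
  assumes X: "max_independent E X" and fin: "finite (\<Union>E)" and two: "\<And>e. e \<in> E \<Longrightarrow> card e = 2"
    and u: "u \<in> \<Union>E" "u \<notin> X"
  shows "\<exists>x\<in>X. {x, u} \<in> E"
proof (rule ccontr)
  assume no: "\<not> ?thesis"
  have ind: "independent_in E X" using X by (simp add: max_independent_def)
  have "independent_in E (insert u X)"
    unfolding independent_in_def
  proof (intro conjI ballI notI)
    show "insert u X \<subseteq> \<Union>E" using u ind by (auto simp: independent_in_def)
    fix e assume e: "e \<in> E" "e \<subseteq> insert u X"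
    obtain a b where ab: "e = {a, b}" "a \<noteq> b" using two[OF e(1)] by (meson card_2_iff)
    have "\<not> e \<subseteq> X" using ind e(1) by (simp add: independent_in_def)
    then show False using e ab no by (auto simp: insert_commute)
  qed
  then have "card (insert u X) \<le> card X" using X by (simp add: max_independent_def)
  moreover have "finite X" using ind fin by (auto simp: independent_in_def intro: finite_subset)
  ultimately show False using u by simp
qed

text \<open>Exchanging an element of \<open>X\<close> for one of its neighbours would yield another maximum
  independent set, so without a vertex having two neighbours in such a set no edge could leave the
  closed neighbourhood of an element of \<open>X\<close>.\<close>

lemma two_neighbours:
  assumes fin: "finite (\<Union>E)" and two: "\<And>e. e \<in> E \<Longrightarrow> card e = 2" and conn: "connected_edges E"
    and X: "max_independent E X" and x: "x \<in> X" "y \<in> X" "x \<noteq> y"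
  shows "\<exists>X u a b. max_independent E X \<and> u \<in> \<Union>E - X \<and> a \<in> X \<and> b \<in> X \<and> a \<noteq> b \<and> {a, u} \<in> E \<and> {b, u} \<in> E"
proof (rule ccontr)
  assume neg: "\<not> ?thesis"
  have uniq: "a = b" if "max_independent E X" "u \<in> \<Union>E - X" "a \<in> X" "b \<in> X" "{a, u} \<in> E" "{b, u} \<in> E" for X u a b
    using neg that by blast
  have ind: "X \<subseteq> \<Union>E" "\<And>e. e \<in> E \<Longrightarrow> \<not> e \<subseteq> X" using X by (auto simp: max_independent_def independent_in_def)
  have finX: "finite X" using ind(1) fin by (rule finite_subset)
  let ?R = "insert x {u \<in> \<Union>E - X. {x, u} \<in> E}"
  have "\<Union>E \<subseteq> ?R"
  proof (rule connected_closed[OF conn])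
    show "x \<in> ?R" "x \<in> \<Union>E" using x ind by auto
    fix e assume e: "e \<in> E" "e \<inter> ?R \<noteq> {}"
    then obtain a where a: "a \<in> e" "a \<in> ?R" by auto
    obtain c d where "e = {c, d}" "c \<noteq> d" using two[OF e(1)] by (meson card_2_iff)
    then obtain b where ab: "e = {a, b}" "a \<noteq> b" using a(1) by auto
    have bE: "b \<in> \<Union>E" using e ab by auto
    have "b \<in> ?R"
    proof (cases "a = x")
      case True
      then have "b \<notin> X" using ind(2)[OF e(1)] ab x by auto
      then show ?thesis using True ab e bE by simp
    next
      case False
      then have a': "a \<in> \<Union>E - X" "{x, a} \<in> E" using a by auto
      show ?thesis
      proof (cases "b \<in> X")
        case True
        have "{b, a} \<in> E" using e(1) ab by (simp add: insert_commute)
        then have "b = x" using uniq[OF X a'(1) True x(1)] a' by simp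
        then show ?thesis by simp
      next
        case False
        \<comment> \<open>By \<open>uniq\<close> the vertex \<open>a\<close> has no neighbour in
          \<open>X\<close> except \<open>x\<close>, so the exchange gives a maximum independent set.
          Now \<open>b\<close> has the neighbour \<open>a\<close> in \<open>?Y\<close> and may have
          no other there, so its neighbour in \<open>X\<close> can only be \<open>x\<close>.\<close>
        let ?Y = "insert a (X - {x})"
        have "independent_in E ?Y"
          unfolding independent_in_def
        proof (intro conjI ballI notI)
          show "?Y \<subseteq> \<Union>E" using a' ind by auto
          fix f assume f: "f \<in> E" "f \<subseteq> ?Y"
          obtain p q where pq: "f = {p, q}" "p \<noteq> q" using two[OF f(1)] by (meson card_2_iff)
          have "\<not> f \<subseteq> X" using ind(2) f by simp
          then obtain z where z: "z \<in> X - {x}" "f = {z, a}" using f pq by (auto simp: insert_commute)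
          then have "z = x" using uniq[OF X a'(1), of z x] f x a' by auto
          then show False using z by simp
        qed
        moreover have cY: "card ?Y = card X" using a' finX card.remove[OF finX x(1)] by simp
        ultimately have Y: "max_independent E ?Y" using X by (simp add: max_independent_def)
        obtain z where z: "z \<in> X" "{z, b} \<in> E" using max_independent_neighbour[OF X fin two bE False] by blast
        have "z = x"
        proof (rule ccontr)
          assume "z \<noteq> x"
          then have "a = z" using uniq[OF Y, of b a z] z e ab bE False by auto
          then show False using z a' by simp
        qed
        then show ?thesis using z bE False by simp
      qed
    qed
    then show "e \<subseteq> ?R" using a ab by simp
  qed
  then have "y \<in> ?R" using x(2) ind(1) by blast
  then show False using x by simp
qed

text \<open>\<open>S\<close> is peeled off by classes \<open>K\<close> of vertices connected through
  edges of \<open>J \<inter> B\<close>. Different classes have disjoint neighbourhoods in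
  \<open>X\<close>, and a class is independent by minimality of \<open>J\<close>. So
  \<open>K\<close> can replace its neighbours in \<open>X\<close>, and maximality of
  \<open>X\<close> gives \<open>card K\<close> at most the number of these neighbours.\<close>

lemma hall_condition:
  assumes cg: "cut_graph E X" and X: "max_independent E X" and fin: "finite (\<Union>E)"
    and JE: "J \<subseteq> E"
    and Jmin: "\<And>C. C \<subseteq> E \<Longrightarrow> (\<And>v. even (dg C v)) \<Longrightarrow> card (C \<inter> J) \<le> card (C - J)"
    and S: "S \<subseteq> {u \<in> \<Union>E - X. \<forall>s\<in>cut_graph.B E X. u \<in> s \<longrightarrow> s \<in> J}"
  shows "card S \<le> card (\<Union>u\<in>S. {x \<in> X. {x, u} \<in> E})"
  using S
proof (induction "card S" arbitrary: S rule: less_induct)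
  case less
  interpret cut_graph E X by fact
  let ?N = "\<lambda>S. \<Union>u\<in>S. {x \<in> X. {x, u} \<in> E}"
  have XE: "X \<subseteq> \<Union>E" and ind: "\<And>e. e \<in> E \<Longrightarrow> \<not> e \<subseteq> X" and Xmax: "\<And>Y. independent_in E Y \<Longrightarrow> card Y \<le> card X"
    using X by (auto simp: max_independent_def independent_in_def)
  have finX: "finite X" using XE fin by (rule finite_subset)
  have SU: "S \<subseteq> \<Union>E - X" and SJ: "\<And>u s. u \<in> S \<Longrightarrow> s \<in> B \<Longrightarrow> u \<in> s \<Longrightarrow> s \<in> J" using less.prems by auto
  have finS: "finite S" using SU fin by (auto intro: finite_subset)
  show ?case
  proof (cases "S = {}")
    case False
    then obtain s where s: "s \<in> S" by auto
    define K where "K = {s' \<in> S. \<exists>P\<subseteq>J \<inter> B. \<forall>y. odd (dg P y) \<longleftrightarrow> (y = s) \<noteq> (y = s')}"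
    have finJB: "finite (J \<inter> B)" using finB by simp
    have sK: "s \<in> K" unfolding K_def using s by (auto intro!: exI[of _ "{}"] simp: ideg_def)
    have KS: "K \<subseteq> S" by (auto simp: K_def)
    have finK: "finite K" using KS finS by (rule finite_subset)
    have step: "s'' \<in> K" if s': "s' \<in> K" "s'' \<in> S" "x \<in> X" "{x, s'} \<in> E" "{x, s''} \<in> E" for s' s'' x
    proof (cases "s' = s''")
      case False
      obtain P where P: "P \<subseteq> J \<inter> B" "\<And>y. odd (dg P y) \<longleftrightarrow> (y = s) \<noteq> (y = s')" using s'(1) by (auto simp: K_def)
      have finP: "finite P" using P(1) finJB by (rule finite_subset)
      let ?Q = "sym_diff P {{x, s'}}" and ?a = "{x, s'}" and ?b = "{x, s''}"
      have JB: "?a \<in> J \<inter> B" "?b \<in> J \<inter> B"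
        using SJ[of s' ?a] SJ[of s'' ?b] s' KS cutI[of x s'] cutI[of x s''] by auto
      have ne: "x \<noteq> s'" "x \<noteq> s''" using s' SU KS by auto
      have "?Q \<subseteq> J \<inter> B" using P(1) JB by blast
      moreover have "finite ?Q" using finP by simp
      ultimately have Q: "?Q \<subseteq> J \<inter> B" "finite ?Q" .
      have "odd (dg (sym_diff ?Q {?b}) y) \<longleftrightarrow> (y = s) \<noteq> (y = s'')" for y
        unfolding odd_ideg_sym_diff[OF Q(2) finite.insertI[OF finite.emptyI]]
          odd_ideg_sym_diff[OF finP finite.insertI[OF finite.emptyI]] P(2) ideg_singleton
        using ne False by auto
      moreover have "sym_diff ?Q {?b} \<subseteq> J \<inter> B" using Q JB by auto
      ultimately show ?thesis unfolding K_def using s'(2) by blast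
    qed (use s' in simp)
    have Kind: "{a, b} \<notin> E" if ab: "a \<in> K" "b \<in> K" "a \<noteq> b" for a b
    proof
      assume e: "{a, b} \<in> E"
      obtain P P' where P: "P \<subseteq> J \<inter> B" "\<And>y. odd (dg P y) \<longleftrightarrow> (y = s) \<noteq> (y = a)"
        and P': "P' \<subseteq> J \<inter> B" "\<And>y. odd (dg P' y) \<longleftrightarrow> (y = s) \<noteq> (y = b)" using ab by (auto simp: K_def)
      have finP: "finite P" "finite P'" using finite_subset[OF P(1) finJB] finite_subset[OF P'(1) finJB] .
      \<comment> \<open>An edge \<open>{a, b}\<close> inside \<open>K\<close> would close a set of
        cut edges of \<open>J\<close> to an even set \<open>?C\<close>. The edges of this set at
        \<open>a\<close> and at \<open>b\<close> are different, so at least two edges of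
        \<open>?C\<close> lie in \<open>J\<close>, against a single edge outside.\<close>
      let ?Q = "sym_diff P P'" and ?C = "insert {a, b} (sym_diff P P')"
      have "?Q \<subseteq> J \<inter> B" using P(1) P'(1) by blast
      moreover have "finite ?Q" using finP by simp
      ultimately have Q: "?Q \<subseteq> J \<inter> B" "finite ?Q" .
      have bd: "odd (dg ?Q y) \<longleftrightarrow> y = a \<or> y = b" for y
        unfolding odd_ideg_sym_diff[OF finP] P(2) P'(2) using ab(3) by auto
      have abX: "a \<notin> X" "b \<notin> X" using ab KS SU by auto
      then have eB: "{a, b} \<notin> B" by (auto simp: B_def)
      then have eQ: "{a, b} \<notin> ?Q" using Q by blast
      have "even (dg ?C y)" for y
        using ideg_insert[OF Q(2) eQ, of "\<lambda>e v. v \<in> e" y] bd[of y] by auto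
      moreover have "?C \<subseteq> E" using Q e BE by auto
      ultimately have le: "card (?C \<inter> J) \<le> card (?C - J)" using Jmin by blast
      have da: "dg ?Q a \<noteq> 0" using bd[of a] by (metis even_zero)
      have db: "dg ?Q b \<noteq> 0" using bd[of b] by (metis even_zero)
      obtain f where f: "f \<in> ?Q" "a \<in> f" using ideg_pos[OF da] by blast
      obtain h where h: "h \<in> ?Q" "b \<in> h" using ideg_pos[OF db] by blast
      have "mu f = a" "mu h = b" using cut_mem(2)[of f a] cut_mem(2)[of h b] f h Q(1) abX by auto
      then have "f \<noteq> h" using ab(3) by auto
      then have "card {f, h} = 2" by simp
      moreover have "card {f, h} \<le> card (?C \<inter> J)" using f h Q by (intro card_mono) auto
      moreover have "card (?C - J) \<le> card {{a, b}}" using Q(1) by (intro card_mono) auto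
      ultimately show False using le by simp
    qed
    let ?Y = "(X - ?N K) \<union> K"
    have NK: "?N K \<subseteq> X" by auto
    have "independent_in E ?Y"
      unfolding independent_in_def
    proof (intro conjI ballI notI)
      show "?Y \<subseteq> \<Union>E" using XE KS SU by auto
      fix f assume f: "f \<in> E" "f \<subseteq> ?Y"
      obtain p q where pq: "f = {p, q}" "p \<noteq> q" using card2[OF f(1)] by (meson card_2_iff)
      have mixed: False if "{p, q} \<in> E" "p \<in> X - ?N K" "q \<in> K" for p q using that by auto
      have "\<not> f \<subseteq> X" using ind f by simp
      then consider "p \<in> K" "q \<in> K" | "p \<in> X - ?N K" "q \<in> K" | "q \<in> X - ?N K" "p \<in> K" using f pq by auto
      then show False
        using Kind[of p q] mixed[of p q] mixed[of q p] f(1) pq by cases (auto simp: insert_commute)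
    qed
    then have "card ?Y \<le> card X" by (rule Xmax)
    moreover have "card ?Y = card (X - ?N K) + card K"
      using finX finK KS SU by (intro card_Un_disjoint) auto
    moreover have "card (X - ?N K) = card X - card (?N K)" using NK finX by (intro card_Diff_subset) (auto intro: finite_subset)
    moreover have "card (?N K) \<le> card X" using NK finX by (rule card_mono[rotated])
    ultimately have cK: "card K \<le> card (?N K)" by linarith
    have "card (S - K) < card S" using sK KS finS by (intro psubset_card_mono) auto
    then have cSK: "card (S - K) \<le> card (?N (S - K))" using less.hyps[of "S - K"] less.prems by blast
    have disj: "?N K \<inter> ?N (S - K) = {}" using step by blast
    have "card S = card K + card (S - K)" using KS finS finK by (metis card_Diff_subset card_mono le_add_diff_inverse)
    also have "\<dots> \<le> card (?N K) + card (?N (S - K))" using cK cSK by linarith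
    also have "\<dots> = card (?N K \<union> ?N (S - K))"
      using disj finX by (intro card_Un_disjoint[symmetric]) (auto intro: finite_subset)
    also have "\<dots> \<le> card (?N S)"
    proof (rule card_mono)
      show "finite (?N S)" by (rule finite_subset[OF _ finX]) blast
      show "?N K \<union> ?N (S - K) \<subseteq> ?N S" using KS by blast
    qed
    finally show ?thesis .
  qed simp
qed

lemma sum_dg_B:
  assumes "cut_graph E X" "finite (\<Union>E)"
  shows "(\<Sum>u\<in>\<Union>E - X. dg (cut_graph.B E X) u) = card (cut_graph.B E X)"
proof -
  interpret cut_graph E X by fact
  have "card B = (\<Sum>u\<in>\<Union>E - X. card {s \<in> B. mu s = u})"
    using B_mem(3) assms(2) finB by (subst card_eq_sum, subst sum.group[symmetric, of _ "\<Union>E - X" mu]) auto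
  also have "\<dots> = (\<Sum>u\<in>\<Union>E - X. dg B u)" by (intro sum.cong) (auto simp: dgB)
  finally show ?thesis by simp
qed

text \<open>The prescribed parities have a join only if their sum is even, and without
  \<open>W\<close> that sum has the parity of the number of cut edges. If it is odd, counting
  \<open>w\<close> once more repairs it; the two neighbours of \<open>w\<close> in \<open>X\<close>
  ensure a cut edge at \<open>w\<close> other than \<open>{\<gamma> w, w}\<close> for the unpaired
  column.\<close>

lemma certified_two_neighbours:
  assumes fin: "finite E" and two: "\<And>e. e \<in> E \<Longrightarrow> card e = 2" and conn: "connected_edges E"
    and X: "max_independent E X" and w: "w \<in> \<Union>E - X" "a \<in> X" "b \<in> X" "a \<noteq> b" "{a, w} \<in> E" "{b, w} \<in> E"
  shows "certified E"
proof -
  have finV: "finite (\<Union>E)" using fin two by (intro finite_Union) (auto intro: card_ge_0_finite)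
  have ind: "X \<subseteq> \<Union>E" "\<And>e. e \<in> E \<Longrightarrow> \<not> e \<subseteq> X" using X by (auto simp: max_independent_def independent_in_def)
  interpret cut_graph E X
  proof
    show "finite E" by (rule fin)
    show "card e = 2" if "e \<in> E" for e using two[OF that] .
    show "\<not> e \<subseteq> X" if "e \<in> E" for e using ind(2)[OF that] .
  qed
  define W where "W = (if even (card B) then {} else {w})"
  define T where "T = {u \<in> \<Union>E - X. odd (dg B u + of_bool (u \<in> W))}"
  have "even (card T)"
  proof -
    have "even (card T) \<longleftrightarrow> even (\<Sum>u\<in>\<Union>E - X. dg B u + of_bool (u \<in> W))"
      unfolding T_def using finV by (subst even_sum_iff) auto
    also have "(\<Sum>u\<in>\<Union>E - X. dg B u + of_bool (u \<in> W)) = card B + card W"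
    proof -
      have "(\<Sum>u\<in>\<Union>E - X. of_bool (u \<in> W)) = card W"
        using finV w by (simp add: W_def sum.If_cases of_bool_def)
      then show ?thesis using sum_dg_B[OF cut_graph_axioms finV] by (simp add: sum.distrib)
    qed
    finally show ?thesis by (simp add: W_def)
  qed
  moreover have "T \<subseteq> \<Union>E" unfolding T_def by blast
  moreover from this have "finite T" using finV by (rule finite_subset)
  ultimately have "\<exists>J\<subseteq>E. \<forall>y. odd (dg J y) \<longleftrightarrow> y \<in> T"
    using odd_join_exists[OF fin two conn, of T] by blast
  from minimal_odd_join[OF fin this, of UU] obtain J where J: "J \<subseteq> E" "\<And>y. odd (dg J y) \<longleftrightarrow> y \<in> T"
    and Jmin: "\<And>C. C \<subseteq> E \<Longrightarrow> (\<And>v. even (dg C v)) \<Longrightarrow>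
      card (C \<inter> J) \<le> card (C - J) \<and> (card (C \<inter> J) = card (C - J) \<longrightarrow> card (C \<inter> J \<inter> UU) \<le> card ((C - J) \<inter> UU))"
    by blast
  let ?Z = "{u \<in> \<Union>E - X. \<forall>s\<in>B. u \<in> s \<longrightarrow> s \<in> J}"
  let ?N = "\<lambda>u. {x \<in> X. {x, u} \<in> E}"
  have finX: "finite X" using ind(1) finV by (rule finite_subset)
  have "\<exists>\<phi>. inj_on \<phi> ?Z \<and> (\<forall>u\<in>?Z. \<phi> u \<in> ?N u)"
  proof (rule hall_marriage)
    show "finite ?Z" by (rule finite_subset[OF _ finV]) blast
    show "finite (?N u)" for u using finX by auto
    show "card S \<le> card (\<Union>(?N ` S))" if "S \<subseteq> ?Z" for S
      using hall_condition[OF cut_graph_axioms X finV J(1) _ that] Jmin by blast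
  qed
  then obtain \<phi> where \<phi>: "inj_on \<phi> ?Z" "\<And>u. u \<in> ?Z \<Longrightarrow> \<phi> u \<in> X \<and> {\<phi> u, u} \<in> E" by blast
  have outside: "\<exists>x\<in>X. {x, u} \<in> E \<and> {x, u} \<notin> J" if u: "u \<in> \<Union>E - X" "u \<notin> ?Z" for u
  proof -
    obtain s where s: "s \<in> B" "u \<in> s" "s \<notin> J" using u by blast
    then have "u = mu s" using cut_mem(2) u by blast
    then have "s = {lam s, u}" "lam s \<in> X" using cut_ends[OF s(1)] by auto
    then show ?thesis using s BE by (metis subsetD)
  qed
  \<comment> \<open>Outside \<open>?Z\<close> some cut edge at \<open>u\<close> avoids
    \<open>J\<close>, and such an edge is chosen as root, so it has room for triangular
    columns.\<close>
  define \<gamma> where "\<gamma> u = (if u \<in> ?Z then \<phi> u else (SOME x. x \<in> X \<and> {x, u} \<in> E \<and> {x, u} \<notin> J))" for u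
  have \<gamma>1: "\<gamma> u \<in> X \<and> {\<gamma> u, u} \<in> E \<and> {\<gamma> u, u} \<notin> J" if "u \<in> \<Union>E - X" "u \<notin> ?Z" for u
  proof -
    have "\<exists>x. x \<in> X \<and> {x, u} \<in> E \<and> {x, u} \<notin> J" using outside[OF that] by blast
    then have "(SOME x. x \<in> X \<and> {x, u} \<in> E \<and> {x, u} \<notin> J) \<in> X \<and> {(SOME x. x \<in> X \<and> {x, u} \<in> E \<and> {x, u} \<notin> J), u} \<in> E
        \<and> {(SOME x. x \<in> X \<and> {x, u} \<in> E \<and> {x, u} \<notin> J), u} \<notin> J" by (rule someI_ex)
    then show ?thesis unfolding \<gamma>_def if_not_P[OF that(2)] .
  qed
  have \<gamma>2: "\<gamma> u = \<phi> u" if "u \<in> ?Z" for u unfolding \<gamma>_def using that by (rule if_P)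
  define t0 where "t0 = (if a = \<gamma> w then {b, w} else {a, w})"
  have t0: "t0 \<in> B" "mu t0 = w" "lam t0 \<noteq> \<gamma> w"
    using w cutI[of a w] cutI[of b w] cut_eq[of a w "{a, w}"] cut_eq[of b w "{b, w}"] by (auto simp: t0_def)
  let ?Z2 = "{u \<in> ?Z. dg B u = 2 \<and> u \<notin> W \<and> (\<forall>g\<in>J. u \<in> g \<longrightarrow> g \<in> B)}"
  have "{} \<notin> {e \<in> E. e \<subseteq> ?Z2}" using two by force
  then obtain M where M: "M \<subseteq> {e \<in> E. e \<subseteq> ?Z2}" "\<forall>e\<in>M. \<forall>f\<in>M. e \<noteq> f \<longrightarrow> e \<inter> f = {}"
      "\<forall>e\<in>{e \<in> E. e \<subseteq> ?Z2}. \<exists>f\<in>M. e \<inter> f \<noteq> {}"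
    using maximal_matching[of "{e \<in> E. e \<subseteq> ?Z2}"] fin by auto
  have "main_case E X W J \<gamma> t0 M"
  proof unfold_locales
    show "t0 \<in> B \<and> W = {mu t0} \<and> lam t0 \<noteq> \<gamma> (mu t0)" if "W \<noteq> {}"
      using that t0 by (auto simp: W_def split: if_splits)
    show "J \<subseteq> E" by (rule J(1))
    show "odd (dg J v) \<longleftrightarrow> v \<in> \<Union>E - X \<and> odd (dg B v + of_bool (v \<in> W))" for v
      unfolding J(2) T_def by blast
    show "card (C \<inter> J) \<le> card (C - J) \<and> (card (C \<inter> J) = card (C - J) \<longrightarrow> card (C \<inter> J \<inter> UU) \<le> card ((C - J) \<inter> UU))"
      if "C \<subseteq> E" "\<And>v. even (dg C v)" for C using Jmin[OF that] .
    show "\<gamma> u \<in> X \<and> {\<gamma> u, u} \<in> E" if "u \<in> \<Union>E - X" for u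
      using \<gamma>1[OF that] \<gamma>2[of u] \<phi>(2)[of u] by (cases "u \<in> ?Z") (simp, blast)
    show "inj_on \<gamma> ?Z" using \<phi>(1) \<gamma>2 by (simp add: inj_on_def)
    show "{\<gamma> u, u} \<notin> J" if "u \<in> \<Union>E - X" "u \<notin> ?Z" for u using \<gamma>1[OF that] by blast
    show "e \<in> E \<and> e \<subseteq> ?Z2" if "e \<in> M" for e using M(1) that by blast
    show "e \<inter> f = {}" if "e \<in> M" "f \<in> M" "e \<noteq> f" for e f using M(2) that by blast
    show "\<exists>f\<in>M. e \<inter> f \<noteq> {}" if "e \<in> E" "e \<subseteq> ?Z2" for e using M(3) that by blast
  qed
  then show ?thesis by (rule main_case.main_certified)
qed

section \<open>Complete graphs\<close>

lemma derangement_map: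
  assumes fin: "finite (U :: nat set)" and "card U \<ge> 2"
  shows "\<exists>\<pi>. (\<forall>u\<in>U. \<pi> u \<in> U \<and> \<pi> u \<noteq> u) \<and> (\<forall>v. card {u \<in> U. \<pi> u = v} \<le> 2)"
proof -
  let ?G = "\<lambda>u. {v \<in> U. v > u}"
  \<comment> \<open>The cyclic successor in increasing order, the maximum being sent to the
    minimum.\<close>
  define \<pi> where "\<pi> u = (if ?G u = {} then Min U else Min (?G u))" for u
  have ne: "U \<noteq> {}" using assms by auto
  have MM: "Min U \<noteq> Max U"
  proof
    assume "Min U = Max U"
    then have "U \<subseteq> {Min U}" using fin by (metis Max_ge Min_le antisym singletonI subsetI)
    then have "card U \<le> card {Min U}" by (intro card_mono) auto
    then show False using assms(2) by simp
  qed
  have G: "Min (?G u) \<in> U \<and> u < Min (?G u)" if "?G u \<noteq> {}" for u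
    using Min_in[of "?G u"] that fin by simp
  have G0: "u = Max U" if "?G u = {}" "u \<in> U" for u
    using that fin ne by (metis (mono_tags, lifting) Max_ge Max_in antisym_conv1 empty_Collect_eq)
  have "\<pi> u \<in> U \<and> \<pi> u \<noteq> u" if "u \<in> U" for u
  proof (cases "?G u = {}")
    case True
    then show ?thesis using G0[OF True that] MM Min_in[OF fin ne] by (simp add: \<pi>_def)
  next
    case False
    then have "\<pi> u = Min (?G u)" unfolding \<pi>_def by (rule if_not_P)
    then show ?thesis using G[OF False] by simp
  qed
  moreover have "card {u \<in> U. \<pi> u = v} \<le> 2" for v
  proof -
    have uniq: "u = u'" if u: "u \<in> U" "?G u \<noteq> {}" "u' \<in> U" "?G u' \<noteq> {}" "\<pi> u = \<pi> u'" for u u'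
    proof -
      have aux: "\<not> u < u'" if u: "u \<in> U" "?G u \<noteq> {}" "u' \<in> U" "?G u' \<noteq> {}" "\<pi> u = \<pi> u'" for u u'
      proof
        assume "u < u'"
        then have "Min (?G u) \<le> u'" using u fin by (intro Min_le) auto
        moreover have "Min (?G u) = Min (?G u')" using u unfolding \<pi>_def if_not_P[OF u(2)] if_not_P[OF u(4)] by simp
        ultimately show False using G[OF u(4)] by simp
      qed
      show ?thesis using aux[OF u] aux[OF u(3,4,1,2) u(5)[symmetric]] by (metis linorder_less_linear)
    qed
    let ?A = "{u \<in> U. \<pi> u = v \<and> ?G u \<noteq> {}}"
    have "card ?A \<le> 1"
      using uniq fin by (subst card_le_Suc0_iff_eq[unfolded One_nat_def[symmetric]]) auto
    have "{u \<in> U. \<pi> u = v} \<subseteq> insert (Max U) ?A" using G0 by blast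
    then have "card {u \<in> U. \<pi> u = v} \<le> card (insert (Max U) ?A)" using fin by (intro card_mono) auto
    also have "\<dots> \<le> Suc (card ?A)" using fin by (simp add: card_insert_if)
    finally show ?thesis using \<open>card ?A \<le> 1\<close> by linarith
  qed
  ultimately show ?thesis by blast
qed

text \<open>With \<open>X = {z}\<close> all labels coincide, so differences of labels vanish.
  Instead each cut edge gets the column with value 2 at \<open>z\<close> and 0 elsewhere, and all
  entries of the block are 2. A cut edge is used by its own column, by at most two through \<pi> and
  by one chain; another edge is used by the columns of its two ends and by at most two triangular
  ones.\<close>

lemma certified_complete:
  assumes fin: "finite V" and card: "card V \<ge> 3" and E: "E = {e. e \<subseteq> V \<and> card e = 2}"
  shows "certified E"
proof -
  obtain z where z: "z \<in> V" using card by fastforce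
  let ?U = "V - {z}"
  have pairE: "{x, y} \<in> E \<longleftrightarrow> x \<in> V \<and> y \<in> V" if "x \<noteq> y" for x y using that by (auto simp: E)
  have finE: "finite E" using fin unfolding E by (auto intro: finite_subset[of _ "Pow V"])
  interpret cut_graph E "{z}"
  proof
    show "finite E" by (rule finE)
    show "card e = 2" if "e \<in> E" for e using that by (simp add: E)
    show "\<not> e \<subseteq> {z}" if "e \<in> E" for e
    proof
      assume "e \<subseteq> {z}"
      then have "card e \<le> card {z}" by (intro card_mono) auto
      then show False using that by (simp add: E)
    qed
  qed
  have VE: "\<Union>E - {z} \<subseteq> ?U" by (auto simp: E)
  have Bu: "mu s \<in> ?U" "s = {z, mu s}" "lam s = z" if "s \<in> B" for s
  proof -
    show "lam s = z" using cut_ends(2)[OF that] by simp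
    then show "s = {z, mu s}" using cut_ends(1)[OF that] by simp
    show "mu s \<in> ?U" using B_mem(3)[OF that] VE by auto
  qed
  have uB: "{z, u} \<in> B" "mu {z, u} = u" if "u \<in> ?U" for u
  proof -
    have "{z, u} \<in> E" using pairE[of z u] that z by auto
    then show "{z, u} \<in> B" by (intro cutI) auto
    show "mu {z, u} = u" using cut_eq[of z u "{z, u}"] that by auto
  qed
  have cU: "card ?U \<ge> 2" using card z fin by simp
  from derangement_map[OF finite_Diff[OF fin] cU]
  obtain \<pi> where "\<forall>u\<in>?U. \<pi> u \<in> ?U \<and> \<pi> u \<noteq> u" "\<forall>v. card {u \<in> ?U. \<pi> u = v} \<le> 2" by blast
  note \<pi> = this[rule_format]
  have inj: "inj_on id (\<Union>E - {z})" by simp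
  have \<gamma>: "\<forall>u\<in>\<Union>E - {z}. (\<lambda>_. z) u \<in> {z} \<and> {(\<lambda>_. z) u, u} \<in> E"
    using VE pairE z by fastforce
  have M: "{} \<subseteq> UU" by simp
  obtain cU where cU: "\<forall>e\<in>UU. form E (cU e) (low id e) = 1 \<and>
      (\<forall>v. v \<notin> {z} \<longrightarrow> id v > id (low id e) \<longrightarrow> form E (cU e) v = 0)"
    and "\<forall>g\<in>{}. load UU cU g = 0" and lU: "\<forall>g\<in>UU. load UU cU g \<le> 2"
    and lB: "\<forall>g\<in>B. load UU cU g \<le> (if g = {(\<lambda>_. z) (mu g), mu g}
       then of_bool (\<exists>b. {b, mu g} \<in> UU - {} \<and> id b < id (mu g)) + card {e \<in> {}. low id e = mu g} else 0)"
    using ground_columns[OF inj \<gamma> M] by (elim exE conjE)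
  \<comment> \<open>Two sides of the triangle on \<open>z\<close>, \<open>mu s\<close> and
    \<open>\<pi> (mu s)\<close> minus the third: the values at the outer vertices cancel.\<close>
  define cB where "cB s g = (unit s g + unit {z, \<pi> (mu s)} g) - unit {mu s, \<pi> (mu s)} g" for s g
  define c where "c s = (if s \<in> B then cB s else cU s)" for s
  have formB: "form E (c s) v = 2 * of_bool (v = z)" if s: "s \<in> B" for s v
  proof -
    let ?u = "mu s"
    have u: "?u \<in> ?U" "\<pi> ?u \<in> ?U" "\<pi> ?u \<noteq> ?u" using Bu[OF s] \<pi>(1) by auto
    have E: "s \<in> E" "{z, \<pi> ?u} \<in> E" "{?u, \<pi> ?u} \<in> E" using s BE pairE z u by auto
    have "form E (cB s) v = of_bool (v \<in> s) + of_bool (v \<in> {z, \<pi> ?u}) - of_bool (v \<in> {?u, \<pi> ?u})"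
      unfolding cB_def form_diff form_add form_unit[OF finE E(1)] form_unit[OF finE E(2)] form_unit[OF finE E(3)] ..
    also have "of_bool (v \<in> s) = (of_bool (v \<in> {z, ?u}) :: int)" using Bu(2)[OF s] by simp
    finally show ?thesis using u s by (auto simp: c_def)
  qed
  have cUU: "c e = cU e" if "e \<in> UU" for e using that BU by (auto simp: c_def)
  have perm: "permanent E (\<lambda>r s. form E (c s) (Min r) - form E (c s) (Max r)) \<noteq> 0"
  proof (rule permanent_assembly[where rank = id and low = "low id"])
    fix e assume e: "e \<in> UU"
    note lh = low_high[OF inj e]
    show "low id e \<in> e" using lh(1) by blast
    show "id (low id e) < id v" if "v \<in> e" "v \<noteq> low id e" for v
    proof -
      have "v = high id e" using that lh(1) by blast
      then show ?thesis using lh(2) by simp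
    qed
    show "form E (c e) (low id e) = 1" using cU e cUU by simp
    show "form E (c e) v = 0" if "v \<notin> {z}" "id (low id e) < id v" for v using that cU e cUU by simp
  next
    show "form E (c s) v = 0" if "s \<in> B" "v \<notin> {z}" for s v using formB[OF that(1)] that(2) by simp
    show "permanent B (\<lambda>r s. form E (c s) (lam r)) \<noteq> 0"
      by (rule permanent_ranked[OF finB, where rk = "\<lambda>_. 0" and c = "\<lambda>_. 2"]) (simp_all add: formB Bu)
  qed (rule inj)
  have "load E c g \<le> 4" if g: "g \<in> E" for g
  proof -
    have "load E c g \<le> load B c g + load UU c g" using load_Un[of B UU c g] unfolding EBU[symmetric] .
    moreover have "load UU c g = load UU cU g" by (rule load_cong) (simp add: cUU)
    ultimately have total: "load E c g \<le> load B c g + load UU cU g" by simp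
    have col: "s = g \<or> {z, \<pi> (mu s)} = g \<or> {mu s, \<pi> (mu s)} = g" if "s \<in> B" "c s g \<noteq> 0" for s
    proof (rule ccontr)
      assume "\<not> ?thesis"
      then have "g \<noteq> s" "g \<noteq> {z, \<pi> (mu s)}" "g \<noteq> {mu s, \<pi> (mu s)}" by blast+
      then have "cB s g = 0" by (simp add: cB_def)
      then show False using that by (simp add: c_def)
    qed
    show ?thesis
    proof (cases "g \<in> B")
      case True
      let ?F = "{u \<in> ?U. \<pi> u = mu g}"
      have "{s \<in> B. c s g \<noteq> 0} \<subseteq> insert g ((\<lambda>u. {z, u}) ` ?F)"
      proof
        fix s assume "s \<in> {s \<in> B. c s g \<noteq> 0}"
        then have s: "s \<in> B" "c s g \<noteq> 0" by auto
        note u = Bu[OF s(1)] and u' = \<pi>(1)[OF Bu(1)[OF s(1)]]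
        have "z \<in> g" using Bu(2)[OF True] by blast
        then have "{mu s, \<pi> (mu s)} \<noteq> g" using u(1) u' by auto
        then have "s = g \<or> \<pi> (mu s) = mu g" using col[OF s] uB(2)[of "\<pi> (mu s)"] u' by auto
        then show "s \<in> insert g ((\<lambda>u. {z, u}) ` ?F)" using u by auto
      qed
      then have "load B c g \<le> card (insert g ((\<lambda>u. {z, u}) ` ?F))"
        unfolding load_def using fin by (intro card_mono) auto
      also have "\<dots> \<le> Suc (card ((\<lambda>u. {z, u}) ` ?F))" using fin by (simp add: card_insert_if)
      also have "\<dots> \<le> Suc (card ?F)" using fin by (simp add: card_image_le)
      finally have "load B c g \<le> 3" using \<pi>(2)[of "mu g"] by linarith
      moreover have "load UU cU g \<le> 1"
        using lB[rule_format, OF True] by (rule order_trans) simp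
      ultimately show ?thesis using total by linarith
    next
      case False
      then have gU: "g \<in> UU" using g by (simp add: B_def UU_def)
      obtain a b where ab: "g = {a, b}" using card2[OF g] by (meson card_2_iff)
      have "{s \<in> B. c s g \<noteq> 0} \<subseteq> {{z, a}, {z, b}}"
      proof
        fix s assume "s \<in> {s \<in> B. c s g \<noteq> 0}"
        then have s: "s \<in> B" "c s g \<noteq> 0" by auto
        have "s \<noteq> g" using s False by auto
        moreover have "{z, \<pi> (mu s)} \<noteq> g" using gU by (auto simp: UU_def)
        ultimately have "mu s \<in> g" using col[OF s] by blast
        then show "s \<in> {{z, a}, {z, b}}" using Bu(2)[OF s(1)] ab by auto
      qed
      then have "load B c g \<le> card {{z, a}, {z, b}}" unfolding load_def by (intro card_mono) auto
      also have "\<dots> \<le> 2" by (simp add: card_insert_if)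
      finally show ?thesis using total lU gU by fastforce
    qed
  qed
  then show ?thesis using perm unfolding certified_def by blast
qed

section \<open>Connected graphs and reduction to components\<close>

lemma certified_connected:
  assumes fin: "finite E" and two: "\<And>e. e \<in> E \<Longrightarrow> card e = 2" and conn: "connected_edges E"
    and nice: "nice E" and ne: "E \<noteq> {}"
  shows "certified E"
proof -
  have finV: "finite (\<Union>E)" using fin two by (intro finite_Union) (auto intro: card_ge_0_finite)
  have "{} \<notin> E" using two by force
  then obtain X where X: "max_independent E X" using max_independent_exists[OF finV] by blast
  have ind: "X \<subseteq> \<Union>E" "\<And>Y. independent_in E Y \<Longrightarrow> card Y \<le> card X"
    using X by (auto simp: max_independent_def independent_in_def)
  show ?thesis
  proof (cases "\<exists>x\<in>X. \<exists>y\<in>X. x \<noteq> y")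
    case True
    then obtain x y where "x \<in> X" "y \<in> X" "x \<noteq> y" by blast
    from two_neighbours[OF finV two conn X this]
    obtain X u a b where "max_independent E X" "u \<in> \<Union>E - X" "a \<in> X" "b \<in> X" "a \<noteq> b" "{a, u} \<in> E" "{b, u} \<in> E"
      by blast
    then show ?thesis using certified_two_neighbours[OF fin two conn] by blast
  next
    case False
    have "card X \<le> 1"
      using False ind(1) finV by (subst card_le_Suc0_iff_eq[unfolded One_nat_def[symmetric]]) (auto intro: finite_subset)
    have adj: "{x, y} \<in> E" if "x \<in> \<Union>E" "y \<in> \<Union>E" "x \<noteq> y" for x y
    proof (rule ccontr)
      assume no: "{x, y} \<notin> E"
      have "independent_in E {x, y}"
        unfolding independent_in_def
      proof (intro conjI ballI notI)
        show "{x, y} \<subseteq> \<Union>E" using that by auto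
        fix e assume e: "e \<in> E" "e \<subseteq> {x, y}"
        have "e = {x, y}" using two[OF e(1)] e(2) that(3) by (intro card_subset_eq) auto
        then show False using no e(1) by simp
      qed
      then have "card {x, y} \<le> card X" by (rule ind(2))
      then show False using that(3) \<open>card X \<le> 1\<close> by simp
    qed
    have E: "E = {e. e \<subseteq> \<Union>E \<and> card e = 2}"
    proof (intro equalityI subsetI)
      fix e assume "e \<in> E"
      then show "e \<in> {e. e \<subseteq> \<Union>E \<and> card e = 2}" using two by auto
    next
      fix e assume "e \<in> {e. e \<subseteq> \<Union>E \<and> card e = 2}"
      then obtain x y where "e = {x, y}" "x \<noteq> y" "e \<subseteq> \<Union>E" by (auto simp: card_2_iff)
      then show "e \<in> E" using adj by auto
    qed
    \<comment> \<open>On two vertices the graph would be a single edge, which is isolated; this is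
      where \<open>nice\<close> is needed.\<close>
    have "card (\<Union>E) \<ge> 3"
    proof (rule ccontr)
      assume "\<not> ?thesis"
      then have le: "card (\<Union>E) \<le> 2" by simp
      obtain e where e: "e \<in> E" using ne by auto
      have sub: "f = \<Union>E" if "f \<in> E" for f
        using that two le finV by (intro card_seteq) auto
      have "E = {e}" using sub e by blast
      then have "inc_edges E v = {e}" if "v \<in> e" for v using that by (auto simp: inc_edges_def)
      then have "isolated_edge E e" using e by (simp add: isolated_edge_def deg_def)
      then show False using nice e by (auto simp: nice_def)
    qed
    then show ?thesis by (rule certified_complete[OF finV _ E])
  qed
qed

lemma certified_nice:
  assumes "finite E" "\<And>e. e \<in> E \<Longrightarrow> card e = 2" "nice E"
  shows "certified E"
  using assms
proof (induction "card E" arbitrary: E rule: less_induct)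
  case less
  note fin = less.prems(1) and two = less.prems(2) and nice = less.prems(3)
  show ?case
  proof (cases "E = {}")
    case True
    then show ?thesis by (simp add: certified_def permanent_def)
  next
    case ne: False
    show ?thesis
    proof (cases "connected_edges E")
      case True
      then show ?thesis using certified_connected fin two nice ne by blast
    next
      case False
      then have "\<exists>A. A \<subseteq> E \<and> A \<noteq> {} \<and> A \<noteq> E \<and> \<not> (\<exists>e\<in>A. \<exists>f\<in>E - A. e \<inter> f \<noteq> {})"
        unfolding connected_edges_def by (simp only: not_all not_imp)
      then obtain A where A: "A \<subseteq> E" "A \<noteq> {}" "A \<noteq> E" and no: "\<not> (\<exists>e\<in>A. \<exists>f\<in>E - A. e \<inter> f \<noteq> {})"
        by (elim exE conjE)
      have sep: "\<forall>e\<in>A. \<forall>f\<in>E - A. e \<inter> f = {}" using no by blast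
      have part: "certified F" if F: "F \<subset> E" "\<forall>e\<in>F. \<forall>f\<in>E - F. e \<inter> f = {}" for F
      proof (rule less.hyps)
        show "card F < card E" using F fin by (intro psubset_card_mono) auto
        show "finite F" using F fin by (auto intro: finite_subset)
        show "card e = 2" if "e \<in> F" for e using that F two by auto
        \<comment> \<open>\<open>F\<close> is separated from the other edges, so degrees at its
          vertices are the same in \<open>F\<close> and in \<open>E\<close>.\<close>
        show "nice F"
          unfolding nice_def
        proof
          assume "\<exists>e\<in>F. isolated_edge F e"
          then obtain e where e: "e \<in> F" "\<forall>v\<in>e. deg F v = 1" by (auto simp: isolated_edge_def)
          have "deg E v = deg F v" if "v \<in> e" for v
          proof -
            have "inc_edges E v = inc_edges F v" using that e(1) F by (auto simp: inc_edges_def)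
            then show ?thesis by (simp add: deg_def)
          qed
          then have "isolated_edge E e" using e F by (auto simp: isolated_edge_def)
          then show False using nice e F by (auto simp: nice_def)
        qed
      qed
      have EA: "E - (E - A) = A" "A \<union> (E - A) = E" using A(1) by blast+
      have "certified A" using A(1,3) sep by (intro part) blast+
      moreover have "certified (E - A)"
      proof (rule part)
        show "E - A \<subset> E" using A(1,2) by blast
        show "\<forall>e\<in>E - A. \<forall>f\<in>E - (E - A). e \<inter> f = {}" unfolding EA(1) using sep by blast
      qed
      moreover have "finite A" "finite (E - A)" using A(1) fin by (auto intro: finite_subset)
      ultimately have "certified (A \<union> (E - A))"
        using sep two A(1) by (intro certified_disjoint_Un) blast+
      then show ?thesis unfolding EA(2) .
    qed
  qed
qed

theorem theorem5p1:
  fixes n :: nat and E :: "nat set set"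
  assumes "simple_graph n E" and "nice E"
  shows "alg_choosable E 5"
proof -
  have "E \<subseteq> Pow {1..n}" "\<And>e. e \<in> E \<Longrightarrow> card e = 2" using assms(1) by (auto simp: simple_graph_def)
  moreover from this have "finite E" by (auto intro: finite_subset)
  ultimately show ?thesis using certified_imp_alg_choosable certified_nice assms(2) by blast
qed

end
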